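(* Let $d\ge2$, $\theta>0$, and let $\bm{p}=(p_1,\ldots,p_d)$ be a probability distribution with positive entries. Let $\bm{u}=\{u^{(l)}\}_{l=0}^{d-1}$ be an orthogonal basis on $\bm{p}$ with $u^{(0)}\equiv1$, $\sum_{j=1}^du_j^{(k)}u_j^{(l)}p_j=\delta_{kl}a_k$, scaled so that $u_d^{(r)}=1$ for $r=0,\ldots,d-1$, and suppose that it satisfies the hypergroup property $$\mathfrak{s}(j,k,l)=\sum_{r=0}^{d-1}a_r^{-1}u_j^{(r)}u_k^{(r)}u_l^{(r)}\ge0,\qquad j,k,l=1,\ldots,d.$$ Let $\{\rho_{\bm{n}}\}_{\bm{n}\in\mathbb{Z}_+^d}$, $\rho_{\bm{0}}=1$, be real numbers not depending on $\alpha$, and consider $$P(\bm{x};\alpha,\theta,\bm{p})P(\bm{y};\alpha,\theta,\bm{p})\Big\{1+\sum_{|\bm{n}|\ge1}\rho_{\bm{n}}h_{\bm{n}}(\alpha,\theta,\bm{u})M_{\bm{n}}(\bm{x};\alpha,\theta,\bm{p},\bm{u})M_{\bm{n}}(\bm{y};\alpha,\theta,\bm{p},\bm{u})\Big\},\quad \bm{x},\bm{y}\in\mathbb{Z}_+^d.\qquad(\ast)$$ Expression $(\ast)$ is non-negative, and thus a proper bivariate negative binomial distribution, for all $\alpha>0$ if and only if $$\rho_{\bm{n}}=\mathbb{E}_{\bm{\xi}}\Big[\prod_{j=0}^{d-1}\rho_j(\bm{\xi})^{n_j}\Big],\quad \bm{n}\in\mathbb{Z}_+^d,\qquad \rho_j(\bm{\xi})=\sum_{i=1}^{d}u_i^{(j)}\xi_i,\qquad(\ast\ast)$$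 for a random vector $\bm{\xi}$ in the unit simplex $\{\xi_i\ge0,\ \sum_{i=1}^d\xi_i\le1\}$ satisfying a set of conditions, as follows. (1) If $(\ast)$ is non-negative for all $\alpha>0$, then $(\ast\ast)$ holds for some random vector $\bm{\xi}$ in the unit simplex. (2) If $\bm{\xi}$ is non-random and $\rho_{\bm{n}}=\prod_{j=0}^{d-1}\rho_j(\bm{\xi})^{n_j}$ for all $\bm{n}$, then $(\ast)$ is non-negative for all $\alpha>0$ if and only if $$p_{ij}(\bm{\omega})\ \ge\ \frac{\theta(1-|\bm{\xi}|)}{1+\theta(1-|\bm{\xi}|)}\,p_ip_j,\qquad i,j=1,\ldots,d,\qquad(\ast\ast\ast)$$ where $\bm{\omega}=\bm{\xi}/|\bm{\xi}|$ and $p_{ij}(\bm{\omega})=p_ip_j\sum_{l=1}^d\omega_l\,\mathfrak{s}(i,j,l)$. (3) If $\bm{\xi}$ is random, $(\ast\ast)$ holds, and $(\ast\ast\ast)$ holds (almost surely), then $(\ast)$ is non-negative for all $\alpha>0$.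
   Context: For a vector $\bm{z}$, $|\bm{z}|$ denotes the sum of its entries. Multivariate Meixner (negative binomial) distribution: for $\alpha,\theta>0$ and $\bm{x}\in\mathbb{Z}_+^d$, $$P(\bm{x};\alpha,\theta,\bm{p})=\frac{\Gamma(\alpha+|\bm{x}|)}{\Gamma(\alpha)|\bm{x}|!}\,\frac{\theta^{|\bm{x}|}}{(1+\theta)^{\alpha+|\bm{x}|}}\binom{|\bm{x}|}{\bm{x}}\prod_{i=1}^dp_i^{x_i}.$$ A bivariate negative binomial distribution means a joint distribution of $(\bm{X},\bm{Y})$ in which each of $\bm{X},\bm{Y}$ has marginal distribution $P(\cdot;\alpha,\theta,\bm{p})$. A basis $\bm{u}$ is a complete set of real orthogonal functions on $\{1,\ldots,d\}$ with respect to $\bm{p}$; $a_0=1$. Multivariate Meixner polynomials: for $\bm{n}=(n_0,\ldots,n_{d-1})\in\mathbb{Z}_+^d$, $M_{\bm{n}}(\bm{X};\alpha,\theta,\bm{p},\bm{u})$ is the coefficient of $w_0^{n_0}\cdots w_{d-1}^{n_{d-1}}$ in $$(1-w_0)^{-(|\bm{X}|+\alpha)}\prod_{i=1}^d\Big(1-w_0\frac{1+\theta}{\theta}+\sum_{j=1}^{d-1}u_i^{(j)}w_j\Big)^{X_i}.$$ They are orthogonal on $P(\cdot;\alpha,\theta,\bm{p})$, with $\mathbb{E}[M_{\bm{m}}M_{\bm{n}}]=\delta_{\bm{m}\bm{n}}h_{\bm{n}}(\alpha,\theta,\bm{u})^{-1}$, where $$h_{\bm{n}}(\alpha,\theta,\bm{u})^{-1}=\frac{\Gamma(|\bm{n}|+\alpha)}{\Gamma(\alpha)n_0!\cdots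 n_{d-1}!}\Big(\frac{1+\theta}{\theta}\Big)^{n_0}\theta^{|\bm{n}|-n_0}\prod_{j=1}^{d-1}a_j^{n_j}.$$ In a Lancaster expansion the coefficients $\rho_{\bm{n}}$ are by definition the correlation sequence of the pair: $\mathbb{E}[M_{\bm{m}}(\bm{X})M_{\bm{n}}(\bm{Y})]=\delta_{\bm{m}\bm{n}}\rho_{\bm{n}}h_{\bm{n}}(\alpha,\theta,\bm{u})^{-1}$. When $|\bm{\xi}|=0$, $\bm{\omega}$ is undefined; condition $(\ast\ast\ast)$ is then regarded as vacuous (this is the case of independent $\bm{X},\bm{Y}$). *)

theory Defs
  imports "HOL-Probability.Probability" "HOL-Library.Poly_Mapping"
begin

text \<open>
  Vectors of length \<open>d\<close> are indexed by a finite type \<open>'d\<close> with \<open>CARD('d) = d\<close>. The same type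
  labels the points \<open>1, \<dots>, d\<close> and the basis functions \<open>0, \<dots>, d - 1\<close>; the parameter \<open>z\<close> is the
  label of the constant basis function and \<open>e\<close> is the point
  at which the basis is normalised. The value of the basis function with label \<open>l\<close>
  at the point \<open>i\<close> is \<open>u l $ i\<close>. Multi-indices and states in \<open>\<int>\<^sub>+\<^sup>d\<close> have type \<open>'d \<Rightarrow> nat\<close>.
\<close>

definition total :: "('d::finite \<Rightarrow> 'b::comm_monoid_add) \<Rightarrow> 'b" where
  "total v = (\<Sum>i\<in>UNIV. v i)"

definition nb_prob :: "real \<Rightarrow> real \<Rightarrow> real^'d::finite \<Rightarrow> ('d \<Rightarrow> nat) \<Rightarrow> real" where
  "nb_prob \<alpha> \<theta> p x =
     Gamma (\<alpha> + real (total x)) / (Gamma \<alpha> * fact (total x))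
     * (\<theta> ^ total x / (1 + \<theta>) powr (\<alpha> + real (total x)))
     * (fact (total x) / (\<Prod>i\<in>UNIV. fact (x i)))
     * (\<Prod>i\<in>UNIV. (p $ i) ^ x i)"

definition bivariate_nb ::
    "real \<Rightarrow> real \<Rightarrow> real^'d::finite \<Rightarrow> (('d \<Rightarrow> nat) \<times> ('d \<Rightarrow> nat)) pmf \<Rightarrow> bool" where
  "bivariate_nb \<alpha> \<theta> p J \<longleftrightarrow>
     (\<forall>x. pmf (map_pmf fst J) x = nb_prob \<alpha> \<theta> p x) \<and>
     (\<forall>y. pmf (map_pmf snd J) y = nb_prob \<alpha> \<theta> p y)"

text \<open>
  Real polynomials in the variables \<open>w\<^sub>j\<close>, with \<open>j\<close> ranging over \<open>'d\<close>, are finitely supported maps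
  from monomials \<open>'d \<Rightarrow>\<^sub>0 nat\<close> to coefficients; multiplication is convolution.
\<close>

definition w_const :: "real \<Rightarrow> ('d \<Rightarrow>\<^sub>0 nat) \<Rightarrow>\<^sub>0 real" where
  "w_const c = Poly_Mapping.single 0 c"

definition w_var :: "'d \<Rightarrow> ('d \<Rightarrow>\<^sub>0 nat) \<Rightarrow>\<^sub>0 real" where
  "w_var j = Poly_Mapping.single (Poly_Mapping.single j 1) 1"

definition w_coeff :: "(('d::finite \<Rightarrow>\<^sub>0 nat) \<Rightarrow>\<^sub>0 real) \<Rightarrow> ('d \<Rightarrow> nat) \<Rightarrow> real" where
  "w_coeff q n = Poly_Mapping.lookup q (Abs_poly_mapping n)"

definition meixner_factor ::
    "real \<Rightarrow> ('d::finite \<Rightarrow> real^'d) \<Rightarrow> 'd \<Rightarrow> 'd \<Rightarrow> ('d \<Rightarrow>\<^sub>0 nat) \<Rightarrow>\<^sub>0 real" where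
  "meixner_factor \<theta> u z i =
     1 - w_const ((1 + \<theta>) / \<theta>) * w_var z + (\<Sum>j\<in>UNIV - {z}. w_const (u j $ i) * w_var j)"

text \<open>
  The generating function is the product of a polynomial and of the binomial series
  \<open>(1 - w\<^sub>z) powr (- \<beta>) = (\<Sum>k. (- 1) ^ k * ((- \<beta>) gchoose k) * w\<^sub>z ^ k)\<close> with
  \<open>\<beta> = \<alpha> + total x\<close>. Its coefficient at \<open>n\<close> is a finite convolution, since only the exponent
  of \<open>w\<^sub>z\<close> is shared.
\<close>

definition meixner ::
    "real \<Rightarrow> real \<Rightarrow> ('d::finite \<Rightarrow> real^'d) \<Rightarrow> 'd \<Rightarrow> ('d \<Rightarrow> nat) \<Rightarrow> ('d \<Rightarrow> nat) \<Rightarrow> real" where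
  "meixner \<alpha> \<theta> u z n x =
     (\<Sum>k\<le>n z. (- 1) ^ k * ((- (real (total x) + \<alpha>)) gchoose k)
        * w_coeff (\<Prod>i\<in>UNIV. meixner_factor \<theta> u z i ^ x i) (n(z := n z - k)))"

definition meixner_h ::
    "real \<Rightarrow> real \<Rightarrow> ('d::finite \<Rightarrow> real) \<Rightarrow> 'd \<Rightarrow> ('d \<Rightarrow> nat) \<Rightarrow> real" where
  "meixner_h \<alpha> \<theta> a z n = inverse
     (Gamma (real (total n) + \<alpha>) / (Gamma \<alpha> * (\<Prod>j\<in>UNIV. fact (n j)))
      * ((1 + \<theta>) / \<theta>) ^ n z * \<theta> ^ (total n - n z) * (\<Prod>j\<in>UNIV - {z}. a j ^ n j))"

definition lancaster_term ::
    "real \<Rightarrow> ('d::finite \<Rightarrow> real^'d) \<Rightarrow> ('d \<Rightarrow> real) \<Rightarrow> 'd \<Rightarrow> (('d \<Rightarrow> nat) \<Rightarrow> real) \<Rightarrow> real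
      \<Rightarrow> ('d \<Rightarrow> nat) \<Rightarrow> ('d \<Rightarrow> nat) \<Rightarrow> ('d \<Rightarrow> nat) \<Rightarrow> real" where
  "lancaster_term \<theta> u a z \<rho> \<alpha> x y n =
     \<rho> n * meixner_h \<alpha> \<theta> a z n * meixner \<alpha> \<theta> u z n x * meixner \<alpha> \<theta> u z n y"

definition lancaster ::
    "real \<Rightarrow> real^'d::finite \<Rightarrow> ('d \<Rightarrow> real^'d) \<Rightarrow> ('d \<Rightarrow> real) \<Rightarrow> 'd \<Rightarrow> (('d \<Rightarrow> nat) \<Rightarrow> real) \<Rightarrow> real
      \<Rightarrow> ('d \<Rightarrow> nat) \<Rightarrow> ('d \<Rightarrow> nat) \<Rightarrow> real" where
  "lancaster \<theta> p u a z \<rho> \<alpha> x y =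
     nb_prob \<alpha> \<theta> p x * nb_prob \<alpha> \<theta> p y
     * (1 + (\<Sum>\<^sub>\<infinity>n | total n \<ge> 1. lancaster_term \<theta> u a z \<rho> \<alpha> x y n))"

text \<open>
  \<open>infsum\<close> is \<open>0\<close> for divergent series, so non-negativity includes (unordered) convergence of
  the series at every pair of states.
\<close>

definition lancaster_nonneg ::
    "real \<Rightarrow> real^'d::finite \<Rightarrow> ('d \<Rightarrow> real^'d) \<Rightarrow> ('d \<Rightarrow> real) \<Rightarrow> 'd \<Rightarrow> (('d \<Rightarrow> nat) \<Rightarrow> real) \<Rightarrow> real
      \<Rightarrow> bool" where
  "lancaster_nonneg \<theta> p u a z \<rho> \<alpha> \<longleftrightarrow>
     (\<forall>x y. lancaster_term \<theta> u a z \<rho> \<alpha> x y summable_on {n. total n \<ge> 1}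
        \<and> lancaster \<theta> p u a z \<rho> \<alpha> x y \<ge> 0)"

text \<open>
  The coefficients of a Lancaster expansion are the correlation sequence of the pair \<open>(X, Y)\<close>
  with joint weights \<open>lancaster\<close>: the mixed moment of the polynomials with indices \<open>m\<close> and \<open>n\<close>
  is \<open>\<delta>\<^sub>m\<^sub>n \<rho>\<^sub>n / h\<^sub>n\<close>. The case \<open>m = n = 0\<close> says that the weights have total mass \<open>\<rho>\<^sub>0\<close>.
\<close>

definition lancaster_correlations ::
    "real \<Rightarrow> real^'d::finite \<Rightarrow> ('d \<Rightarrow> real^'d) \<Rightarrow> ('d \<Rightarrow> real) \<Rightarrow> 'd \<Rightarrow> (('d \<Rightarrow> nat) \<Rightarrow> real) \<Rightarrow> real
      \<Rightarrow> bool" where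
  "lancaster_correlations \<theta> p u a z \<rho> \<alpha> \<longleftrightarrow>
     (\<forall>m n. ((\<lambda>(x, y). lancaster \<theta> p u a z \<rho> \<alpha> x y * (meixner \<alpha> \<theta> u z m x * meixner \<alpha> \<theta> u z n y))
        has_sum (if m = n then \<rho> n * inverse (meixner_h \<alpha> \<theta> a z n) else 0)) UNIV)"

definition hypergroup_s :: "('d::finite \<Rightarrow> real^'d) \<Rightarrow> ('d \<Rightarrow> real) \<Rightarrow> 'd \<Rightarrow> 'd \<Rightarrow> 'd \<Rightarrow> real" where
  "hypergroup_s u a j k l = (\<Sum>r\<in>UNIV. inverse (a r) * (u r $ j) * (u r $ k) * (u r $ l))"

definition orthogonal_basis ::
    "real^'d::finite \<Rightarrow> ('d \<Rightarrow> real^'d) \<Rightarrow> ('d \<Rightarrow> real) \<Rightarrow> 'd \<Rightarrow> 'd \<Rightarrow> bool" where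
  "orthogonal_basis p u a z e \<longleftrightarrow>
     (\<forall>j. u z $ j = 1) \<and>
     (\<forall>k l. (\<Sum>j\<in>UNIV. (u k $ j) * (u l $ j) * (p $ j)) = (if k = l then a k else 0)) \<and>
     (\<forall>r. u r $ e = 1)"

definition unit_simplex :: "(real^'d::finite) set" where
  "unit_simplex = {\<xi>. (\<forall>i. \<xi> $ i \<ge> 0) \<and> (\<Sum>i\<in>UNIV. \<xi> $ i) \<le> 1}"

definition simplex_random_vector :: "'w measure \<Rightarrow> ('w \<Rightarrow> real^'d::finite) \<Rightarrow> bool" where
  "simplex_random_vector M \<xi> \<longleftrightarrow>
     prob_space M \<and> \<xi> \<in> borel_measurable M \<and> (\<forall>\<omega>\<in>space M. \<xi> \<omega> \<in> unit_simplex)"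

definition rho_lin :: "('d::finite \<Rightarrow> real^'d) \<Rightarrow> 'd \<Rightarrow> real^'d \<Rightarrow> real" where
  "rho_lin u j \<xi> = (\<Sum>i\<in>UNIV. (u j $ i) * (\<xi> $ i))"

definition p_pair ::
    "real^'d::finite \<Rightarrow> ('d \<Rightarrow> real^'d) \<Rightarrow> ('d \<Rightarrow> real) \<Rightarrow> real^'d \<Rightarrow> 'd \<Rightarrow> 'd \<Rightarrow> real" where
  "p_pair p u a \<omega> i j = (p $ i) * (p $ j) * (\<Sum>l\<in>UNIV. (\<omega> $ l) * hypergroup_s u a i j l)"

text \<open>Vacuous for \<open>\<xi>\<close> with total mass \<open>0\<close>, where \<open>\<omega> = \<xi> / |\<xi>|\<close> is undefined.\<close>

definition pair_condition ::
    "real \<Rightarrow> real^'d::finite \<Rightarrow> ('d \<Rightarrow> real^'d) \<Rightarrow> ('d \<Rightarrow> real) \<Rightarrow> real^'d \<Rightarrow> bool" where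
  "pair_condition \<theta> p u a \<xi> \<longleftrightarrow>
     (let s = (\<Sum>i\<in>UNIV. \<xi> $ i) in
      s \<noteq> 0 \<longrightarrow>
        (\<forall>i j. p_pair p u a (\<xi> /\<^sub>R s) i j
               \<ge> \<theta> * (1 - s) / (1 + \<theta> * (1 - s)) * (p $ i) * (p $ j)))"

end

(*
In terms of the generating function G(x, w) of the Meixner polynomials M_n the function
sum_x P(x) M_n(x) s^x equals h_n^(-1) A(s)^(-alpha) W(s)^n for explicit rational A and W. Hence, for
rho_n = prod_j rho_j(xi)^(n_j), the generating function in t of the conditional weights of Y given
X = x is A(t)^(-alpha) G(x, rho W(t)); this is a negative binomial factor times
prod_i b_i(t)^(x_i), where each b_i is a constant plus a linear form divided by 1 - beta sum_k p_k t_k.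
The coefficients of the linear form are non-negative exactly under the pair condition, which gives
sufficiency; letting alpha tend to 0 for x a unit vector gives necessity, and random xi is a mixture.

Conversely, the correlations give E[M_n(X) | Y = y] = rho_n M_n(y). Since M_n has leading form
prod_j (sum_i u_i^(j) x_i)^(n_j) up to a constant, taking y = N e (all basis functions are 1 at e) makes
the moments of X / N converge to rho_n, and a weak limit of the conditional laws of X / N represents rho.
Positivity enters through |rho_n| <= 1, which bounds all moments of the limit and confines it to the
simplex.
*)
theory Submission
  imports Defs
begin

section \<open>Multivariate power series\<close>

text \<open>The recurring obstacle is to interchange sums over indices with sums over states. What
  makes it possible is that \<open>inverse (hinv n)\<close> decays like the square of a power
  product \<open>mpow vd n\<close>, while the generating function is singular in \<open>w z\<close>
  only; it is a polynomial in the other variables, so that just \<open>vd z < 1\<close> is required.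
  With |rho_n| <= 1 all kernel series then converge absolutely. In (2) and (3) this bound is read
  off from the simplex. In (1) it must be had before the kernel can be estimated: squares of Meixner
  polynomials are expanded in Meixner polynomials, so that the correlations yield both marginal
  second moments, and 2ab <= a^2 + b^2 applies. Leading forms are treated without coefficients:
  degree is measured by vanishing differences, taken in directions dual to the linear forms of the
  basis. For the weak limit, X / N is cut off at total mass 2, which costs 2^(-k) times a moment of
  order |n| + k with k free; a space-filling curve carries compactness from an interval to the
  cube.\<close>

definition mpow :: "('d::finite \<Rightarrow> real) \<Rightarrow> ('d \<Rightarrow> nat) \<Rightarrow> real" where
  "mpow w n = (\<Prod>i\<in>UNIV. w i ^ n i)"

definition mfact :: "('d::finite \<Rightarrow> nat) \<Rightarrow> real" where
  "mfact n = (\<Prod>i\<in>UNIV. fact (n i))"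

definition e_vec :: "'d \<Rightarrow> 'd \<Rightarrow> nat" where
  "e_vec i = (\<lambda>j. if j = i then 1 else 0)"

lemma mpow_zero [simp]: "mpow w (\<lambda>_. 0) = 1"
  by (simp add: mpow_def)

lemma mpow_nonneg: "(\<And>i. w i \<ge> 0) \<Longrightarrow> mpow w n \<ge> 0"
  by (simp add: mpow_def prod_nonneg)

lemma mpow_pos: "(\<And>i. w i > 0) \<Longrightarrow> mpow w n > 0"
  by (simp add: mpow_def prod_pos)

lemma abs_mpow: "\<bar>mpow w n\<bar> = mpow (\<lambda>i. \<bar>w i\<bar>) n"
  by (simp add: mpow_def abs_prod power_abs)

lemma mpow_mult: "mpow (\<lambda>i. v i * w i) n = mpow v n * mpow w n"
  by (simp add: mpow_def power_mult_distrib prod.distrib)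

lemma mpow_add: "mpow w (\<lambda>i. m i + n i) = mpow w m * mpow w n"
  by (simp add: mpow_def power_add prod.distrib)

lemma mpow_const: "mpow (\<lambda>_. c) n = c ^ total n"
  by (simp add: mpow_def total_def power_sum)

lemma mpow_mono: "(\<And>i. 0 \<le> v i) \<Longrightarrow> (\<And>i. v i \<le> w i) \<Longrightarrow> mpow v n \<le> mpow w n"
  unfolding mpow_def by (intro prod_mono conjI power_mono) auto

lemma mpow_le_one: "(\<And>i. 0 \<le> v i) \<Longrightarrow> (\<And>i. v i \<le> 1) \<Longrightarrow> mpow v n \<le> 1"
  using mpow_mono[of v "\<lambda>_. 1" n] by (simp add: mpow_const)

lemma mpow_inverse: "mpow (\<lambda>i. inverse (v i)) n = inverse (mpow v n)"
  by (simp add: mpow_def power_inverse prod_inversef[unfolded o_def])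

lemma mpow_fun_upd: "n i = 0 \<Longrightarrow> mpow w (n(i := k)) = w i ^ k * mpow w n"
  unfolding mpow_def by (subst (1 2) prod.remove[of UNIV i]) (auto intro!: prod.cong)

lemma mpow_weight_upd: "n i = 0 \<Longrightarrow> mpow (w(i := t)) n = mpow w n"
  unfolding mpow_def by (rule prod.cong) auto

lemma mpow_e_vec [simp]: "mpow w (e_vec i) = w i"
proof -
  have "mpow w (e_vec i) = (\<Prod>j\<in>UNIV. if j = i then w i else 1)"
    unfolding mpow_def e_vec_def by (rule prod.cong) auto
  then show ?thesis by simp
qed

lemma mfact_pos [simp]: "mfact n > 0"
  by (simp add: mfact_def prod_pos)

lemma mfact_zero [simp]: "mfact (\<lambda>_. 0) = 1"
  by (simp add: mfact_def)

lemma mfact_fun_upd: "n i = 0 \<Longrightarrow> mfact (n(i := k)) = fact k * mfact n"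
  unfolding mfact_def by (subst (1 2) prod.remove[of UNIV i]) (auto intro!: prod.cong)

lemma total_zero [simp]: "total (\<lambda>_. 0 :: nat) = 0"
  by (simp add: total_def)

lemma total_eq_0_iff: "total n = 0 \<longleftrightarrow> n = (\<lambda>_. 0 :: nat)" for n :: "'d::finite \<Rightarrow> nat"
  by (auto simp: total_def fun_eq_iff)

lemma total_fun_upd: "n i = (0::nat) \<Longrightarrow> total (n(i := k)) = k + total n"
  unfolding total_def by (subst (1 2) sum.remove[of UNIV i]) auto

lemma total_add: "total (\<lambda>i. m i + n i) = total m + (total n :: nat)"
  by (simp add: total_def sum.distrib)

lemma total_e_vec [simp]: "total (e_vec i :: 'd::finite \<Rightarrow> nat) = 1"
  by (simp add: total_def e_vec_def)

lemma component_le_total: "n i \<le> (total n :: nat)" for n :: "'d::finite \<Rightarrow> nat"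
  unfolding total_def by (rule member_le_sum) auto

section \<open>Unordered sums of real families\<close>

lemma summable_on_abs_real: "(\<lambda>x. \<bar>f x\<bar>) summable_on A \<longleftrightarrow> f summable_on A" for f :: "'a \<Rightarrow> real"
  using summable_on_iff_abs_summable_on_real[of f A] by simp

lemma summable_on_real_comparison:
  fixes f g :: "'a \<Rightarrow> real"
  assumes "f summable_on A" "\<And>x. x \<in> A \<Longrightarrow> \<bar>g x\<bar> \<le> f x"
  shows "g summable_on A"
  using summable_on_comparison_test[OF assms(1), of "\<lambda>x. \<bar>g x\<bar>"] assms(2)
  by (simp add: summable_on_abs_real)

lemma has_sum_abs_le:
  fixes f g :: "'a \<Rightarrow> real"
  assumes "(f has_sum F) A" "(g has_sum G) A" "\<And>x. x \<in> A \<Longrightarrow> \<bar>f x\<bar> \<le> g x"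
  shows "\<bar>F\<bar> \<le> G"
proof -
  have "F \<le> G"
    by (rule has_sum_mono[OF assms(1,2)]) (use assms(3) in fastforce)
  moreover have "-F \<le> G"
    by (rule has_sum_mono[OF has_sum_uminusI[OF assms(1)] assms(2)]) (use assms(3) in fastforce)
  ultimately show ?thesis by linarith
qed

lemma term_le_infsum:
  fixes f :: "'a \<Rightarrow> real"
  assumes "f summable_on A" "x \<in> A" "\<And>y. y \<in> A \<Longrightarrow> f y \<ge> 0"
  shows "f x \<le> infsum f A"
  using finite_sum_le_infsum[of f A "{x}"] assms by auto

text \<open>Tonelli's criterion. \<open>g\<close> only has to dominate the inner sums, which are
  rarely known in closed form.\<close>

lemma summable_on_pairs:
  fixes f :: "'a \<Rightarrow> 'b \<Rightarrow> real"
  assumes "\<And>x. x \<in> A \<Longrightarrow> (\<lambda>y. \<bar>f x y\<bar>) summable_on B"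
    and "g summable_on A" "\<And>x. x \<in> A \<Longrightarrow> infsum (\<lambda>y. \<bar>f x y\<bar>) B \<le> g x"
  shows "(\<lambda>(x, y). f x y) summable_on A \<times> B"
proof -
  have "(\<lambda>x. infsum (\<lambda>y. \<bar>f x y\<bar>) B) summable_on A"
    by (rule summable_on_comparison_test[OF assms(2)]) (auto intro: assms(3) infsum_nonneg)
  then have "(\<lambda>p. \<bar>case p of (x, y) \<Rightarrow> f x y\<bar>) summable_on A \<times> B"
    by (intro summable_on_SigmaI[where g = "\<lambda>x. infsum (\<lambda>y. \<bar>f x y\<bar>) B"])
       (auto intro!: has_sum_infsum assms(1))
  then show ?thesis
    by (simp add: summable_on_abs_real)
qed

text \<open>Fubini in the form in which it is applied: the total \<open>S\<close> is known in one
  order of summation and is transferred to the other.\<close>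

lemma has_sum_exchange:
  fixes f :: "'a \<Rightarrow> 'b \<Rightarrow> real"
  assumes "(\<lambda>(x, y). f x y) summable_on A \<times> B"
    and "\<And>x. x \<in> A \<Longrightarrow> ((\<lambda>y. f x y) has_sum H x) B"
    and "\<And>y. y \<in> B \<Longrightarrow> ((\<lambda>x. f x y) has_sum F y) A"
    and "(H has_sum S) A"
  shows "(F has_sum S) B"
proof -
  have "((\<lambda>(x, y). f x y) has_sum S) (A \<times> B)"
    by (rule has_sum_SigmaI[where g = H]) (use assms in auto)
  then have "((\<lambda>(y, x). f x y) has_sum S) (B \<times> A)"
    by (subst (asm) has_sum_swap) (simp add: case_prod_unfold)
  then show ?thesis
    by (rule has_sum_SigmaD) (use assms in auto)
qed

lemma has_sum_mult_pairs:
  fixes f :: "'a \<Rightarrow> real" and g :: "'b \<Rightarrow> real"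
  assumes "(f has_sum F) A" "(g has_sum G) B"
  shows "((\<lambda>(x, y). f x * g y) has_sum F * G) (A \<times> B)"
proof (rule has_sum_SigmaI[where g = "\<lambda>x. f x * G"])
  have s: "f summable_on A" "g summable_on B"
    using assms has_sum_imp_summable by blast+
  show "(\<lambda>(x, y). f x * g y) summable_on A \<times> B"
  proof (rule summable_on_pairs[where g = "\<lambda>x. \<bar>f x\<bar> * infsum (\<lambda>y. \<bar>g y\<bar>) B"])
    show "(\<lambda>y. \<bar>f x * g y\<bar>) summable_on B" for x
      using s(2) by (simp add: abs_mult summable_on_abs_real summable_on_cmult_right)
    show "(\<lambda>x. \<bar>f x\<bar> * infsum (\<lambda>y. \<bar>g y\<bar>) B) summable_on A"
      using s(1) by (simp add: summable_on_abs_real summable_on_cmult_left)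
    show "infsum (\<lambda>y. \<bar>f x * g y\<bar>) B \<le> \<bar>f x\<bar> * infsum (\<lambda>y. \<bar>g y\<bar>) B" for x
      by (simp add: abs_mult infsum_cmult_right')
  qed
qed (use assms in \<open>auto intro: has_sum_cmult_right has_sum_cmult_left\<close>)

section \<open>Uniqueness of the coefficients of a power series in several variables\<close>

definition supp :: "'d set \<Rightarrow> ('d \<Rightarrow> nat) set" where
  "supp A = {n. \<forall>i. i \<notin> A \<longrightarrow> n i = 0}"

lemma supp_UNIV [simp]: "supp UNIV = UNIV"
  by (auto simp: supp_def)

lemma supp_empty: "supp {} = {\<lambda>_. 0}"
  by (auto simp: supp_def)

lemma bij_betw_supp_insert:
  assumes "i \<notin> A"
  shows "bij_betw (\<lambda>(k, n). n(i := k)) (UNIV \<times> supp A) (supp (insert i A))"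
proof (rule bij_betwI[where g = "\<lambda>n. (n i, n(i := 0))"])
  show "(\<lambda>(k, n). n(i := k)) \<in> UNIV \<times> supp A \<rightarrow> supp (insert i A)"
    by (auto simp: supp_def)
  show "(\<lambda>n. (n i, n(i := 0))) \<in> supp (insert i A) \<rightarrow> UNIV \<times> supp A"
    by (auto simp: supp_def)
  fix p :: "nat \<times> ('a \<Rightarrow> nat)"
  assume "p \<in> UNIV \<times> supp A"
  then show "((case p of (k, n) \<Rightarrow> n(i := k)) i, (case p of (k, n) \<Rightarrow> n(i := k))(i := 0)) = p"
    using assms by (auto simp: supp_def fun_eq_iff)
qed auto

text \<open>Once the lower coefficients vanish, the series may be divided by \<open>x ^ m\<close>,
  and its limit at 0 is then \<open>c m\<close>.\<close>

lemma powser_coeff_zero: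
  fixes c :: "nat \<Rightarrow> real"
  assumes "\<epsilon> > 0" and s: "\<And>t. \<bar>t\<bar> < \<epsilon> \<Longrightarrow> (\<lambda>k. c k * t ^ k) sums 0"
  shows "c k = 0"
proof (induction k rule: less_induct)
  case (less m)
  have "((\<lambda>_. 0 :: real) \<longlongrightarrow> c (0 + m)) (at (0 :: real))"
  proof (rule powser_limit_0_strong[OF \<open>\<epsilon> > 0\<close>, where a = "\<lambda>k. c (k + m)"])
    fix x :: real assume x: "x \<noteq> 0" "norm x < \<epsilon>"
    have "(\<lambda>k. c (k + m) * x ^ (k + m)) sums 0"
      using s[of x] x less by (subst sums_zero_iff_shift) auto
    from sums_mult[OF this, of "1 / x ^ m"] show "(\<lambda>k. c (k + m) * x ^ k) sums 0"
      using x by (simp add: power_add)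
  qed
  then show ?case
    using LIM_const_eq by fastforce
qed

text \<open>Restricting the support to \<open>A\<close> allows induction on the number of variables
  although the index type is fixed. Arranged by powers of the new variable, the series has
  coefficients \<open>S k\<close> that are series in the old ones; they vanish by the one-variable
  case, and the induction hypothesis applies to each of them.\<close>

lemma mpowser_coeff_zero_supp:
  fixes c :: "('d::finite \<Rightarrow> nat) \<Rightarrow> real"
  assumes "finite A" "\<epsilon> > 0"
    and "\<And>w. (\<And>j. \<bar>w j\<bar> < \<epsilon>) \<Longrightarrow> ((\<lambda>n. c n * mpow w n) has_sum 0) (supp A)"
    and "n \<in> supp A"
  shows "c n = 0"
  using assms(1,3,4)
proof (induction A arbitrary: c n)
  case empty
  from empty.prems(1)[of "\<lambda>_. 0"] empty.prems(2) show ?case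
    using \<open>\<epsilon> > 0\<close> by (simp add: supp_empty has_sum_finite_iff)
next
  case (insert i A)
  have "c (m(i := k)) = 0" if "m \<in> supp A" for m k
  proof (rule insert.IH[OF _ that, of "\<lambda>m. c (m(i := k))"])
    fix w :: "'d \<Rightarrow> real" assume w: "\<And>j. \<bar>w j\<bar> < \<epsilon>"
    define S where "S k = infsum (\<lambda>m. c (m(i := k)) * mpow w m) (supp A)" for k
    have hs: "((\<lambda>(k, m). t ^ k * (c (m(i := k)) * mpow w m)) has_sum 0) (UNIV \<times> supp A)"
      if "\<bar>t\<bar> < \<epsilon>" for t
    proof -
      have "((\<lambda>n. c n * mpow (w(i := t)) n) has_sum 0) (supp (insert i A))"
        using w that by (intro insert.prems(1)) auto
      then have "((\<lambda>p. c ((\<lambda>(k, n). n(i := k)) p) * mpow (w(i := t)) ((\<lambda>(k, n). n(i := k)) p))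
          has_sum 0) (UNIV \<times> supp A)"
        by (subst has_sum_reindex_bij_betw[OF bij_betw_supp_insert[OF insert.hyps(2)], where f = "\<lambda>n. c n * mpow (w(i := t)) n"])
      then show ?thesis
        by (rule has_sum_cong[THEN iffD1, rotated])
           (use insert.hyps(2) in \<open>auto simp: supp_def mpow_fun_upd mpow_weight_upd\<close>)
    qed
    have sm: "(\<lambda>m. c (m(i := k)) * mpow w m) summable_on supp A" for k
    proof -
      \<comment> \<open>Any non-zero value of the new variable inside the radius serves here, since
        its power is cancelled afterwards.\<close>
      have "(\<lambda>m. (\<epsilon>/2) ^ k * (c (m(i := k)) * mpow w m)) summable_on supp A"
        using summable_on_SigmaD1[OF has_sum_imp_summable[OF hs[of "\<epsilon>/2"]], of k] \<open>\<epsilon> > 0\<close> by simp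
      then show ?thesis
        using \<open>\<epsilon> > 0\<close> by (simp add: summable_on_cmult_right')
    qed
    have "((\<lambda>k. t ^ k * S k) has_sum 0) UNIV" if "\<bar>t\<bar> < \<epsilon>" for t
      by (rule has_sum_SigmaD[OF hs[OF that]]) (auto simp: S_def intro!: has_sum_cmult_right has_sum_infsum sm)
    then have "S k = 0" for k
      by (intro powser_coeff_zero[OF \<open>\<epsilon> > 0\<close>]) (auto simp: mult.commute dest: has_sum_imp_sums)
    then show "((\<lambda>m. c (m(i := k)) * mpow w m) has_sum 0) (supp A)"
      using has_sum_infsum[OF sm[of k]] by (simp add: S_def)
  qed
  from this[of "n(i := 0)" "n i"] show ?case
    using insert.prems(2) by (auto simp: supp_def)
qed

text \<open>All closed forms for moments and kernels below are obtained by comparing generating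
  functions on a small cube and applying this.\<close>

lemma mpowser_unique:
  fixes c c' :: "('d::finite \<Rightarrow> nat) \<Rightarrow> real"
  assumes "\<epsilon> > 0"
    and "\<And>w. (\<And>j. \<bar>w j\<bar> < \<epsilon>) \<Longrightarrow> ((\<lambda>n. c n * mpow w n) has_sum F w) UNIV"
    and "\<And>w. (\<And>j. \<bar>w j\<bar> < \<epsilon>) \<Longrightarrow> ((\<lambda>n. c' n * mpow w n) has_sum F w) UNIV"
  shows "c n = c' n"
proof -
  have "c n - c' n = 0"
  proof (rule mpowser_coeff_zero_supp[of UNIV \<epsilon>])
    fix w :: "'d \<Rightarrow> real" assume w: "\<And>j. \<bar>w j\<bar> < \<epsilon>"
    show "((\<lambda>n. (c n - c' n) * mpow w n) has_sum 0) (supp UNIV)"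
      using has_sum_add[OF assms(2) has_sum_uminusI[OF assms(3)], of w w] w
      by (simp add: algebra_simps)
  qed (use assms(1) in auto)
  then show ?thesis by simp
qed

section \<open>The negative binomial series in one and several variables\<close>

lemma negbin_series:
  fixes z \<alpha> :: real
  assumes "\<bar>z\<bar> < 1" "\<alpha> > 0"
  shows "((\<lambda>k. pochhammer \<alpha> k / fact k * z ^ k) has_sum (1 - z) powr (-\<alpha>)) UNIV"
proof -
  have *: "(\<lambda>k. pochhammer \<alpha> k / fact k * t ^ k) sums (1 - t) powr (-\<alpha>)" if "\<bar>t\<bar> < 1" for t
  proof -
    have "(\<lambda>k. ((-\<alpha>) gchoose k) * (-t) ^ k) sums (1 + (-t)) powr (-\<alpha>)"
      using that by (intro gen_binomial_real) auto
    moreover have "((-\<alpha>) gchoose k) * (-t) ^ k = pochhammer \<alpha> k / fact k * t ^ k" for k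
    proof -
      have "(- 1) ^ k * (- t) ^ k = t ^ k" by (metis minus_mult_minus mult_1 power_mult_distrib)
      then show ?thesis by (simp add: gbinomial_pochhammer)
    qed
    ultimately show ?thesis by simp
  qed
  show ?thesis
  proof (rule norm_summable_imp_has_sum)
    have "norm (pochhammer \<alpha> k / fact k * z ^ k) = pochhammer \<alpha> k / fact k * \<bar>z\<bar> ^ k" for k
      using assms(2) by (simp add: abs_mult power_abs pochhammer_nonneg)
    then show "summable (\<lambda>k. norm (pochhammer \<alpha> k / fact k * z ^ k))"
      using *[of "\<bar>z\<bar>"] assms(1) by (simp add: sums_iff)
  qed (use * assms in auto)
qed

lemma pochhammer_add: "pochhammer a (m + n) = pochhammer a m * pochhammer (a + real m) n" for a :: real
  using pochhammer_product'[of a m n] by simp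

text \<open>The exponent \<open>k\<close> of the new variable is summed last. The inner sum is the
  induction hypothesis at \<open>\<alpha> + k\<close>, which is why \<open>\<alpha>\<close> varies;
  the outer sum is then a one-variable series in \<open>w i / V\<close>, where \<open>V\<close> is 1
  minus the sum over \<open>A\<close>.\<close>

lemma multi_negbin_series_supp:
  fixes v :: "'d::finite \<Rightarrow> real"
  assumes "finite A" "(\<Sum>i\<in>A. \<bar>v i\<bar>) < 1" "\<alpha> > 0"
  shows "((\<lambda>x. pochhammer \<alpha> (total x) / mfact x * mpow v x) has_sum (1 - (\<Sum>i\<in>A. v i)) powr (-\<alpha>)) (supp A)"
  using assms
proof (induction A arbitrary: v \<alpha>)
  case empty
  then show ?case by (simp add: supp_empty has_sum_finite_iff)
next
  case (insert i A)
  define f where "f w = (\<lambda>(k, x). pochhammer \<alpha> (k + total x) / (fact k * mfact x) * (w i ^ k * mpow w x))" for w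
  have inner: "((\<lambda>x. f w (k, x)) has_sum pochhammer \<alpha> k / fact k * w i ^ k * (1 - (\<Sum>j\<in>A. w j)) powr (- (\<alpha> + k))) (supp A)"
    and outer: "((\<lambda>k. pochhammer \<alpha> k / fact k * w i ^ k * (1 - (\<Sum>j\<in>A. w j)) powr (- (\<alpha> + k)))
        has_sum (1 - (\<Sum>j\<in>insert i A. w j)) powr (-\<alpha>)) UNIV"
    if w: "(\<Sum>j\<in>insert i A. \<bar>w j\<bar>) < 1" for w :: "'d \<Rightarrow> real" and k :: nat
  proof -
    have wA: "(\<Sum>j\<in>A. \<bar>w j\<bar>) < 1" using w insert.hyps by auto
    have "((\<lambda>x. pochhammer (\<alpha> + k) (total x) / mfact x * mpow w x) has_sum (1 - (\<Sum>j\<in>A. w j)) powr (-(\<alpha> + k))) (supp A)"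
      using insert.prems by (intro insert.IH wA) auto
    from has_sum_cmult_right[OF this, of "pochhammer \<alpha> k / fact k * w i ^ k"]
    show "((\<lambda>x. f w (k, x)) has_sum pochhammer \<alpha> k / fact k * w i ^ k * (1 - (\<Sum>j\<in>A. w j)) powr (- (\<alpha> + k))) (supp A)"
    proof (rule has_sum_cong[THEN iffD1, rotated])
      fix x
      show "pochhammer \<alpha> k / fact k * w i ^ k * (pochhammer (\<alpha> + k) (total x) / mfact x * mpow w x) = f w (k, x)"
        by (simp add: f_def pochhammer_add)
    qed
    define V where "V = 1 - (\<Sum>j\<in>A. w j)"
    have V: "\<bar>w i\<bar> < V"
    proof -
      have "(\<Sum>j\<in>A. w j) \<le> (\<Sum>j\<in>A. \<bar>w j\<bar>)" by (rule sum_mono) auto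
      then show ?thesis using w insert.hyps unfolding V_def by auto
    qed
    then have V0: "V > 0" by linarith
    have "((\<lambda>k. pochhammer \<alpha> k / fact k * (w i / V) ^ k) has_sum (1 - w i / V) powr (-\<alpha>)) UNIV"
      using V V0 insert.prems by (intro negbin_series) (simp_all add: abs_divide)
    from has_sum_cmult_right[OF this, of "V powr (-\<alpha>)"]
    have "((\<lambda>k. V powr (-\<alpha>) * (pochhammer \<alpha> k / fact k * (w i / V) ^ k)) has_sum V powr (-\<alpha>) * (1 - w i / V) powr (-\<alpha>)) UNIV" .
    moreover have "V powr (-\<alpha>) * (1 - w i / V) powr (-\<alpha>) = (1 - (\<Sum>j\<in>insert i A. w j)) powr (-\<alpha>)"
    proof -
      have "1 - w i / V \<ge> 0" using V V0 by (simp add: abs_if split: if_splits)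
      moreover have "V * (1 - w i / V) = 1 - (\<Sum>j\<in>insert i A. w j)"
        using V0 insert.hyps by (simp add: right_diff_distrib) (simp add: V_def)
      ultimately show ?thesis
        using V0 by (metis less_imp_le powr_mult)
    qed
    moreover have eq: "V powr (-\<alpha>) * (pochhammer \<alpha> k / fact k * (w i / V) ^ k) = pochhammer \<alpha> k / fact k * w i ^ k * V powr (- (\<alpha> + k))" for k
    proof -
      have "V powr (- (\<alpha> + k)) = V powr (-\<alpha>) / V ^ k"
        using V0 by (simp add: powr_diff powr_realpow)
      then show ?thesis by (simp add: power_divide)
    qed
    ultimately show "((\<lambda>k. pochhammer \<alpha> k / fact k * w i ^ k * (1 - (\<Sum>j\<in>A. w j)) powr (- (\<alpha> + k)))
        has_sum (1 - (\<Sum>j\<in>insert i A. w j)) powr (-\<alpha>)) UNIV"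
      by (simp only: eq V_def)
  qed
  \<comment> \<open>The same iterated sums at the absolute values of \<open>v\<close> supply the
    majorant.\<close>
  have "f v summable_on UNIV \<times> supp A"
  proof (rule summable_on_real_comparison)
    show "f (\<lambda>i. \<bar>v i\<bar>) summable_on UNIV \<times> supp A"
      by (rule summable_on_SigmaI[OF inner has_sum_imp_summable[OF outer]])
         (use insert.prems in \<open>auto simp: f_def intro!: mult_nonneg_nonneg divide_nonneg_nonneg pochhammer_nonneg mpow_nonneg less_imp_le[OF mfact_pos]\<close>)
    show "\<bar>f v p\<bar> \<le> f (\<lambda>i. \<bar>v i\<bar>) p" for p
      using insert.prems by (cases p) (simp add: f_def abs_mult abs_mpow power_abs pochhammer_nonneg less_imp_le[OF mfact_pos])
  qed
  then have "(f v has_sum (1 - (\<Sum>j\<in>insert i A. v j)) powr (-\<alpha>)) (UNIV \<times> supp A)"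
    by (intro has_sum_SigmaI[OF inner outer]) (use insert.prems in auto)
  then have "((\<lambda>p. pochhammer \<alpha> (total ((\<lambda>(k, n). n(i := k)) p)) / mfact ((\<lambda>(k, n). n(i := k)) p)
      * mpow v ((\<lambda>(k, n). n(i := k)) p)) has_sum (1 - (\<Sum>j\<in>insert i A. v j)) powr (-\<alpha>)) (UNIV \<times> supp A)"
    by (rule has_sum_cong[THEN iffD1, rotated])
       (use insert.hyps(2) in \<open>auto simp: f_def supp_def mpow_fun_upd mfact_fun_upd total_fun_upd\<close>)
  then show ?case
    by (subst (asm) has_sum_reindex_bij_betw[OF bij_betw_supp_insert[OF insert.hyps(2)],
          where f = "\<lambda>n. pochhammer \<alpha> (total n) / mfact n * mpow v n"])
qed

lemma multi_negbin_series:
  fixes v :: "'d::finite \<Rightarrow> real"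
  assumes "(\<Sum>i\<in>UNIV. \<bar>v i\<bar>) < 1" "\<alpha> > 0"
  shows "((\<lambda>x. pochhammer \<alpha> (total x) / mfact x * mpow v x) has_sum (1 - (\<Sum>i\<in>UNIV. v i)) powr (-\<alpha>)) UNIV"
  using multi_negbin_series_supp[OF finite assms] by simp

section \<open>Evaluation of polynomials in the generating variables\<close>

definition peval :: "('d::finite \<Rightarrow> real) \<Rightarrow> (('d \<Rightarrow>\<^sub>0 nat) \<Rightarrow>\<^sub>0 real) \<Rightarrow> real" where
  "peval w q = (\<Sum>m\<in>Poly_Mapping.keys q. Poly_Mapping.lookup q m * mpow w (Poly_Mapping.lookup m))"

text \<open>A weighted l1 norm of the coefficients. It is submultiplicative, and so bounds the
  product of linear factors in the generating function without expanding it.\<close>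

definition pnorm :: "('d::finite \<Rightarrow> real) \<Rightarrow> (('d \<Rightarrow>\<^sub>0 nat) \<Rightarrow>\<^sub>0 real) \<Rightarrow> real" where
  "pnorm r q = (\<Sum>m\<in>Poly_Mapping.keys q. \<bar>Poly_Mapping.lookup q m\<bar> * mpow r (Poly_Mapping.lookup m))"

lemma peval_superset:
  "finite S \<Longrightarrow> Poly_Mapping.keys q \<subseteq> S \<Longrightarrow>
    peval w q = (\<Sum>m\<in>S. Poly_Mapping.lookup q m * mpow w (Poly_Mapping.lookup m))"
  unfolding peval_def by (rule sum.mono_neutral_left) (auto simp: in_keys_iff)

lemma pnorm_superset:
  "finite S \<Longrightarrow> Poly_Mapping.keys q \<subseteq> S \<Longrightarrow>
    pnorm w q = (\<Sum>m\<in>S. \<bar>Poly_Mapping.lookup q m\<bar> * mpow w (Poly_Mapping.lookup m))"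
  unfolding pnorm_def by (rule sum.mono_neutral_left) (auto simp: in_keys_iff)

lemma peval_single [simp]: "peval w (Poly_Mapping.single m c) = c * mpow w (Poly_Mapping.lookup m)"
  by (subst peval_superset[of "{m}"]) auto

lemma pnorm_single [simp]: "pnorm w (Poly_Mapping.single m c) = \<bar>c\<bar> * mpow w (Poly_Mapping.lookup m)"
  by (subst pnorm_superset[of "{m}"]) auto

lemma peval_zero [simp]: "peval w 0 = 0" by (simp add: peval_def)
lemma pnorm_zero [simp]: "pnorm w 0 = 0" by (simp add: pnorm_def)

lemma peval_add: "peval w (q + q') = peval w q + peval w q'"
  by (subst (1 2 3) peval_superset[of "Poly_Mapping.keys q \<union> Poly_Mapping.keys q'"])
     (auto simp: lookup_add algebra_simps sum.distrib dest: Poly_Mapping.keys_add[THEN subsetD])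

lemma pnorm_add:
  assumes "\<And>i. r i \<ge> 0"
  shows "pnorm r (q + q') \<le> pnorm r q + pnorm r q'"
proof -
  have "pnorm r (q + q') \<le> (\<Sum>m\<in>Poly_Mapping.keys q \<union> Poly_Mapping.keys q'.
      (\<bar>Poly_Mapping.lookup q m\<bar> + \<bar>Poly_Mapping.lookup q' m\<bar>) * mpow r (Poly_Mapping.lookup m))"
    by (subst pnorm_superset[of "Poly_Mapping.keys q \<union> Poly_Mapping.keys q'"])
       (auto simp: lookup_add mpow_nonneg assms dest: Poly_Mapping.keys_add[THEN subsetD] intro!: sum_mono mult_right_mono)
  then show ?thesis
    by (subst (2 3) pnorm_superset[of "Poly_Mapping.keys q \<union> Poly_Mapping.keys q'"])
       (auto simp: algebra_simps sum.distrib)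
qed

lemma peval_sum: "peval w (sum f S) = (\<Sum>s\<in>S. peval w (f s))"
  by (induction S rule: infinite_finite_induct) (auto simp: peval_add)

lemma pnorm_sum: "(\<And>i. r i \<ge> 0) \<Longrightarrow> pnorm r (sum f S) \<le> (\<Sum>s\<in>S. pnorm r (f s))"
  by (induction S rule: infinite_finite_induct) (auto intro: order_trans[OF pnorm_add])

lemma poly_as_monomials: "q = (\<Sum>m\<in>Poly_Mapping.keys q. Poly_Mapping.single m (Poly_Mapping.lookup q m))"
  for q :: "'a \<Rightarrow>\<^sub>0 'b::comm_monoid_add"
proof (rule poly_mapping_eqI)
  fix k
  show "Poly_Mapping.lookup q k = Poly_Mapping.lookup (\<Sum>m\<in>Poly_Mapping.keys q. Poly_Mapping.single m (Poly_Mapping.lookup q m)) k"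
    by (simp add: lookup_sum lookup_single when_def in_keys_iff)
qed

lemma times_as_monomials:
  "q * q' = (\<Sum>m\<in>Poly_Mapping.keys q. \<Sum>m'\<in>Poly_Mapping.keys q'.
     Poly_Mapping.single (m + m') (Poly_Mapping.lookup q m * Poly_Mapping.lookup q' m'))"
  for q q' :: "('a::monoid_add) \<Rightarrow>\<^sub>0 real"
  by (subst (1) poly_as_monomials[of q], subst (1) poly_as_monomials[of q'])
     (simp add: sum_product mult_single)

lemma mpow_lookup_add: "mpow w (Poly_Mapping.lookup (m + m')) = mpow w (Poly_Mapping.lookup m) * mpow w (Poly_Mapping.lookup m')"
  by (simp add: mpow_def lookup_add power_add prod.distrib)

lemma peval_mult: "peval w (q * q') = peval w q * peval w q'"
  by (simp add: times_as_monomials peval_sum mpow_lookup_add)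
     (simp add: peval_def sum_product mult_ac)

lemma pnorm_mult:
  assumes "\<And>i. r i \<ge> 0"
  shows "pnorm r (q * q') \<le> pnorm r q * pnorm r q'"
proof -
  have "pnorm r (q * q') \<le> (\<Sum>m\<in>Poly_Mapping.keys q. \<Sum>m'\<in>Poly_Mapping.keys q'.
     pnorm r (Poly_Mapping.single (m + m') (Poly_Mapping.lookup q m * Poly_Mapping.lookup q' m')))"
    unfolding times_as_monomials
    by (intro order_trans[OF pnorm_sum] sum_mono order_trans[OF pnorm_sum] assms) auto
  also have "\<dots> = pnorm r q * pnorm r q'"
    by (simp add: mpow_lookup_add abs_mult) (simp add: pnorm_def sum_product mult_ac)
  finally show ?thesis .
qed

lemma pnorm_nonneg: "(\<And>i. r i \<ge> 0) \<Longrightarrow> pnorm r q \<ge> 0"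
  by (simp add: pnorm_def sum_nonneg mpow_nonneg)

lemma mpow_lookup_zero [simp]: "mpow w (Poly_Mapping.lookup 0) = 1"
  by (simp add: mpow_def)

lemma peval_one [simp]: "peval w 1 = 1"
  by (simp flip: single_one)

lemma pnorm_one [simp]: "pnorm w 1 = 1"
  by (simp flip: single_one)

lemma peval_power: "peval w (q ^ n) = peval w q ^ n"
  by (induction n) (auto simp: peval_mult)

lemma pnorm_power: "(\<And>i. r i \<ge> 0) \<Longrightarrow> pnorm r (q ^ n) \<le> pnorm r q ^ n"
  by (induction n) (auto intro!: order_trans[OF pnorm_mult] mult_left_mono pnorm_nonneg)

lemma peval_prod: "peval w (prod f S) = (\<Prod>s\<in>S. peval w (f s))"
  by (induction S rule: infinite_finite_induct) (auto simp: peval_mult)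

lemma pnorm_prod: "(\<And>i. r i \<ge> 0) \<Longrightarrow> pnorm r (prod f S) \<le> (\<Prod>s\<in>S. pnorm r (f s))"
  by (induction S rule: infinite_finite_induct) (auto intro!: order_trans[OF pnorm_mult] mult_left_mono pnorm_nonneg)

lemma peval_w_const [simp]: "peval w (w_const c) = c"
  by (simp add: w_const_def)

lemma pnorm_w_const [simp]: "pnorm w (w_const c) = \<bar>c\<bar>"
  by (simp add: w_const_def)

lemma lookup_single_e_vec: "Poly_Mapping.lookup (Poly_Mapping.single j (1::nat)) = e_vec j"
  by (auto simp: e_vec_def lookup_single when_def fun_eq_iff)

lemma peval_w_var [simp]: "peval w (w_var j) = w j"
  unfolding w_var_def by (simp add: lookup_single_e_vec[unfolded One_nat_def])

lemma pnorm_w_var [simp]: "pnorm w (w_var j) = w j"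
  unfolding w_var_def by (simp add: lookup_single_e_vec[unfolded One_nat_def])

text \<open>\<open>g\<close> is the identity for \<open>peval\<close> and the absolute value for
  \<open>pnorm\<close>.\<close>

lemma has_sum_w_coeff_gen:
  fixes q :: "('d::finite \<Rightarrow>\<^sub>0 nat) \<Rightarrow>\<^sub>0 real"
  assumes "g 0 = (0 :: real)"
  shows "((\<lambda>n. g (w_coeff q n) * mpow w n) has_sum
     (\<Sum>m\<in>Poly_Mapping.keys q. g (Poly_Mapping.lookup q m) * mpow w (Poly_Mapping.lookup m))) UNIV"
proof (rule has_sum_finite_neutralI)
  show "finite (Poly_Mapping.lookup ` Poly_Mapping.keys q)" by simp
  fix n :: "'d \<Rightarrow> nat"
  assume n: "n \<in> UNIV - Poly_Mapping.lookup ` Poly_Mapping.keys q"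
  have "Abs_poly_mapping n \<notin> Poly_Mapping.keys q"
  proof
    assume "Abs_poly_mapping n \<in> Poly_Mapping.keys q"
    then have "Poly_Mapping.lookup (Abs_poly_mapping n) \<in> Poly_Mapping.lookup ` Poly_Mapping.keys q" by blast
    with n show False by simp
  qed
  then show "g (w_coeff q n) * mpow w n = 0"
    using assms by (simp add: w_coeff_def in_keys_iff)
next
  have "inj_on Poly_Mapping.lookup (Poly_Mapping.keys q)"
    by (simp add: inj_on_def lookup_inject)
  then show "(\<Sum>m\<in>Poly_Mapping.keys q. g (Poly_Mapping.lookup q m) * mpow w (Poly_Mapping.lookup m))
     = (\<Sum>n\<in>Poly_Mapping.lookup ` Poly_Mapping.keys q. g (w_coeff q n) * mpow w n)"
    by (simp add: sum.reindex w_coeff_def lookup_inverse)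
qed auto

lemma has_sum_w_coeff: "((\<lambda>n. w_coeff q n * mpow w n) has_sum peval w q) UNIV"
  using has_sum_w_coeff_gen[of "\<lambda>c. c" q w] by (simp add: peval_def)

lemma has_sum_abs_w_coeff: "((\<lambda>n. \<bar>w_coeff q n\<bar> * mpow w n) has_sum pnorm w q) UNIV"
  using has_sum_w_coeff_gen[of "\<lambda>c. \<bar>c\<bar>" q w] by (simp add: pnorm_def)

text \<open>The Cauchy product of a series in \<open>w z\<close> alone with a series in all
  variables, which is the shape of the sum defining \<open>meixner\<close>.\<close>

lemma has_sum_convolution_at:
  fixes b :: "nat \<Rightarrow> real" and c :: "('d::finite \<Rightarrow> nat) \<Rightarrow> real"
  assumes "((\<lambda>k. b k * w z ^ k) has_sum B) UNIV" "((\<lambda>n. c n * mpow w n) has_sum C) UNIV"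
  shows "((\<lambda>n. (\<Sum>k\<le>n z. b k * c (n(z := n z - k))) * mpow w n) has_sum B * C) UNIV"
proof -
  define f where "f = (\<lambda>(n, k). b k * c (n(z := n z - k)) * mpow w n)"
  have "((\<lambda>(k, m). (b k * w z ^ k) * (c m * mpow w m)) has_sum B * C) (UNIV \<times> UNIV)"
    by (rule has_sum_mult_pairs[OF assms])
  moreover have "f (m(z := m z + k), k) = (b k * w z ^ k) * (c m * mpow w m)" for k m
  proof -
    have upd: "m(z := m z + k) = (\<lambda>i. m i + (if i = z then k else 0))" by auto
    have "(\<Prod>i\<in>UNIV. w i ^ (if i = z then k else 0)) = (\<Prod>i\<in>UNIV. if i = z then w z ^ k else 1)"
      by (rule prod.cong) auto
    then have "mpow w (\<lambda>i. if i = z then k else 0) = w z ^ k" by (simp add: mpow_def)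
    then have "mpow w (m(z := m z + k)) = mpow w m * w z ^ k"
      unfolding upd mpow_add by (rule arg_cong)
    then show ?thesis by (simp add: f_def)
  qed
  ultimately have "((\<lambda>p. f ((\<lambda>(k, m). (m(z := m z + k), k)) p)) has_sum B * C) (UNIV \<times> UNIV)"
    by (simp add: case_prod_unfold)
  moreover have "bij_betw (\<lambda>(k :: nat, m). (m(z := m z + k), k)) (UNIV \<times> UNIV) (Sigma UNIV (\<lambda>n. {..n z}))"
    by (rule bij_betwI[where g = "\<lambda>(n, k). (k, n(z := n z - k))"]) (auto simp: fun_eq_iff)
  ultimately have "(f has_sum B * C) (Sigma UNIV (\<lambda>n. {..n z}))"
    by (subst (asm) has_sum_reindex_bij_betw) auto
  then show ?thesis
    by (rule has_sum_SigmaD) (auto simp: f_def sum_distrib_right intro!: has_sum_finiteI)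
qed

section \<open>The basis, the hypergroup property and the linear factors of the generating
  function\<close>

locale meixner_basis =
  fixes \<theta> :: real and p :: "real^'d::finite" and u :: "'d \<Rightarrow> real^'d" and a :: "'d \<Rightarrow> real"
    and z e :: 'd
  assumes theta_pos: "\<theta> > 0" and p_pos: "\<And>i. p $ i > 0" and sum_p: "(\<Sum>i\<in>UNIV. p $ i) = 1"
    and basis: "orthogonal_basis p u a z e"
    and hypergroup: "\<And>j k l. hypergroup_s u a j k l \<ge> 0"
begin

lemma u_z [simp]: "u z $ j = 1" and u_e [simp]: "u r $ e = 1"
  and u_orth: "(\<Sum>j\<in>UNIV. (u k $ j) * (u l $ j) * (p $ j)) = (if k = l then a k else 0)"
  using basis by (auto simp: orthogonal_basis_def)

text \<open>The term at the normalisation point \<open>e\<close> already contributes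
  \<open>p $ e\<close>.\<close>

lemma a_pos: "a k > 0"
proof -
  have "0 < (u k $ e) * (u k $ e) * (p $ e)" using p_pos by simp
  also have "\<dots> \<le> (\<Sum>j\<in>UNIV. (u k $ j) * (u k $ j) * (p $ j))"
    by (rule member_le_sum) (auto intro!: mult_nonneg_nonneg less_imp_le[OF p_pos] simp flip: power2_eq_square)
  finally show ?thesis by (simp add: u_orth)
qed

lemma u_orth_z: "k \<noteq> z \<Longrightarrow> (\<Sum>j\<in>UNIV. (u k $ j) * (p $ j)) = 0"
  using u_orth[of k z] by simp

text \<open>This inverts the definition of \<open>hypergroup_s\<close> by orthogonality. The case
  \<open>r = z\<close> says that the weights \<open>hypergroup_s u a j k l * p $ l\<close> have
  total mass 1 in \<open>l\<close>.\<close>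

lemma hypergroup_product: "(\<Sum>l\<in>UNIV. hypergroup_s u a j k l * (u r $ l) * (p $ l)) = (u r $ j) * (u r $ k)"
proof -
  have "(\<Sum>l\<in>UNIV. hypergroup_s u a j k l * (u r $ l) * (p $ l)) =
     (\<Sum>l\<in>UNIV. \<Sum>r'\<in>UNIV. inverse (a r') * (u r' $ j) * (u r' $ k) * ((u r' $ l) * (u r $ l) * (p $ l)))"
    unfolding hypergroup_s_def sum_distrib_right by (simp add: mult_ac)
  also have "\<dots> = (\<Sum>r'\<in>UNIV. inverse (a r') * (u r' $ j) * (u r' $ k) * (\<Sum>l\<in>UNIV. (u r' $ l) * (u r $ l) * (p $ l)))"
    by (subst sum.swap) (simp add: sum_distrib_left)
  also have "\<dots> = (\<Sum>r'\<in>UNIV. if r' = r then (u r $ j) * (u r $ k) else 0)"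
    by (rule sum.cong) (use a_pos in \<open>auto simp: u_orth less_imp_neq[symmetric]\<close>)
  finally show ?thesis by simp
qed

text \<open>The product of two values of a basis function is an average of its values, so the
  maximal modulus \<open>m\<close> satisfies \<open>m\<^sup>2 \<le> m\<close>.\<close>

lemma abs_u_le_1: "\<bar>u r $ i\<bar> \<le> 1"
proof -
  define m where "m = Max (range (\<lambda>j. \<bar>u r $ j\<bar>))"
  have le: "\<bar>u r $ j\<bar> \<le> m" for j unfolding m_def by (rule Max_ge) auto
  have "m \<in> range (\<lambda>j. \<bar>u r $ j\<bar>)" unfolding m_def by (rule Max_in) auto
  then obtain j where j: "m = \<bar>u r $ j\<bar>" by auto
  have m0: "m \<ge> 0" using j by simp
  have "m * m = \<bar>(u r $ j) * (u r $ j)\<bar>" by (simp add: j abs_mult)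
  also have "\<dots> = \<bar>\<Sum>l\<in>UNIV. hypergroup_s u a j j l * (u r $ l) * (p $ l)\<bar>"
    by (simp add: hypergroup_product)
  also have "\<dots> \<le> (\<Sum>l\<in>UNIV. hypergroup_s u a j j l * m * (p $ l))"
    by (rule order_trans[OF sum_abs], rule sum_mono)
       (auto simp: abs_mult hypergroup less_imp_le[OF p_pos] intro!: mult_right_mono mult_left_mono le)
  also have "\<dots> = m * (\<Sum>l\<in>UNIV. hypergroup_s u a j j l * (u z $ l) * (p $ l))"
    by (simp add: sum_distrib_left mult_ac)
  also have "\<dots> = m" by (subst hypergroup_product) simp
  finally have "m \<le> 1" using m0 by (cases "m = 0") auto
  with le[of i] show ?thesis by simp
qed

definition lam :: "'d \<Rightarrow> 'd \<Rightarrow> real" where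
  "lam i j = (if j = z then - ((1 + \<theta>) / \<theta>) else u j $ i)"

definition lin :: "('d \<Rightarrow> real) \<Rightarrow> 'd \<Rightarrow> real" where
  "lin w i = 1 + (\<Sum>j\<in>UNIV. lam i j * w j)"

definition lin_bd :: "('d \<Rightarrow> real) \<Rightarrow> 'd \<Rightarrow> real" where
  "lin_bd r i = 1 + (\<Sum>j\<in>UNIV. \<bar>lam i j\<bar> * r j)"

lemma peval_factor: "peval w (meixner_factor \<theta> u z i) = lin w i"
proof -
  have neg: "peval w (q - q') = peval w q - peval w q'" for q q'
    using peval_add[of w "q - q'" q'] by simp
  have "lin w i = 1 + lam i z * w z + (\<Sum>j\<in>UNIV - {z}. lam i j * w j)"
    by (simp add: lin_def sum.remove[of UNIV z])
  also have "(\<Sum>j\<in>UNIV - {z}. lam i j * w j) = (\<Sum>j\<in>UNIV - {z}. (u j $ i) * w j)"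
    by (rule sum.cong) (auto simp: lam_def)
  finally show ?thesis
    by (simp add: meixner_factor_def peval_add neg peval_sum peval_mult lam_def)
qed

lemma pnorm_factor:
  assumes "\<And>j. r j \<ge> 0"
  shows "pnorm r (meixner_factor \<theta> u z i) \<le> lin_bd r i"
proof -
  have eq: "meixner_factor \<theta> u z i = 1 + w_const (lam i z) * w_var z + (\<Sum>j\<in>UNIV - {z}. w_const (u j $ i) * w_var j)"
    unfolding meixner_factor_def w_const_def lam_def
    by (simp add: single_uminus)
  have m: "pnorm r (w_const x * w_var j) \<le> \<bar>x\<bar> * r j" for x j
    using pnorm_mult[of r "w_const x" "w_var j"] assms by simp
  have "pnorm r (meixner_factor \<theta> u z i) \<le> (1 + \<bar>lam i z\<bar> * r z) + (\<Sum>j\<in>UNIV - {z}. \<bar>u j $ i\<bar> * r j)"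
    unfolding eq
    by (intro order_trans[OF pnorm_add] add_mono order_trans[OF pnorm_sum] sum_mono m assms) simp
  also have "(\<Sum>j\<in>UNIV - {z}. \<bar>u j $ i\<bar> * r j) = (\<Sum>j\<in>UNIV - {z}. \<bar>lam i j\<bar> * r j)"
    by (rule sum.cong) (auto simp: lam_def)
  also have "1 + \<bar>lam i z\<bar> * r z + (\<Sum>j\<in>UNIV - {z}. \<bar>lam i j\<bar> * r j) = lin_bd r i"
    by (simp add: lin_bd_def sum.remove[of UNIV z])
  finally show ?thesis .
qed

text \<open>A bound for the sum of \<open>\<bar>lam i j\<bar>\<close> over \<open>j\<close>, uniform
  in \<open>i\<close>: every term is at most 1 or \<open>(1 + \<theta>) / \<theta>\<close>.\<close>

definition lam_bd :: real where "lam_bd = real CARD('d) * (1 + (1 + \<theta>) / \<theta>)"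

lemma lam_bd_pos: "lam_bd > 0"
  using theta_pos by (auto simp: lam_bd_def intro!: mult_pos_pos add_pos_pos divide_pos_pos)

lemma abs_lin_le: "\<bar>lin w i\<bar> \<le> lin_bd (\<lambda>j. \<bar>w j\<bar>) i"
  unfolding lin_def lin_bd_def
  by (rule order_trans[OF abs_triangle_ineq]) (auto simp: abs_mult intro!: order_trans[OF sum_abs])

lemma lin_bd_ge_1: "(\<And>j. r j \<ge> 0) \<Longrightarrow> lin_bd r i \<ge> 1"
  by (simp add: lin_bd_def sum_nonneg)

lemma lin_bd_le:
  assumes "\<And>j. r j \<ge> 0" "\<And>j. r j \<le> \<epsilon>"
  shows "lin_bd r i \<le> 1 + lam_bd * \<epsilon>"
proof -
  have l: "\<bar>lam i j\<bar> \<le> 1 + (1 + \<theta>) / \<theta>" for j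
  proof -
    have "(1 + \<theta>) / \<theta> \<ge> 0" using theta_pos by simp
    then show ?thesis using abs_u_le_1[of j i] by (auto simp: lam_def)
  qed
  have "(\<Sum>j\<in>UNIV. \<bar>lam i j\<bar> * r j) \<le> (\<Sum>j\<in>(UNIV::'d set). (1 + (1 + \<theta>) / \<theta>) * \<epsilon>)"
    using theta_pos by (intro sum_mono mult_mono l assms) (auto intro: add_nonneg_nonneg)
  then show ?thesis by (simp add: lin_bd_def lam_bd_def mult_ac)
qed

text \<open>Averaging the linear factors against \<open>p\<close>, and against \<open>p\<close>
  times \<open>u k\<close> in the next lemma, isolates a single variable. This is what inverts the
  substitution in the proof of \<open>orthogonality\<close>.\<close>

lemma sum_p_lin: "(\<Sum>i\<in>UNIV. p $ i * lin w i) = 1 - (1 + \<theta>) / \<theta> * w z"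
proof -
  have "(\<Sum>i\<in>UNIV. p $ i * lin w i) = 1 + (\<Sum>j\<in>UNIV. w j * (\<Sum>i\<in>UNIV. lam i j * p $ i))"
    by (simp add: lin_def algebra_simps sum.distrib sum_p sum_distrib_left)
       (subst sum.swap, simp add: mult_ac)
  also have "(\<Sum>j\<in>UNIV. w j * (\<Sum>i\<in>UNIV. lam i j * p $ i)) = (\<Sum>j\<in>UNIV. if j = z then - ((1 + \<theta>) / \<theta> * w z) else 0)"
    by (rule sum.cong) (auto simp: lam_def u_orth_z sum_p sum_negf simp flip: sum_distrib_left sum_divide_distrib)
  finally show ?thesis by simp
qed

lemma sum_pu_lin:
  assumes "k \<noteq> z"
  shows "(\<Sum>i\<in>UNIV. p $ i * (u k $ i) * lin w i) = a k * w k"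
proof -
  have "(\<Sum>i\<in>UNIV. p $ i * (u k $ i) * lin w i) = (\<Sum>i\<in>UNIV. p $ i * (u k $ i)) + (\<Sum>j\<in>UNIV. w j * (\<Sum>i\<in>UNIV. lam i j * (u k $ i) * p $ i))"
    by (simp add: lin_def algebra_simps sum.distrib sum_distrib_left)
       (subst sum.swap, simp add: mult_ac)
  also have "(\<Sum>i\<in>UNIV. p $ i * (u k $ i)) = 0"
    using u_orth_z[OF assms] by (simp add: mult.commute)
  also have "(\<Sum>j\<in>UNIV. w j * (\<Sum>i\<in>UNIV. lam i j * (u k $ i) * p $ i)) = (\<Sum>j\<in>UNIV. if j = k then a k * w k else 0)"
  proof (rule sum.cong)
    fix j
    show "w j * (\<Sum>i\<in>UNIV. lam i j * (u k $ i) * p $ i) = (if j = k then a k * w k else 0)"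
    proof (cases "j = z")
      case True
      have "(\<Sum>i\<in>UNIV. lam i z * (u k $ i) * p $ i) = - ((1 + \<theta>) / \<theta>) * (\<Sum>i\<in>UNIV. (u k $ i) * p $ i)"
        by (simp add: lam_def sum_distrib_left mult_ac)
      then show ?thesis using True assms u_orth_z[OF assms] by simp
    next
      case False
      then show ?thesis by (auto simp: lam_def u_orth)
    qed
  qed auto
  finally show ?thesis by simp
qed

end

section \<open>Generating functions of the Meixner polynomials\<close>

text \<open>The parameter \<open>\<alpha>\<close> is split off from the basis because the limit
  \<open>\<alpha>\<close> to 0 and the final theorem interpret this locale for many values of
  \<open>\<alpha>\<close> over one basis.\<close>

locale meixner_system = meixner_basis +
  fixes \<alpha> :: real
  assumes alpha_pos: "\<alpha> > 0"
begin

abbreviation P :: "('a \<Rightarrow> nat) \<Rightarrow> real" where "P \<equiv> nb_prob \<alpha> \<theta> p"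

abbreviation Mx :: "('a \<Rightarrow> nat) \<Rightarrow> ('a \<Rightarrow> nat) \<Rightarrow> real" where "Mx \<equiv> meixner \<alpha> \<theta> u z"

definition eta :: "'a \<Rightarrow> real" where
  "eta j = (if j = z then (1 + \<theta>) / \<theta> else \<theta> * a j)"

text \<open>The norm \<open>h_n^(-1)\<close> written as a coefficient of a negative binomial series,
  so that its generating function is known.\<close>

definition hinv :: "('a \<Rightarrow> nat) \<Rightarrow> real" where
  "hinv n = pochhammer \<alpha> (total n) / mfact n * mpow eta n"

lemma eta_pos: "eta j > 0"
  using theta_pos a_pos by (auto simp: eta_def)

lemma hinv_pos: "hinv n > 0"
  by (auto simp: hinv_def intro!: mult_pos_pos divide_pos_pos pochhammer_pos alpha_pos mpow_pos eta_pos)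

lemma hinv_zero [simp]: "hinv (\<lambda>_. 0) = 1"
  by (simp add: hinv_def)

lemma Gamma_quotient: "Gamma (\<alpha> + real k) / Gamma \<alpha> = pochhammer \<alpha> k"
  using alpha_pos by (subst pochhammer_Gamma) (auto dest: nonpos_Ints_nonpos)

lemma meixner_h_eq: "meixner_h \<alpha> \<theta> a z n = inverse (hinv n)"
proof -
  have "total n - n z = (\<Sum>j\<in>UNIV - {z}. n j)"
    unfolding total_def by (subst sum.remove[of UNIV z]) auto
  then have "((1 + \<theta>) / \<theta>) ^ n z * \<theta> ^ (total n - n z) * (\<Prod>j\<in>UNIV - {z}. a j ^ n j) =
     ((1 + \<theta>) / \<theta>) ^ n z * (\<Prod>j\<in>UNIV - {z}. (\<theta> * a j) ^ n j)"
    by (simp add: power_sum power_mult_distrib prod.distrib)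
  also have "\<dots> = mpow eta n"
  proof -
    have "mpow eta n = eta z ^ n z * (\<Prod>j\<in>UNIV - {z}. eta j ^ n j)"
      unfolding mpow_def by (rule prod.remove) auto
    also have "(\<Prod>j\<in>UNIV - {z}. eta j ^ n j) = (\<Prod>j\<in>UNIV - {z}. (\<theta> * a j) ^ n j)"
      by (rule prod.cong) (auto simp: eta_def)
    finally have "mpow eta n = eta z ^ n z * (\<Prod>j\<in>UNIV - {z}. (\<theta> * a j) ^ n j)" .
    moreover have "eta z = (1 + \<theta>) / \<theta>" by (simp add: eta_def)
    ultimately show ?thesis by simp
  qed
  finally have "((1 + \<theta>) / \<theta>) ^ n z * \<theta> ^ (total n - n z) * (\<Prod>j\<in>UNIV - {z}. a j ^ n j) = mpow eta n" .
  then show ?thesis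
    unfolding meixner_h_def hinv_def mfact_def
    by (simp add: Gamma_quotient[symmetric] add.commute mult.assoc)
qed

lemma P_eq: "P x = (1 + \<theta>) powr (-\<alpha>) * (pochhammer \<alpha> (total x) / mfact x * mpow (\<lambda>i. \<theta> / (1 + \<theta>) * p $ i) x)"
proof -
  have "(1 + \<theta>) powr (\<alpha> + real (total x)) = (1 + \<theta>) powr \<alpha> * (1 + \<theta>) ^ total x"
    using theta_pos by (simp add: powr_add powr_realpow)
  moreover have "mpow (\<lambda>i. \<theta> / (1 + \<theta>) * p $ i) x = \<theta> ^ total x / (1 + \<theta>) ^ total x * (\<Prod>i\<in>UNIV. (p $ i) ^ x i)"
    unfolding mpow_mult[of "\<lambda>_. \<theta> / (1 + \<theta>)"] by (simp add: mpow_const power_divide) (simp add: mpow_def)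
  ultimately show ?thesis
    unfolding nb_prob_def mfact_def Gamma_quotient[symmetric]
    by (simp add: powr_minus divide_inverse mult_ac)
qed

lemma P_pos: "P x > 0"
  unfolding P_eq using theta_pos p_pos
  by (auto intro!: mult_pos_pos divide_pos_pos pochhammer_pos alpha_pos mpow_pos)

definition gf :: "('a \<Rightarrow> nat) \<Rightarrow> ('a \<Rightarrow> real) \<Rightarrow> real" where
  "gf x w = (1 - w z) powr (-(real (total x) + \<alpha>)) * mpow (lin w) x"

definition gf_bd :: "('a \<Rightarrow> nat) \<Rightarrow> ('a \<Rightarrow> real) \<Rightarrow> real" where
  "gf_bd x r = (1 - r z) powr (-(real (total x) + \<alpha>)) * mpow (lin_bd r) x"

lemma binomial_coeff_eq: "(- 1) ^ k * ((- \<beta>) gchoose k) = pochhammer \<beta> k / fact k" for \<beta> :: real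
proof -
  have "(- 1) ^ k * ((- 1) ^ k :: real) = 1" by (metis minus_mult_minus mult_1 power_mult_distrib power_one)
  then show ?thesis by (simp add: gbinomial_pochhammer)
qed

lemma Mx_eq: "Mx n x = (\<Sum>k\<le>n z. pochhammer (real (total x) + \<alpha>) k / fact k
        * w_coeff (\<Prod>i\<in>UNIV. meixner_factor \<theta> u z i ^ x i) (n(z := n z - k)))"
  unfolding meixner_def binomial_coeff_eq ..

lemma has_sum_gf:
  assumes "\<bar>w z\<bar> < 1"
  shows "((\<lambda>n. Mx n x * mpow w n) has_sum gf x w) UNIV"
proof -
  have "((\<lambda>k. pochhammer (real (total x) + \<alpha>) k / fact k * w z ^ k) has_sum (1 - w z) powr (-(real (total x) + \<alpha>))) UNIV"
    using alpha_pos by (intro negbin_series assms) auto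
  from has_sum_convolution_at[where b = "\<lambda>k. pochhammer (real (total x) + \<alpha>) k / fact k" and w = w and z = z, OF this has_sum_w_coeff, of "\<Prod>i\<in>UNIV. meixner_factor \<theta> u z i ^ x i"] show ?thesis
    by (simp add: Mx_eq gf_def peval_prod peval_power peval_factor) (simp add: mpow_def)
qed

text \<open>The convolution is majorised term by term and the polynomial factor by its coefficient
  norm. Only \<open>r z\<close> is restricted, since the generating function is a polynomial in the
  other variables.\<close>

lemma abs_gf_bound:
  assumes "\<And>j. 0 \<le> r j" "r z < 1"
  shows "(\<lambda>n. \<bar>Mx n x\<bar> * mpow r n) summable_on UNIV"
    and "infsum (\<lambda>n. \<bar>Mx n x\<bar> * mpow r n) UNIV \<le> gf_bd x r"
proof -
  define q where "q = (\<Prod>i\<in>UNIV. meixner_factor \<theta> u z i ^ x i)"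
  define M' where "M' n = (\<Sum>k\<le>n z. pochhammer (real (total x) + \<alpha>) k / fact k * \<bar>w_coeff q (n(z := n z - k))\<bar>)" for n
  define B where "B = (1 - r z) powr (-(real (total x) + \<alpha>))"
  have "((\<lambda>k. pochhammer (real (total x) + \<alpha>) k / fact k * r z ^ k) has_sum B) UNIV"
    unfolding B_def using assms alpha_pos by (intro negbin_series) auto
  from has_sum_convolution_at[where b = "\<lambda>k. pochhammer (real (total x) + \<alpha>) k / fact k" and w = r and z = z and c = "\<lambda>n. \<bar>w_coeff q n\<bar>",
      OF this has_sum_abs_w_coeff]
  have *: "((\<lambda>n. M' n * mpow r n) has_sum B * pnorm r q) UNIV"
    by (simp add: M'_def)
  have le: "\<bar>Mx n x\<bar> * mpow r n \<le> M' n * mpow r n" for n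
    unfolding Mx_eq M'_def q_def[symmetric] using alpha_pos
    by (intro mult_right_mono order_trans[OF sum_abs] sum_mono mpow_nonneg assms)
       (simp add: abs_mult pochhammer_nonneg)
  show s: "(\<lambda>n. \<bar>Mx n x\<bar> * mpow r n) summable_on UNIV"
    by (rule summable_on_comparison_test[OF has_sum_imp_summable[OF *]]) (auto intro: le intro!: mult_nonneg_nonneg mpow_nonneg assms)
  have "infsum (\<lambda>n. \<bar>Mx n x\<bar> * mpow r n) UNIV \<le> B * pnorm r q"
    by (rule has_sum_mono[OF has_sum_infsum[OF s] *]) (rule le)
  also have "pnorm r q \<le> mpow (lin_bd r) x"
    unfolding q_def mpow_def
    by (intro order_trans[OF pnorm_prod] prod_mono conjI order_trans[OF pnorm_power] power_mono
          pnorm_factor pnorm_nonneg assms)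
  finally show "infsum (\<lambda>n. \<bar>Mx n x\<bar> * mpow r n) UNIV \<le> gf_bd x r"
    by (simp add: gf_bd_def B_def mult_left_mono)
qed

text \<open>The part of the exponent that depends on \<open>total x\<close> is distributed over the
  factors. Then \<open>x\<close> enters through a power product only, and sums over \<open>x\<close>
  against \<open>P\<close> are values of the generating function of \<open>P\<close>.\<close>

lemma gf_alt:
  assumes "w z < 1"
  shows "gf x w = (1 - w z) powr (-\<alpha>) * mpow (\<lambda>i. lin w i / (1 - w z)) x"
    and "gf_bd x w = (1 - w z) powr (-\<alpha>) * mpow (\<lambda>i. lin_bd w i / (1 - w z)) x"
proof -
  have "(1 - w z) powr (-(real (total x) + \<alpha>)) = (1 - w z) powr (-\<alpha>) * inverse (1 - w z) ^ total x"
    using assms by (simp add: powr_diff powr_minus powr_realpow power_inverse divide_inverse)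
  then show "gf x w = (1 - w z) powr (-\<alpha>) * mpow (\<lambda>i. lin w i / (1 - w z)) x"
    and "gf_bd x w = (1 - w z) powr (-\<alpha>) * mpow (\<lambda>i. lin_bd w i / (1 - w z)) x"
    unfolding gf_def gf_bd_def by (simp_all add: divide_inverse mpow_mult mpow_const mult_ac)
qed

lemma has_sum_P_mpow:
  assumes "(\<Sum>i\<in>UNIV. \<theta> / (1 + \<theta>) * p $ i * \<bar>v i\<bar>) < 1"
  shows "((\<lambda>x. P x * mpow v x) has_sum ((1 + \<theta>) - \<theta> * (\<Sum>i\<in>UNIV. p $ i * v i)) powr (-\<alpha>)) UNIV"
proof -
  have "\<bar>\<theta> / (1 + \<theta>) * p $ i * v i\<bar> = \<theta> / (1 + \<theta>) * p $ i * \<bar>v i\<bar>" for i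
    using theta_pos p_pos[of i] by (simp add: abs_mult)
  then have *: "(\<Sum>i\<in>UNIV. \<bar>\<theta> / (1 + \<theta>) * p $ i * v i\<bar>) < 1" using assms by simp
  have "((\<lambda>x. pochhammer \<alpha> (total x) / mfact x * mpow (\<lambda>i. \<theta> / (1 + \<theta>) * p $ i * v i) x) has_sum
     (1 - (\<Sum>i\<in>UNIV. \<theta> / (1 + \<theta>) * p $ i * v i)) powr (-\<alpha>)) UNIV"
    by (rule multi_negbin_series[OF * alpha_pos])
  from has_sum_cmult_right[OF this, of "(1 + \<theta>) powr (-\<alpha>)"]
  have "((\<lambda>x. P x * mpow v x) has_sum (1 + \<theta>) powr (-\<alpha>) * (1 - (\<Sum>i\<in>UNIV. \<theta> / (1 + \<theta>) * p $ i * v i)) powr (-\<alpha>)) UNIV"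
    unfolding P_eq mpow_mult by (simp add: mult_ac)
  moreover have "(\<Sum>i\<in>UNIV. \<theta> / (1 + \<theta>) * p $ i * v i) = \<theta> / (1 + \<theta>) * (\<Sum>i\<in>UNIV. p $ i * v i)"
    by (simp add: sum_distrib_left mult_ac)
  moreover have "(\<Sum>i\<in>UNIV. \<theta> / (1 + \<theta>) * p $ i * v i) \<le> (\<Sum>i\<in>UNIV. \<theta> / (1 + \<theta>) * p $ i * \<bar>v i\<bar>)"
    using theta_pos p_pos by (intro sum_mono mult_left_mono mult_nonneg_nonneg) (simp_all add: less_imp_le)
  moreover have "(1 + \<theta>) * (1 - \<theta> / (1 + \<theta>) * S) = (1 + \<theta>) - \<theta> * S" for S
    using theta_pos by (simp add: field_simps)
  ultimately show ?thesis
    using theta_pos assms powr_mult[of "1 + \<theta>" "1 - \<theta> / (1 + \<theta>) * (\<Sum>i\<in>UNIV. p $ i * v i)" "-\<alpha>"] by simp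
qed

text \<open>Here \<open>\<kappa>\<close> stands for the weighted mass \<open>\<theta> \<Sum> p\<^sub>i \<bar>s\<^sub>i\<bar>\<close> of the point \<open>s\<close> at which the generating
  function is evaluated.\<close>

lemma radius_exists:
  assumes "0 \<le> \<kappa>" "\<kappa> < 1 + \<theta>"
  obtains \<epsilon> where "\<epsilon> > 0" "\<epsilon> < 1" "\<kappa> * ((1 + lam_bd * \<epsilon>) / (1 - \<epsilon>)) < 1 + \<theta>"
proof -
  have "((\<lambda>\<epsilon>. \<kappa> * ((1 + lam_bd * \<epsilon>) / (1 - \<epsilon>))) \<longlongrightarrow> \<kappa> * ((1 + lam_bd * 0) / (1 - 0))) (at_right 0)"
    by (intro tendsto_intros) auto
  then have "\<forall>\<^sub>F \<epsilon> in at_right 0. \<kappa> * ((1 + lam_bd * \<epsilon>) / (1 - \<epsilon>)) < 1 + \<theta>"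
    using assms by (auto intro: order_tendstoD)
  moreover have "\<forall>\<^sub>F \<epsilon> in at_right (0::real). 0 < \<epsilon> \<and> \<epsilon> < 1"
    by (intro eventually_at_rightI[of 0 1]) auto
  ultimately have "\<forall>\<^sub>F \<epsilon> in at_right (0::real). \<kappa> * ((1 + lam_bd * \<epsilon>) / (1 - \<epsilon>)) < 1 + \<theta> \<and> 0 < \<epsilon> \<and> \<epsilon> < 1"
    by eventually_elim auto
  then obtain \<epsilon> where "\<kappa> * ((1 + lam_bd * \<epsilon>) / (1 - \<epsilon>)) < 1 + \<theta> \<and> 0 < \<epsilon> \<and> \<epsilon> < 1"
    using eventually_happens'[of "at_right (0::real)"] by (auto simp: trivial_limit_at_right_real)
  then show ?thesis using that by blast
qed

lemma lin_quotient_le: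
  assumes "\<And>j. 0 \<le> r j" "\<And>j. r j \<le> \<epsilon>" "\<epsilon> < 1"
  shows "lin_bd r i / (1 - r z) \<le> (1 + lam_bd * \<epsilon>) / (1 - \<epsilon>)"
proof -
  have "0 \<le> \<epsilon>" using assms(1,2) order_trans by blast
  then show ?thesis
    using assms lin_bd_le[of r \<epsilon> i] lam_bd_pos by (intro frac_le) (auto intro!: add_nonneg_nonneg)
qed

text \<open>The point with entries \<open>\<bar>s i\<bar> * lin_bd r i / (1 - r z)\<close> stays in
  the domain where the generating function of \<open>P\<close> converges; the choice of
  \<open>\<epsilon>\<close> in \<open>radius_exists\<close> is made for this.\<close>

lemma has_sum_P_gf_bd:
  assumes "\<kappa> * ((1 + lam_bd * \<epsilon>) / (1 - \<epsilon>)) < 1 + \<theta>" "\<theta> * (\<Sum>i\<in>UNIV. p $ i * \<bar>s i\<bar>) \<le> \<kappa>" "\<epsilon> < 1"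
    and "\<And>j. 0 \<le> r j" "\<And>j. r j \<le> \<epsilon>"
  shows "(\<lambda>x. P x * \<bar>mpow s x\<bar> * gf_bd x r) summable_on UNIV"
    and "(\<Sum>i\<in>UNIV. \<theta> / (1 + \<theta>) * p $ i * (\<bar>s i\<bar> * (lin_bd r i / (1 - r z)))) < 1"
proof -
  have rz: "r z < 1" using assms(3) assms(5)[of z] by linarith
  have e0: "\<epsilon> \<ge> 0" using assms(4,5) order_trans by blast
  have nn: "lin_bd r i / (1 - r z) \<ge> 0" for i
    using lin_bd_ge_1[of r i] assms(4) rz by auto
  have "(\<Sum>i\<in>UNIV. \<theta> / (1 + \<theta>) * p $ i * (\<bar>s i\<bar> * (lin_bd r i / (1 - r z))))
     \<le> (\<Sum>i\<in>UNIV. \<theta> / (1 + \<theta>) * p $ i * (\<bar>s i\<bar> * ((1 + lam_bd * \<epsilon>) / (1 - \<epsilon>))))"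
    using theta_pos p_pos assms lin_quotient_le
    by (intro sum_mono mult_left_mono) (auto simp: less_imp_le)
  also have "\<dots> = \<theta> * (\<Sum>i\<in>UNIV. p $ i * \<bar>s i\<bar>) * ((1 + lam_bd * \<epsilon>) / (1 - \<epsilon>)) / (1 + \<theta>)"
    by (simp add: sum_distrib_left sum_distrib_right sum_divide_distrib mult_ac)
  also have "\<dots> \<le> \<kappa> * ((1 + lam_bd * \<epsilon>) / (1 - \<epsilon>)) / (1 + \<theta>)"
    using assms theta_pos lam_bd_pos e0
    by (intro divide_right_mono mult_right_mono divide_nonneg_pos) auto
  also have "\<dots> < 1" using assms(1) theta_pos by (subst pos_divide_less_eq) simp_all
  finally show lt: "(\<Sum>i\<in>UNIV. \<theta> / (1 + \<theta>) * p $ i * (\<bar>s i\<bar> * (lin_bd r i / (1 - r z)))) < 1" .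
  have "(\<lambda>x. P x * mpow (\<lambda>i. \<bar>s i\<bar> * (lin_bd r i / (1 - r z))) x) summable_on UNIV"
  proof (rule has_sum_imp_summable[OF has_sum_P_mpow])
    have "\<bar>\<bar>s i\<bar> * (lin_bd r i / (1 - r z))\<bar> = \<bar>s i\<bar> * (lin_bd r i / (1 - r z))" for i
      by (rule abs_of_nonneg) (intro mult_nonneg_nonneg nn abs_ge_zero)
    then show "(\<Sum>i\<in>UNIV. \<theta> / (1 + \<theta>) * p $ i * \<bar>\<bar>s i\<bar> * (lin_bd r i / (1 - r z))\<bar>) < 1"
      using lt by (simp only:)
  qed
  from summable_on_cmult_right[OF this, of "(1 - r z) powr (-\<alpha>)"]
  show "(\<lambda>x. P x * \<bar>mpow s x\<bar> * gf_bd x r) summable_on UNIV"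
    unfolding gf_alt(2)[of r, OF rz] mpow_mult abs_mpow by (simp add: mult_ac)
qed

section \<open>Moments of the polynomials against monomials, and orthogonality\<close>

text \<open>The numbers \<open>W_fn s j\<close> invert the substitution
  \<open>s\<^sub>i = L\<^sub>i(w) / (1 - w\<^sub>z)\<close>.\<close>

definition tr :: "'a \<Rightarrow> ('a \<Rightarrow> real) \<Rightarrow> real" where
  "tr j s = (\<Sum>i\<in>UNIV. p $ i * (u j $ i) * s i)"

definition A_fn :: "('a \<Rightarrow> real) \<Rightarrow> real" where
  "A_fn s = 1 + \<theta> * (1 - tr z s)"

definition W_fn :: "('a \<Rightarrow> real) \<Rightarrow> 'a \<Rightarrow> real" where
  "W_fn s j = (if j = z then \<theta> * (1 - tr z s) else tr j s / a j) / A_fn s"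

lemma tr_z: "tr z s = (\<Sum>i\<in>UNIV. p $ i * s i)"
  by (simp add: tr_def)

lemma A_fn_pos:
  assumes "\<theta> * (\<Sum>i\<in>UNIV. p $ i * \<bar>s i\<bar>) < 1 + \<theta>"
  shows "A_fn s > 0"
proof -
  have "tr z s \<le> (\<Sum>i\<in>UNIV. p $ i * \<bar>s i\<bar>)"
    unfolding tr_z by (rule sum_mono) (use p_pos in \<open>auto intro!: mult_left_mono simp: less_imp_le\<close>)
  then have "\<theta> * tr z s \<le> \<theta> * (\<Sum>i\<in>UNIV. p $ i * \<bar>s i\<bar>)"
    using theta_pos by simp
  with assms show ?thesis by (simp add: A_fn_def algebra_simps)
qed

text \<open>Collecting the coefficients of \<open>w\<close> shows where \<open>A_fn\<close> and
  \<open>W_fn\<close> come from: raised to the power \<open>-\<alpha>\<close>, the right-hand side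
  is the generating function of
  \<open>hinv n * A_fn s powr (-\<alpha>) * mpow (W_fn s) n\<close>.\<close>

lemma sum_p_s_lin:
  assumes "A_fn s \<noteq> 0"
  shows "(1 + \<theta>) * (1 - w z) - \<theta> * (\<Sum>i\<in>UNIV. p $ i * (s i * lin w i)) =
    A_fn s * (1 - (\<Sum>j\<in>UNIV. eta j * W_fn s j * w j))"
proof -
  have "(\<Sum>i\<in>UNIV. p $ i * (s i * lin w i)) = tr z s + (\<Sum>j\<in>UNIV. w j * (\<Sum>i\<in>UNIV. p $ i * lam i j * s i))"
    by (simp add: lin_def tr_z algebra_simps sum.distrib sum_distrib_left)
       (subst sum.swap, simp add: mult_ac)
  also have "(\<Sum>j\<in>UNIV. w j * (\<Sum>i\<in>UNIV. p $ i * lam i j * s i)) =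
     - ((1 + \<theta>) / \<theta> * tr z s * w z) + (\<Sum>j\<in>UNIV - {z}. w j * tr j s)"
    by (subst sum.remove[of UNIV z])
       (auto simp: lam_def tr_def sum_negf sum_distrib_left mult_ac intro!: sum.cong)
  finally have 1: "(1 + \<theta>) * (1 - w z) - \<theta> * (\<Sum>i\<in>UNIV. p $ i * (s i * lin w i)) =
      A_fn s - (1 + \<theta>) * (1 - tr z s) * w z - \<theta> * (\<Sum>j\<in>UNIV - {z}. w j * tr j s)"
    using theta_pos by (simp add: A_fn_def field_simps)
  have "A_fn s * (\<Sum>j\<in>UNIV. eta j * W_fn s j * w j) = A_fn s * (eta z * W_fn s z * w z) +
      (\<Sum>j\<in>UNIV - {z}. A_fn s * (eta j * W_fn s j * w j))"
    by (subst sum.remove[of UNIV z]) (auto simp: algebra_simps sum_distrib_left)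
  also have "A_fn s * (eta z * W_fn s z * w z) = (1 + \<theta>) * (1 - tr z s) * w z"
    using assms theta_pos by (simp add: eta_def W_fn_def)
  also have "(\<Sum>j\<in>UNIV - {z}. A_fn s * (eta j * W_fn s j * w j)) = \<theta> * (\<Sum>j\<in>UNIV - {z}. w j * tr j s)"
    unfolding sum_distrib_left
  proof (rule sum.cong)
    fix j assume "j \<in> UNIV - {z}"
    then show "A_fn s * (eta j * W_fn s j * w j) = \<theta> * (w j * tr j s)"
      using assms a_pos[of j] by (simp add: eta_def W_fn_def)
  qed auto
  finally show ?thesis using 1 by (simp add: algebra_simps)
qed

text \<open>Both sides are coefficients of the same power series in \<open>w\<close>: the sum of
  \<open>P x * mpow s x * gf x w\<close> over \<open>x\<close>, evaluated by
  \<open>has_sum_P_mpow\<close>, and a negative binomial series in the products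
  \<open>eta j * W_fn s j * w j\<close>.\<close>

lemma moment_gf:
  assumes s: "\<theta> * (\<Sum>i\<in>UNIV. p $ i * \<bar>s i\<bar>) < 1 + \<theta>"
  shows "((\<lambda>x. P x * Mx n x * mpow s x) has_sum hinv n * A_fn s powr (-\<alpha>) * mpow (W_fn s) n) UNIV"
proof -
  define \<kappa> where "\<kappa> = \<theta> * (\<Sum>i\<in>UNIV. p $ i * \<bar>s i\<bar>)"
  have "\<kappa> \<ge> 0" unfolding \<kappa>_def using theta_pos p_pos by (auto intro!: mult_nonneg_nonneg sum_nonneg simp: less_imp_le)
  then obtain \<epsilon> where eps: "\<epsilon> > 0" "\<epsilon> < 1" "\<kappa> * ((1 + lam_bd * \<epsilon>) / (1 - \<epsilon>)) < 1 + \<theta>"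
    using radius_exists s unfolding \<kappa>_def by blast
  have A: "A_fn s > 0" by (rule A_fn_pos[OF s])
  define f where "f w x n = P x * mpow s x * (Mx n x * mpow w n)" for w x n
  have sm: "(\<lambda>(x, n). f w x n) summable_on UNIV \<times> UNIV" if w: "\<And>j. \<bar>w j\<bar> \<le> \<epsilon>" for w
  proof (rule summable_on_pairs)
    have wz: "\<bar>w z\<bar> < 1" using w[of z] eps by linarith
    have eq: "(\<lambda>n. \<bar>f w x n\<bar>) = (\<lambda>n. (P x * \<bar>mpow s x\<bar>) * (\<bar>Mx n x\<bar> * mpow (\<lambda>j. \<bar>w j\<bar>) n))" for x
      using P_pos[of x] by (auto simp: f_def abs_mult abs_mpow)
    note g = abs_gf_bound[of "\<lambda>j. \<bar>w j\<bar>" x for x, simplified, OF wz]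
    show "(\<lambda>n. \<bar>f w x n\<bar>) summable_on UNIV" for x
      unfolding eq by (intro summable_on_cmult_right g)
    show "infsum (\<lambda>n. \<bar>f w x n\<bar>) UNIV \<le> P x * \<bar>mpow s x\<bar> * gf_bd x (\<lambda>j. \<bar>w j\<bar>)" for x
      unfolding eq infsum_cmult_right'
      using P_pos[of x] by (intro mult_left_mono g) auto
    show "(\<lambda>x. P x * \<bar>mpow s x\<bar> * gf_bd x (\<lambda>j. \<bar>w j\<bar>)) summable_on UNIV"
      by (rule has_sum_P_gf_bd(1)[OF eps(3)]) (use w eps in \<open>auto simp: \<kappa>_def\<close>)
  qed
  \<comment> \<open>Summability for a single \<open>n\<close> is a section of the joint summability
    at the constant point \<open>\<epsilon>\<close>, where the extra factor is not 0.\<close>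
  have sn: "(\<lambda>x. P x * Mx n x * mpow s x) summable_on UNIV" for n
  proof -
    have "(\<lambda>(n, x). f (\<lambda>_. \<epsilon>) x n) summable_on UNIV \<times> UNIV"
      using sm[of "\<lambda>_. \<epsilon>"] eps by (subst summable_on_swap) (simp add: case_prod_unfold)
    from summable_on_SigmaD1[OF this, of n]
    have "(\<lambda>x. P x * Mx n x * mpow s x * mpow (\<lambda>_. \<epsilon>) n) summable_on UNIV"
      by (simp add: f_def mult_ac)
    moreover have "mpow (\<lambda>_. \<epsilon>) n \<noteq> 0" using eps by (simp add: mpow_const)
    ultimately show ?thesis by (simp add: summable_on_cmult_left')
  qed
  define F where "F n = infsum (\<lambda>x. P x * Mx n x * mpow s x) UNIV" for n
  have F: "((\<lambda>n. F n * mpow w n) has_sum (A_fn s * (1 - (\<Sum>j\<in>UNIV. eta j * W_fn s j * w j))) powr (-\<alpha>)) UNIV"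
    if w: "\<And>j. \<bar>w j\<bar> < \<epsilon>" for w
  proof (rule has_sum_exchange[OF sm[of w]])
    have wz: "\<bar>w z\<bar> < 1" using w[of z] eps by linarith
    then have wz': "w z < 1" by linarith
    show "((\<lambda>n. f w x n) has_sum P x * mpow s x * gf x w) UNIV" for x
      unfolding f_def by (intro has_sum_cmult_right has_sum_gf wz)
    show "((\<lambda>x. f w x n) has_sum F n * mpow w n) UNIV" for n
      using has_sum_cmult_left[OF has_sum_infsum[OF sn], of n "mpow w n"] by (simp add: f_def F_def mult_ac)
    have "(\<Sum>i\<in>UNIV. \<theta> / (1 + \<theta>) * p $ i * \<bar>s i * (lin w i / (1 - w z))\<bar>)
       \<le> (\<Sum>i\<in>UNIV. \<theta> / (1 + \<theta>) * p $ i * (\<bar>s i\<bar> * (lin_bd (\<lambda>j. \<bar>w j\<bar>) i / (1 - \<bar>w z\<bar>))))"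
      using theta_pos p_pos wz lin_bd_ge_1[of "\<lambda>j. \<bar>w j\<bar>"] unfolding abs_mult abs_divide
      by (intro sum_mono mult_left_mono frac_le abs_lin_le) (auto simp: less_imp_le order_trans[of 0 1])
    also have "\<dots> < 1"
      by (rule has_sum_P_gf_bd(2)[OF eps(3)]) (use w eps in \<open>auto simp: \<kappa>_def less_imp_le\<close>)
    finally have "((\<lambda>x. P x * mpow (\<lambda>i. s i * (lin w i / (1 - w z))) x) has_sum
        ((1 + \<theta>) - \<theta> * (\<Sum>i\<in>UNIV. p $ i * (s i * (lin w i / (1 - w z))))) powr (-\<alpha>)) UNIV"
      by (rule has_sum_P_mpow)
    from has_sum_cmult_right[OF this, of "(1 - w z) powr (-\<alpha>)"]
    have 1: "((\<lambda>x. P x * mpow s x * gf x w) has_sum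
        (1 - w z) powr (-\<alpha>) * ((1 + \<theta>) - \<theta> * (\<Sum>i\<in>UNIV. p $ i * (s i * (lin w i / (1 - w z))))) powr (-\<alpha>)) UNIV"
      unfolding gf_alt(1)[of w, OF wz'] mpow_mult by (simp add: mult_ac)
    have eq: "(1 - w z) * ((1 + \<theta>) - \<theta> * (\<Sum>i\<in>UNIV. p $ i * (s i * (lin w i / (1 - w z))))) =
        A_fn s * (1 - (\<Sum>j\<in>UNIV. eta j * W_fn s j * w j))"
    proof -
      have "(1 - w z) * (\<Sum>i\<in>UNIV. p $ i * (s i * (lin w i / (1 - w z)))) = (\<Sum>i\<in>UNIV. p $ i * (s i * lin w i))"
        unfolding sum_distrib_left using wz' by (intro sum.cong) auto
      then have "(1 - w z) * ((1 + \<theta>) - \<theta> * (\<Sum>i\<in>UNIV. p $ i * (s i * (lin w i / (1 - w z))))) =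
        (1 + \<theta>) * (1 - w z) - \<theta> * (\<Sum>i\<in>UNIV. p $ i * (s i * lin w i))"
        by (simp only: right_diff_distrib mult.left_commute[of "1 - w z" \<theta>]) (simp add: algebra_simps)
      then show ?thesis using sum_p_s_lin[of s w] A by simp
    qed
    show "((\<lambda>x. P x * mpow s x * gf x w) has_sum (A_fn s * (1 - (\<Sum>j\<in>UNIV. eta j * W_fn s j * w j))) powr (-\<alpha>)) UNIV"
      using 1 unfolding eq[symmetric] by (subst powr_mult) (use wz' in auto)
  qed (use w in \<open>auto intro: less_imp_le\<close>)
  define S where "S = (\<Sum>j\<in>UNIV. \<bar>eta j * W_fn s j\<bar>)"
  have S: "S \<ge> 0" by (simp add: S_def sum_nonneg)
  \<comment> \<open>Below \<open>\<epsilon>\<close> the exchange of sums is valid; below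
    \<open>1 / (S + 1)\<close> the negative binomial series in \<open>n\<close> converges.\<close>
  define \<delta> where "\<delta> = min \<epsilon> (1 / (S + 1))"
  have delta: "\<delta> > 0" "\<delta> \<le> \<epsilon>" "\<delta> * S < 1"
  proof -
    show "\<delta> > 0" "\<delta> \<le> \<epsilon>" using S eps by (auto simp: \<delta>_def)
    have "\<delta> * S \<le> 1 / (S + 1) * S" using S by (intro mult_right_mono) (auto simp: \<delta>_def)
    also have "\<dots> < 1" using S by simp
    finally show "\<delta> * S < 1" .
  qed
  have "F n = hinv n * A_fn s powr (-\<alpha>) * mpow (W_fn s) n"
  proof (rule mpowser_unique[of \<delta> F "\<lambda>w. (A_fn s * (1 - (\<Sum>j\<in>UNIV. eta j * W_fn s j * w j))) powr (-\<alpha>)"])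
    fix w :: "'a \<Rightarrow> real"
    assume w: "\<And>j. \<bar>w j\<bar> < \<delta>"
    show "((\<lambda>n. F n * mpow w n) has_sum (A_fn s * (1 - (\<Sum>j\<in>UNIV. eta j * W_fn s j * w j))) powr (-\<alpha>)) UNIV"
      using w delta(2) by (intro F) (meson less_le_trans)
    have "(\<Sum>j\<in>UNIV. \<bar>eta j * W_fn s j * w j\<bar>) \<le> (\<Sum>j\<in>UNIV. \<bar>eta j * W_fn s j\<bar> * \<delta>)"
      using less_imp_le[OF w] by (intro sum_mono) (simp add: abs_mult[of _ "w _"] mult_left_mono)
    also have "\<dots> = \<delta> * S" by (simp add: S_def sum_distrib_left mult.commute)
    finally have lt: "(\<Sum>j\<in>UNIV. \<bar>eta j * W_fn s j * w j\<bar>) < 1" using delta by simp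
    then have "(\<Sum>j\<in>UNIV. eta j * W_fn s j * w j) < 1"
      using sum_abs[of "\<lambda>j. eta j * W_fn s j * w j" UNIV] by linarith
    moreover have "((\<lambda>n. A_fn s powr (-\<alpha>) * (pochhammer \<alpha> (total n) / mfact n * mpow (\<lambda>j. eta j * W_fn s j * w j) n)) has_sum
        A_fn s powr (-\<alpha>) * (1 - (\<Sum>j\<in>UNIV. eta j * W_fn s j * w j)) powr (-\<alpha>)) UNIV"
      by (intro has_sum_cmult_right multi_negbin_series lt alpha_pos)
    ultimately show "((\<lambda>n. hinv n * A_fn s powr (-\<alpha>) * mpow (W_fn s) n * mpow w n) has_sum
        (A_fn s * (1 - (\<Sum>j\<in>UNIV. eta j * W_fn s j * w j))) powr (-\<alpha>)) UNIV"
      using A by (simp add: powr_mult hinv_def mpow_mult mult_ac)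
  qed (rule delta(1))
  then show ?thesis using has_sum_infsum[OF sn[of n]] by (simp add: F_def)
qed

text \<open>\<open>moment_gf\<close> is taken at the point \<open>s i = lin w i / (1 - w z)\<close>,
  where \<open>A_fn s\<close> is \<open>1 / (1 - w z)\<close> and \<open>W_fn s\<close> is
  \<open>w\<close>. The powers of \<open>1 - w z\<close> cancel, and comparing coefficients of
  \<open>w\<close> leaves a single term.\<close>

lemma orthogonality: "((\<lambda>x. P x * Mx n x * Mx m x) has_sum (if m = n then hinv n else 0)) UNIV"
proof -
  obtain \<epsilon> where eps: "\<epsilon> > 0" "\<epsilon> < 1" "\<theta> * ((1 + lam_bd * \<epsilon>) / (1 - \<epsilon>)) < 1 + \<theta>"
    using radius_exists[of \<theta>] theta_pos by auto
  have cond: "\<theta> * (\<Sum>i\<in>UNIV. p $ i * \<bar>lin_bd r i / (1 - r z)\<bar>) < 1 + \<theta>"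
    if r: "\<And>j. 0 \<le> r j" "\<And>j. r j \<le> \<epsilon>" for r
  proof -
    have rz: "r z < 1" using r(2)[of z] eps by linarith
    have "(\<Sum>i\<in>UNIV. p $ i * \<bar>lin_bd r i / (1 - r z)\<bar>) \<le> (\<Sum>i\<in>UNIV. p $ i * ((1 + lam_bd * \<epsilon>) / (1 - \<epsilon>)))"
    proof (intro sum_mono mult_left_mono)
      fix i
      have "\<bar>lin_bd r i / (1 - r z)\<bar> = lin_bd r i / (1 - r z)"
        using lin_bd_ge_1[of r i] r rz by simp
      then show "\<bar>lin_bd r i / (1 - r z)\<bar> \<le> (1 + lam_bd * \<epsilon>) / (1 - \<epsilon>)"
        using lin_quotient_le[of r \<epsilon> i] r eps by simp
    qed (use p_pos in \<open>auto simp: less_imp_le\<close>)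
    also have "\<dots> = (1 + lam_bd * \<epsilon>) / (1 - \<epsilon>)"
      by (simp add: sum_p flip: sum_distrib_right sum_divide_distrib)
    finally have "\<theta> * (\<Sum>i\<in>UNIV. p $ i * \<bar>lin_bd r i / (1 - r z)\<bar>) \<le> \<theta> * ((1 + lam_bd * \<epsilon>) / (1 - \<epsilon>))"
      by (rule mult_left_mono) (use theta_pos in auto)
    with eps(3) show ?thesis by linarith
  qed
  have sm: "(\<lambda>(x, m). P x * Mx n x * (Mx m x * mpow w m)) summable_on UNIV \<times> UNIV"
    if w: "\<And>j. \<bar>w j\<bar> \<le> \<epsilon>" for w
  proof (rule summable_on_pairs)
    have wz: "\<bar>w z\<bar> < 1" using w[of z] eps by linarith
    have eq: "(\<lambda>m. \<bar>P x * Mx n x * (Mx m x * mpow w m)\<bar>) = (\<lambda>m. \<bar>P x * Mx n x\<bar> * (\<bar>Mx m x\<bar> * mpow (\<lambda>j. \<bar>w j\<bar>) m))" for x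
      by (auto simp: abs_mult abs_mpow)
    note g = abs_gf_bound[of "\<lambda>j. \<bar>w j\<bar>" x for x, simplified, OF wz]
    show "(\<lambda>m. \<bar>P x * Mx n x * (Mx m x * mpow w m)\<bar>) summable_on UNIV" for x
      unfolding eq by (intro summable_on_cmult_right g)
    show "infsum (\<lambda>m. \<bar>P x * Mx n x * (Mx m x * mpow w m)\<bar>) UNIV \<le> \<bar>P x * Mx n x\<bar> * gf_bd x (\<lambda>j. \<bar>w j\<bar>)" for x
      unfolding eq infsum_cmult_right' by (intro mult_left_mono g) auto
    have "(\<lambda>x. P x * Mx n x * mpow (\<lambda>i. lin_bd (\<lambda>j. \<bar>w j\<bar>) i / (1 - \<bar>w z\<bar>)) x) summable_on UNIV"
      using moment_gf[OF cond[of "\<lambda>j. \<bar>w j\<bar>"]] w by (auto intro: has_sum_imp_summable)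
    then have "(\<lambda>x. \<bar>P x * Mx n x * mpow (\<lambda>i. lin_bd (\<lambda>j. \<bar>w j\<bar>) i / (1 - \<bar>w z\<bar>)) x\<bar>) summable_on UNIV"
      by (simp only: summable_on_abs_real)
    moreover have "mpow (\<lambda>i. lin_bd (\<lambda>j. \<bar>w j\<bar>) i / (1 - \<bar>w z\<bar>)) x \<ge> 0" for x
      using wz lin_bd_ge_1[of "\<lambda>j. \<bar>w j\<bar>"] by (intro mpow_nonneg divide_nonneg_nonneg) (auto intro: order_trans[of 0 1])
    ultimately have "(\<lambda>x. \<bar>P x * Mx n x\<bar> * mpow (\<lambda>i. lin_bd (\<lambda>j. \<bar>w j\<bar>) i / (1 - \<bar>w z\<bar>)) x) summable_on UNIV"
      by (simp add: abs_mult)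
    from summable_on_cmult_right[OF this, of "(1 - \<bar>w z\<bar>) powr (-\<alpha>)"]
    show "(\<lambda>x. \<bar>P x * Mx n x\<bar> * gf_bd x (\<lambda>j. \<bar>w j\<bar>)) summable_on UNIV"
      unfolding gf_alt(2)[of "\<lambda>j. \<bar>w j\<bar>", OF wz] by (simp add: mult_ac)
  qed
  have sn: "(\<lambda>x. P x * Mx n x * Mx m x) summable_on UNIV" for m
  proof -
    have "(\<lambda>(m, x). P x * Mx n x * (Mx m x * mpow (\<lambda>_. \<epsilon>) m)) summable_on UNIV \<times> UNIV"
      using sm[of "\<lambda>_. \<epsilon>"] eps by (subst summable_on_swap) (simp add: case_prod_unfold)
    from summable_on_SigmaD1[OF this, of m]
    have "(\<lambda>x. P x * Mx n x * Mx m x * mpow (\<lambda>_. \<epsilon>) m) summable_on UNIV"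
      by (simp add: mult_ac)
    moreover have "mpow (\<lambda>_. \<epsilon>) m \<noteq> 0" using eps by (simp add: mpow_const)
    ultimately show ?thesis by (simp add: summable_on_cmult_left')
  qed
  define F where "F m = infsum (\<lambda>x. P x * Mx n x * Mx m x) UNIV" for m
  have F: "((\<lambda>m. F m * mpow w m) has_sum hinv n * mpow w n) UNIV"
    if w: "\<And>j. \<bar>w j\<bar> < \<epsilon>" for w
  proof (rule has_sum_exchange[OF sm[of w]])
    have wz: "\<bar>w z\<bar> < 1" using w[of z] eps by linarith
    then have wz': "w z < 1" by linarith
    define s where "s i = lin w i / (1 - w z)" for i
    show "((\<lambda>m. P x * Mx n x * (Mx m x * mpow w m)) has_sum P x * Mx n x * gf x w) UNIV" for x
      by (intro has_sum_cmult_right has_sum_gf wz)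
    show "((\<lambda>x. P x * Mx n x * (Mx m x * mpow w m)) has_sum F m * mpow w m) UNIV" for m
      using has_sum_cmult_left[OF has_sum_infsum[OF sn], of m "mpow w m"] by (simp add: F_def mult_ac)
    have "(\<Sum>i\<in>UNIV. p $ i * \<bar>s i\<bar>) \<le> (\<Sum>i\<in>UNIV. p $ i * \<bar>lin_bd (\<lambda>j. \<bar>w j\<bar>) i / (1 - \<bar>w z\<bar>)\<bar>)"
      using p_pos wz order_trans[OF abs_lin_le abs_ge_self, of w] unfolding s_def abs_mult abs_divide
      by (intro sum_mono mult_left_mono frac_le) (auto simp: less_imp_le)
    then have "\<theta> * (\<Sum>i\<in>UNIV. p $ i * \<bar>s i\<bar>) \<le> \<theta> * (\<Sum>i\<in>UNIV. p $ i * \<bar>lin_bd (\<lambda>j. \<bar>w j\<bar>) i / (1 - \<bar>w z\<bar>)\<bar>)"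
      using theta_pos by simp
    also have "\<dots> < 1 + \<theta>"
      using cond[of "\<lambda>j. \<bar>w j\<bar>"] w by (simp add: less_imp_le)
    finally have s: "\<theta> * (\<Sum>i\<in>UNIV. p $ i * \<bar>s i\<bar>) < 1 + \<theta>" .
    have trz: "tr z s = (1 - (1 + \<theta>) / \<theta> * w z) / (1 - w z)"
      unfolding tr_z s_def sum_p_lin[symmetric] sum_divide_distrib by simp
    have "1 - tr z s = w z / (\<theta> * (1 - w z))"
      unfolding trz using wz' theta_pos by (simp add: field_simps)
    then have tz: "\<theta> * (1 - tr z s) = w z / (1 - w z)" using theta_pos by simp
    have A: "A_fn s = 1 / (1 - w z)" unfolding A_fn_def tz using wz' by (simp add: field_simps)
    have "W_fn s = w"
    proof
      fix j show "W_fn s j = w j"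
      proof (cases "j = z")
        case True then show ?thesis using wz' by (simp add: W_fn_def A tz)
      next
        case False
        have "tr j s = a j * w j / (1 - w z)"
          unfolding tr_def s_def sum_pu_lin[OF False, symmetric] sum_divide_distrib by simp
        then show ?thesis using False wz' a_pos[of j] by (simp add: W_fn_def A)
      qed
    qed
    then have "((\<lambda>x. P x * Mx n x * mpow s x) has_sum hinv n * (1 / (1 - w z)) powr (-\<alpha>) * mpow w n) UNIV"
      using moment_gf[OF s, of n] by (simp add: A)
    from has_sum_cmult_right[OF this, of "(1 - w z) powr (-\<alpha>)"]
    have "((\<lambda>x. P x * Mx n x * gf x w) has_sum (1 - w z) powr (-\<alpha>) * (1 / (1 - w z)) powr (-\<alpha>) * (hinv n * mpow w n)) UNIV"
      unfolding gf_alt(1)[of w, OF wz'] s_def by (simp add: mult_ac)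
    moreover have "(1 - w z) powr (-\<alpha>) * (1 / (1 - w z)) powr (-\<alpha>) = 1"
      using wz' by (subst powr_mult[symmetric]) auto
    ultimately show "((\<lambda>x. P x * Mx n x * gf x w) has_sum hinv n * mpow w n) UNIV" by simp
  qed (use w in \<open>auto intro: less_imp_le\<close>)
  have "F m = (if m = n then hinv n else 0)"
  proof (rule mpowser_unique[OF eps(1) F])
    fix w :: "'a \<Rightarrow> real"
    show "((\<lambda>m. (if m = n then hinv n else 0) * mpow w m) has_sum hinv n * mpow w n) UNIV"
      by (rule has_sum_finite_neutralI[of "{n}"]) auto
  qed
  then show ?thesis using has_sum_infsum[OF sn[of m]] by (simp add: F_def)
qed

end

section \<open>Decay of the coefficients and moments of the kernel\<close>

lemma fact_prod_le_fact_sum: "finite A \<Longrightarrow> (\<Prod>i\<in>A. fact (n i)) \<le> (fact (\<Sum>i\<in>A. n i) :: real)"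
proof (induction A rule: finite_induct)
  case (insert i A)
  have "fact (n i) * fact (\<Sum>i\<in>A. n i) \<le> (fact (n i + (\<Sum>i\<in>A. n i)) :: nat)"
    by (rule dvd_imp_le[OF fact_fact_dvd_fact]) simp
  then have "fact (n i) * fact (\<Sum>i\<in>A. n i) \<le> (fact (n i + (\<Sum>i\<in>A. n i)) :: real)"
    by (metis of_nat_fact of_nat_le_iff of_nat_mult)
  moreover have "fact (n i) * (\<Prod>i\<in>A. fact (n i)) \<le> fact (n i) * (fact (\<Sum>i\<in>A. n i) :: real)"
    by (intro mult_left_mono insert.IH) simp
  ultimately have "fact (n i) * (\<Prod>i\<in>A. fact (n i)) \<le> (fact (n i + (\<Sum>i\<in>A. n i)) :: real)"
    by linarith
  then show ?case using insert.hyps by simp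
qed simp

lemma mfact_le: "mfact n \<le> fact (total n)"
  unfolding mfact_def total_def by (rule fact_prod_le_fact_sum) simp

lemma pochhammer_ge_fact: "\<alpha> > 0 \<Longrightarrow> \<alpha> * fact k \<le> pochhammer \<alpha> (Suc k)" for \<alpha> :: real
proof (induction k)
  case (Suc k)
  have "\<alpha> * fact (Suc k) = \<alpha> * fact k * real (Suc k)" by simp
  also have "\<dots> \<le> pochhammer \<alpha> (Suc k) * (\<alpha> + real (Suc k))"
    using Suc by (intro mult_mono) (auto intro: pochhammer_nonneg)
  finally show ?case by (simp add: pochhammer_Suc[of \<alpha> "Suc k"])
qed simp

text \<open>The quotient is at most \<open>k / \<alpha>\<close> for \<open>k > 0\<close>, and
  Bernoulli's inequality trades this linear growth for \<open>K ^ k\<close>.\<close>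

lemma fact_quotient_le:
  fixes \<alpha> K :: real
  assumes "\<alpha> > 0" "K > 1"
  shows "fact k / pochhammer \<alpha> k \<le> (1 + 1 / (\<alpha> * (K - 1))) * K ^ k"
proof (cases k)
  case 0
  then show ?thesis using assms by simp
next
  case (Suc l)
  have p: "pochhammer \<alpha> k > 0" using assms by (simp add: pochhammer_pos)
  have "fact k / pochhammer \<alpha> k \<le> fact k / (\<alpha> * fact l)"
    using assms p pochhammer_ge_fact[OF assms(1), of l] Suc by (intro divide_left_mono mult_pos_pos) auto
  also have "\<dots> = real k / \<alpha>" by (simp add: Suc)
  also have "real k \<le> K ^ k / (K - 1)"
    using Bernoulli_inequality[of "K - 1" k] assms by (simp add: field_simps)
  then have "real k / \<alpha> \<le> K ^ k / (K - 1) / \<alpha>"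
    using assms by (intro divide_right_mono) auto
  then have "real k / \<alpha> \<le> (1 / (\<alpha> * (K - 1))) * K ^ k"
    by (simp add: mult.commute)
  also have "\<dots> \<le> (1 + 1 / (\<alpha> * (K - 1))) * K ^ k"
    using assms by (intro mult_right_mono) auto
  finally show ?thesis .
qed

lemma finite_below: "finite {m :: 'd::finite \<Rightarrow> nat. \<forall>i. m i \<le> k i}"
proof -
  have "{m. \<forall>i. m i \<le> k i} = PiE UNIV (\<lambda>i. {..k i})" by (auto simp: PiE_UNIV_domain)
  then show ?thesis by (simp add: finite_PiE)
qed

lemma has_sum_mconvolution:
  fixes b c :: "('d::finite \<Rightarrow> nat) \<Rightarrow> real"
  assumes "((\<lambda>n. b n * mpow w n) has_sum B) UNIV" "((\<lambda>n. c n * mpow w n) has_sum C) UNIV"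
  shows "((\<lambda>n. (\<Sum>m | \<forall>i. m i \<le> n i. b m * c (\<lambda>i. n i - m i)) * mpow w n) has_sum B * C) UNIV"
proof -
  define f where "f = (\<lambda>(n, m). b m * c (\<lambda>i. n i - m i) * mpow w n)"
  have "((\<lambda>(m, n). (b m * mpow w m) * (c n * mpow w n)) has_sum B * C) (UNIV \<times> UNIV)"
    by (rule has_sum_mult_pairs[OF assms])
  moreover have "f (\<lambda>i. m i + n i, m) = (b m * mpow w m) * (c n * mpow w n)" for m n
    by (simp add: f_def mpow_add)
  ultimately have "((\<lambda>q. f ((\<lambda>(m, n). (\<lambda>i. m i + n i, m)) q)) has_sum B * C) (UNIV \<times> UNIV)"
    by (simp add: case_prod_unfold)
  moreover have "bij_betw (\<lambda>(m :: 'd \<Rightarrow> nat, n). (\<lambda>i. m i + n i, m)) (UNIV \<times> UNIV) (Sigma UNIV (\<lambda>n. {m. \<forall>i. m i \<le> n i}))"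
    by (rule bij_betwI[where g = "\<lambda>(n, m). (m, \<lambda>i. n i - m i)"]) auto
  ultimately have "(f has_sum B * C) (Sigma UNIV (\<lambda>n. {m. \<forall>i. m i \<le> n i}))"
    by (subst (asm) has_sum_reindex_bij_betw) auto
  then show ?thesis
    by (rule has_sum_SigmaD) (auto simp: f_def sum_distrib_right finite_below intro!: has_sum_finiteI)
qed

section \<open>Power series with non-negative coefficients, a class closed under sums, products and
  powers\<close>

definition nn_series :: "(('d::finite \<Rightarrow> real) \<Rightarrow> real) \<Rightarrow> bool" where
  "nn_series F \<longleftrightarrow> (\<exists>c. (\<forall>n. c n \<ge> 0) \<and>
     (\<forall>t. (\<forall>i. \<bar>t i\<bar> < 1) \<longrightarrow> ((\<lambda>n. c n * mpow t n) has_sum F t) UNIV))"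

lemma nn_series_const: "c \<ge> 0 \<Longrightarrow> nn_series (\<lambda>_. c)"
  unfolding nn_series_def
  by (rule exI[of _ "\<lambda>n. if n = (\<lambda>_. 0) then c else 0"])
     (auto intro!: has_sum_finite_neutralI[of "{\<lambda>_. 0}"] split: if_splits)

lemma nn_series_var: "nn_series (\<lambda>t. t k)"
  unfolding nn_series_def
  by (rule exI[of _ "\<lambda>n. if n = e_vec k then 1 else 0"])
     (auto intro!: has_sum_finite_neutralI[of "{e_vec k}"] split: if_splits)

lemma nn_series_add:
  assumes "nn_series F" "nn_series G"
  shows "nn_series (\<lambda>t. F t + G t)"
proof -
  from assms obtain b c where "\<forall>n. b n \<ge> 0" "\<forall>n. c n \<ge> 0"
    and "\<And>t. (\<forall>i. \<bar>t i\<bar> < 1) \<Longrightarrow> ((\<lambda>n. b n * mpow t n) has_sum F t) UNIV"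
    and "\<And>t. (\<forall>i. \<bar>t i\<bar> < 1) \<Longrightarrow> ((\<lambda>n. c n * mpow t n) has_sum G t) UNIV"
    unfolding nn_series_def by metis
  then show ?thesis
    unfolding nn_series_def by (intro exI[of _ "\<lambda>n. b n + c n"]) (auto simp: distrib_right intro!: has_sum_add)
qed

lemma nn_series_mult:
  assumes "nn_series F" "nn_series G"
  shows "nn_series (\<lambda>t. F t * G t)"
proof -
  from assms obtain b c where "\<forall>n. b n \<ge> 0" "\<forall>n. c n \<ge> 0"
    and "\<And>t. (\<forall>i. \<bar>t i\<bar> < 1) \<Longrightarrow> ((\<lambda>n. b n * mpow t n) has_sum F t) UNIV"
    and "\<And>t. (\<forall>i. \<bar>t i\<bar> < 1) \<Longrightarrow> ((\<lambda>n. c n * mpow t n) has_sum G t) UNIV"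
    unfolding nn_series_def by metis
  then show ?thesis
    unfolding nn_series_def
    by (intro exI[of _ "\<lambda>n. \<Sum>m | \<forall>i. m i \<le> n i. b m * c (\<lambda>i. n i - m i)"])
       (auto intro!: has_sum_mconvolution sum_nonneg)
qed

lemma nn_series_sum: "(\<And>s. s \<in> S \<Longrightarrow> nn_series (F s)) \<Longrightarrow> nn_series (\<lambda>t. \<Sum>s\<in>S. F s t)"
  by (induction S rule: infinite_finite_induct) (auto intro: nn_series_const nn_series_add)

lemma nn_series_power: "nn_series F \<Longrightarrow> nn_series (\<lambda>t. F t ^ n)"
  by (induction n) (auto intro: nn_series_const nn_series_mult)

lemma nn_series_prod: "(\<And>s. s \<in> S \<Longrightarrow> nn_series (F s)) \<Longrightarrow> nn_series (\<lambda>t. \<Prod>s\<in>S. F s t)"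
  by (induction S rule: infinite_finite_induct) (auto intro: nn_series_const nn_series_mult)

lemma nn_series_negbin:
  assumes "\<And>i. q i \<ge> 0" "(\<Sum>i\<in>UNIV. q i) < 1" "\<gamma> > 0"
  shows "nn_series (\<lambda>t. (1 - (\<Sum>i\<in>UNIV. q i * t i)) powr (-\<gamma>))"
  unfolding nn_series_def
proof (intro exI[of _ "\<lambda>n. pochhammer \<gamma> (total n) / mfact n * mpow q n"] conjI allI impI)
  show "0 \<le> pochhammer \<gamma> (total n) / mfact n * mpow q n" for n
    using assms by (intro mult_nonneg_nonneg divide_nonneg_pos pochhammer_nonneg mpow_nonneg) auto
  fix t :: "'a \<Rightarrow> real" assume t: "\<forall>i. \<bar>t i\<bar> < 1"
  have "(\<Sum>i\<in>UNIV. \<bar>q i * t i\<bar>) \<le> (\<Sum>i\<in>UNIV. q i)"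
    using assms(1) t by (intro sum_mono) (auto simp: abs_mult intro: mult_left_le less_imp_le)
  with assms have "(\<Sum>i\<in>UNIV. \<bar>q i * t i\<bar>) < 1" by linarith
  from multi_negbin_series[OF this assms(3)]
  show "((\<lambda>n. pochhammer \<gamma> (total n) / mfact n * mpow q n * mpow t n) has_sum (1 - (\<Sum>i\<in>UNIV. q i * t i)) powr (-\<gamma>)) UNIV"
    by (simp add: mpow_mult mult_ac)
qed

section \<open>Geometric decay of the coefficients\<close>

context meixner_system
begin

text \<open>The factor \<open>(1 + 2\<theta>) / (2\<theta>)\<close> exceeds \<open>1\<close>, which absorbs the polynomial growth of
  \<open>k! / (\<alpha>)\<^sub>k\<close>, and is less than \<open>eta z\<close>, which keeps \<open>vd z\<close> below \<open>1\<close>.\<close>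

definition vd :: "'a \<Rightarrow> real" where
  "vd j = sqrt ((1 + 2 * \<theta>) / (2 * \<theta>) / eta j)"

text \<open>The constant of \<open>fact_quotient_le\<close> at
  \<open>K = (1 + 2 * \<theta>) / (2 * \<theta>)\<close>, for which
  \<open>K - 1 = 1 / (2 * \<theta>)\<close>.\<close>

definition Cd :: real where "Cd = 1 + 2 * \<theta> / \<alpha>"

lemma vd_pos: "vd j > 0"
  unfolding vd_def using theta_pos eta_pos[of j] by simp

lemma vd_z: "vd z < 1"
proof -
  have "(1 + 2 * \<theta>) / (2 * \<theta>) / eta z < 1"
  proof -
    have "(1 + 2 * \<theta>) / (2 * \<theta>) / eta z = (1 + 2 * \<theta>) / (2 + 2 * \<theta>)"
      using theta_pos by (simp add: eta_def distrib_left)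
    also have "\<dots> < 1" using theta_pos by simp
    finally show ?thesis .
  qed
  then show ?thesis unfolding vd_def using real_sqrt_less_mono by fastforce
qed

lemma Cd_pos: "Cd > 0"
  using theta_pos alpha_pos by (simp add: Cd_def add_pos_pos)

text \<open>The bound is a square so that one factor \<open>mpow vd n\<close> can be paired with
  \<open>Mx n x\<close> and the other with \<open>Mx n y\<close>.\<close>

lemma hinv_decay: "inverse (hinv n) \<le> Cd * (mpow vd n)\<^sup>2"
proof -
  define K where "K = (1 + 2 * \<theta>) / (2 * \<theta>)"
  have K: "K > 1" "K - 1 = 1 / (2 * \<theta>)"
    using theta_pos by (auto simp: K_def field_simps)
  have p: "pochhammer \<alpha> (total n) > 0" using alpha_pos by (simp add: pochhammer_pos)
  have "mfact n / pochhammer \<alpha> (total n) \<le> fact (total n) / pochhammer \<alpha> (total n)"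
    using p mfact_le by (intro divide_right_mono) auto
  also have "\<dots> \<le> (1 + 1 / (\<alpha> * (K - 1))) * K ^ total n"
    by (rule fact_quotient_le[OF alpha_pos K(1)])
  also have "1 + 1 / (\<alpha> * (K - 1)) = Cd"
    by (simp add: K Cd_def)
  finally have "mfact n / pochhammer \<alpha> (total n) \<le> Cd * K ^ total n" .
  then have "mfact n / pochhammer \<alpha> (total n) * inverse (mpow eta n) \<le> Cd * K ^ total n * inverse (mpow eta n)"
    using mpow_pos[of eta n] eta_pos by (intro mult_right_mono) auto
  moreover have "(mpow vd n)\<^sup>2 = K ^ total n * inverse (mpow eta n)"
  proof -
    have "(mpow vd n)\<^sup>2 = mpow (\<lambda>j. vd j * vd j) n" by (simp add: mpow_mult power2_eq_square)
    also have "(\<lambda>j. vd j * vd j) = (\<lambda>j. K * inverse (eta j))"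
    proof
      fix j
      have "K / eta j \<ge> 0" using K(1) eta_pos[of j] by simp
      then show "vd j * vd j = K * inverse (eta j)"
        unfolding vd_def K_def[symmetric] by (simp only: real_sqrt_mult_self abs_of_nonneg divide_inverse)
    qed
    finally show ?thesis by (simp add: mpow_mult mpow_const mpow_inverse)
  qed
  ultimately show ?thesis by (simp add: hinv_def divide_inverse mult_ac)
qed

lemma Mx_zero: "Mx (\<lambda>_. 0) x = 1"
proof -
  have "((\<lambda>n. Mx n x * mpow (\<lambda>_. 0) n) has_sum gf x (\<lambda>_. 0)) UNIV"
    by (rule has_sum_gf) simp
  moreover have "mpow (\<lambda>_::'a. 0 :: real) n = (if n = (\<lambda>_. 0) then 1 else 0)" for n
    by (simp add: mpow_const total_eq_0_iff power_0_left)
  moreover have "((\<lambda>n. Mx n x * (if n = (\<lambda>_. 0) then 1 else 0)) has_sum Mx (\<lambda>_. 0) x) UNIV"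
    by (rule has_sum_finite_neutralI[of "{\<lambda>_. 0}"]) auto
  moreover have "gf x (\<lambda>_. 0) = 1"
  proof -
    have "lin (\<lambda>_. 0) = (\<lambda>_. 1)" by (auto simp: lin_def)
    then show ?thesis by (simp add: gf_def mpow_const)
  qed
  ultimately show ?thesis by (simp add: has_sum_unique)
qed

text \<open>Only \<open>vd z < 1\<close> matters; the other \<open>vd j\<close> may exceed
  1.\<close>

lemma summable_Mx_vd: "(\<lambda>n. \<bar>Mx n x\<bar> * mpow vd n) summable_on UNIV"
  by (rule abs_gf_bound) (auto simp: vd_z less_imp_le[OF vd_pos])

lemma second_moment: "((\<lambda>x. P x * (Mx n x)\<^sup>2) has_sum hinv n) UNIV"
  using orthogonality[of n n] by (simp add: power2_eq_square mult_ac)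

lemma has_sum_P: "(P has_sum 1) UNIV"
  using second_moment[of "\<lambda>_. 0"] by (simp add: Mx_zero)

text \<open>This is 2ab <= a^2 + b^2, balanced by the weight \<open>v = mpow vd n\<close>: since
  \<open>inverse (hinv n)\<close> is at most \<open>Cd * v\<^sup>2\<close>, both resulting terms are
  of order \<open>v\<close>.\<close>

lemma mixed_moment_bound:
  assumes "((\<lambda>y. P y * (\<phi> y)\<^sup>2) has_sum \<Phi>) UNIV"
  shows "(\<lambda>y. \<bar>P y * \<phi> y * Mx n y\<bar>) summable_on UNIV"
    and "inverse (hinv n) * infsum (\<lambda>y. \<bar>P y * \<phi> y * Mx n y\<bar>) UNIV \<le> (\<Phi> + Cd) / 2 * mpow vd n"
proof -
  define h where "h = inverse (hinv n)"
  define v where "v = mpow vd n"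
  have h: "h > 0" using hinv_pos[of n] by (simp add: h_def)
  have v: "v > 0" unfolding v_def by (rule mpow_pos[OF vd_pos])
  have hs: "((\<lambda>y. (1/2) * (v * (P y * (\<phi> y)\<^sup>2)) + (1/2) * (h\<^sup>2 / v * (P y * (Mx n y)\<^sup>2))) has_sum
     (1/2) * (v * \<Phi>) + (1/2) * (h\<^sup>2 / v * hinv n)) UNIV"
    by (intro has_sum_add has_sum_cmult_right assms second_moment)
  have le: "h * \<bar>P y * \<phi> y * Mx n y\<bar> \<le> (1/2) * (v * (P y * (\<phi> y)\<^sup>2)) + (1/2) * (h\<^sup>2 / v * (P y * (Mx n y)\<^sup>2))" for y
  proof -
    have "0 \<le> P y / v * (v * \<bar>\<phi> y\<bar> - h * \<bar>Mx n y\<bar>)\<^sup>2"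
      using v P_pos[of y] by simp
    also have "\<dots> = v * (P y * (\<phi> y)\<^sup>2) + h\<^sup>2 / v * (P y * (Mx n y)\<^sup>2) - 2 * (h * (P y * \<bar>\<phi> y\<bar> * \<bar>Mx n y\<bar>))"
      using v by (simp add: power2_diff power_mult_distrib field_simps) (simp add: power2_eq_square)
    finally have "2 * (h * (P y * \<bar>\<phi> y\<bar> * \<bar>Mx n y\<bar>)) \<le> v * (P y * (\<phi> y)\<^sup>2) + h\<^sup>2 / v * (P y * (Mx n y)\<^sup>2)"
      by linarith
    moreover have "h * \<bar>P y * \<phi> y * Mx n y\<bar> = h * (P y * \<bar>\<phi> y\<bar> * \<bar>Mx n y\<bar>)"
      using P_pos[of y] by (simp add: abs_mult)
    ultimately show ?thesis by argo
  qed
  have "(\<lambda>y. h * \<bar>P y * \<phi> y * Mx n y\<bar>) summable_on UNIV"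
    by (rule summable_on_comparison_test[OF has_sum_imp_summable[OF hs]]) (use le h in auto)
  then show s: "(\<lambda>y. \<bar>P y * \<phi> y * Mx n y\<bar>) summable_on UNIV"
    using h by (simp add: summable_on_cmult_right')
  have "h * infsum (\<lambda>y. \<bar>P y * \<phi> y * Mx n y\<bar>) UNIV \<le> (1/2) * (v * \<Phi>) + (1/2) * (h\<^sup>2 / v * hinv n)"
    by (rule has_sum_mono[OF has_sum_cmult_right[OF has_sum_infsum[OF s]] hs]) (rule le)
  also have "h\<^sup>2 / v * hinv n = h / v"
    using hinv_pos[of n] by (simp add: h_def power2_eq_square)
  also have "h / v \<le> Cd * v"
  proof -
    have "h / v \<le> Cd * v\<^sup>2 / v"
      using hinv_decay[of n] v by (intro divide_right_mono) (auto simp: h_def v_def)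
    then show ?thesis using v by (simp add: power2_eq_square)
  qed
  finally show "inverse (hinv n) * infsum (\<lambda>y. \<bar>P y * \<phi> y * Mx n y\<bar>) UNIV \<le> (\<Phi> + Cd) / 2 * mpow vd n"
    by (simp add: h_def v_def algebra_simps)
qed

section \<open>The kernel: the density of the joint weights with respect to the product of the
  marginals\<close>

definition kap :: "(('a \<Rightarrow> nat) \<Rightarrow> real) \<Rightarrow> ('a \<Rightarrow> nat) \<Rightarrow> ('a \<Rightarrow> nat) \<Rightarrow> real" where
  "kap \<rho> x y = infsum (\<lambda>n. \<rho> n * inverse (hinv n) * Mx n x * Mx n y) UNIV"

lemma kap_sym: "kap \<rho> x y = kap \<rho> y x"
  unfolding kap_def by (rule infsum_cong) simp

lemma summable_hMM: "(\<lambda>n. \<bar>inverse (hinv n) * Mx n x * Mx n y\<bar>) summable_on UNIV"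
proof -
  define G where "G = infsum (\<lambda>n. \<bar>Mx n x\<bar> * mpow vd n) UNIV"
  have vn: "mpow vd n > 0" for n by (rule mpow_pos[OF vd_pos])
  have G: "\<bar>Mx n x\<bar> * mpow vd n \<le> G" for n
    unfolding G_def using vn by (intro term_le_infsum summable_Mx_vd) (auto simp: less_imp_le)
  have "\<bar>\<bar>inverse (hinv n) * Mx n x * Mx n y\<bar>\<bar> \<le> Cd * G * (\<bar>Mx n y\<bar> * mpow vd n)" for n
  proof -
    have "\<bar>\<bar>inverse (hinv n) * Mx n x * Mx n y\<bar>\<bar> = inverse (hinv n) * (\<bar>Mx n x\<bar> * \<bar>Mx n y\<bar>)"
      using hinv_pos[of n] by (simp add: abs_mult)
    also have "\<dots> \<le> Cd * (mpow vd n)\<^sup>2 * (\<bar>Mx n x\<bar> * \<bar>Mx n y\<bar>)"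
      by (intro mult_right_mono hinv_decay) auto
    also have "\<dots> = Cd * (\<bar>Mx n x\<bar> * mpow vd n) * (\<bar>Mx n y\<bar> * mpow vd n)"
      by (simp add: power2_eq_square)
    also have "\<dots> \<le> Cd * G * (\<bar>Mx n y\<bar> * mpow vd n)"
      using Cd_pos vn[of n] by (intro mult_right_mono mult_left_mono G) auto
    finally show ?thesis .
  qed
  then show ?thesis
    by (intro summable_on_real_comparison[OF summable_on_cmult_right[OF summable_Mx_vd[of y]]]) auto
qed

lemma summable_kap:
  assumes "\<And>n. \<bar>\<rho> n\<bar> \<le> 1"
  shows "(\<lambda>n. \<rho> n * inverse (hinv n) * Mx n x * Mx n y) summable_on UNIV"
proof (rule summable_on_real_comparison[OF summable_hMM[of x y]])
  fix n
  show "\<bar>\<rho> n * inverse (hinv n) * Mx n x * Mx n y\<bar> \<le> \<bar>inverse (hinv n) * Mx n x * Mx n y\<bar>"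
    using mult_right_mono[OF assms[of n], of "\<bar>inverse (hinv n) * Mx n x * Mx n y\<bar>"]
    by (simp add: abs_mult mult.assoc)
qed

lemma lancaster_eq_kap:
  assumes s: "lancaster_term \<theta> u a z \<rho> \<alpha> x y summable_on {n. total n \<ge> 1}" and r0: "\<rho> (\<lambda>_. 0) = 1"
  shows "lancaster \<theta> p u a z \<rho> \<alpha> x y = P x * P y * kap \<rho> x y"
proof -
  define f where "f n = \<rho> n * inverse (hinv n) * Mx n x * Mx n y" for n
  have lt: "lancaster_term \<theta> u a z \<rho> \<alpha> x y = f"
    unfolding f_def lancaster_term_def meixner_h_eq by auto
  have U: "UNIV = insert (\<lambda>_. 0) {n :: 'a \<Rightarrow> nat. total n \<ge> 1}"
  proof -
    have "total n \<ge> 1 \<or> n = (\<lambda>_. 0)" for n :: "'a \<Rightarrow> nat"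
      using total_eq_0_iff[of n] by linarith
    then show ?thesis by auto
  qed
  have "infsum f UNIV = f (\<lambda>_. 0) + infsum f {n. total n \<ge> 1}"
    by (subst U, rule infsum_insert) (use s in \<open>auto simp: lt\<close>)
  moreover have "f (\<lambda>_. 0) = 1" using r0 by (simp add: f_def Mx_zero)
  moreover have "kap \<rho> x y = infsum f UNIV" by (simp add: kap_def f_def[abs_def])
  ultimately show ?thesis unfolding lancaster_def lt by simp
qed

lemma lancaster_term_summable:
  assumes "\<And>n. \<bar>\<rho> n\<bar> \<le> 1"
  shows "lancaster_term \<theta> u a z \<rho> \<alpha> x y summable_on A"
  unfolding lancaster_term_def meixner_h_eq
  by (rule summable_on_subset_banach[OF summable_kap[OF assms]]) auto

lemma lancaster_nonneg_iff:
  assumes "\<And>n. \<bar>\<rho> n\<bar> \<le> 1" "\<rho> (\<lambda>_. 0) = 1"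
  shows "lancaster_nonneg \<theta> p u a z \<rho> \<alpha> \<longleftrightarrow> (\<forall>x y. kap \<rho> x y \<ge> 0)"
  unfolding lancaster_nonneg_def
proof -
  have "0 \<le> lancaster \<theta> p u a z \<rho> \<alpha> x y \<longleftrightarrow> kap \<rho> x y \<ge> 0" for x y
  proof -
    have "P x * P y > 0" using P_pos by simp
    moreover have "lancaster \<theta> p u a z \<rho> \<alpha> x y = P x * P y * kap \<rho> x y"
      by (intro lancaster_eq_kap lancaster_term_summable assms)
    ultimately show ?thesis by (metis mult_nonneg_nonneg less_imp_le not_le mult_pos_neg)
  qed
  then show "(\<forall>x y. lancaster_term \<theta> u a z \<rho> \<alpha> x y summable_on {n. 1 \<le> total n} \<and> 0 \<le> lancaster \<theta> p u a z \<rho> \<alpha> x y) =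
    (\<forall>x y. 0 \<le> kap \<rho> x y)"
    using lancaster_term_summable[of \<rho>] assms(1) by blast
qed

text \<open>The conditional expectation of \<open>\<phi>\<close> is computed term by term,
  \<open>c n\<close> being the coefficient of \<open>\<phi>\<close> against \<open>Mx n\<close>. The
  finite second moment of \<open>\<phi>\<close> justifies the exchange through
  \<open>mixed_moment_bound\<close>.\<close>

lemma kap_moment:
  assumes "\<And>n. \<bar>\<rho> n\<bar> \<le> 1"
    and phi: "((\<lambda>y. P y * (\<phi> y)\<^sup>2) has_sum \<Phi>) UNIV"
    and c: "\<And>n. ((\<lambda>y. P y * \<phi> y * Mx n y) has_sum c n) UNIV"
    and S: "((\<lambda>n. \<rho> n * inverse (hinv n) * Mx n x * c n) has_sum S) UNIV"
  shows "((\<lambda>y. P y * \<phi> y * kap \<rho> x y) has_sum S) UNIV"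
proof (rule has_sum_exchange)
  define f where "f n y = \<rho> n * inverse (hinv n) * Mx n x * (P y * \<phi> y * Mx n y)" for n y
  show "((\<lambda>y. f n y) has_sum \<rho> n * inverse (hinv n) * Mx n x * c n) UNIV" for n
    unfolding f_def by (intro has_sum_cmult_right c)
  show "((\<lambda>n. f n y) has_sum P y * \<phi> y * kap \<rho> x y) UNIV" for y
    using has_sum_cmult_right[OF has_sum_infsum[OF summable_kap[of \<rho> x y]], of "P y * \<phi> y"] assms(1)
    by (simp add: f_def kap_def mult_ac)
  have eq: "(\<lambda>y. \<bar>f n y\<bar>) = (\<lambda>y. \<bar>\<rho> n * inverse (hinv n) * Mx n x\<bar> * \<bar>P y * \<phi> y * Mx n y\<bar>)" for n
    by (simp add: f_def abs_mult)
  note mb = mixed_moment_bound[OF phi]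
  show "(\<lambda>(n, y). f n y) summable_on UNIV \<times> UNIV"
  proof (rule summable_on_pairs)
    show "(\<lambda>y. \<bar>f n y\<bar>) summable_on UNIV" for n
      unfolding eq by (intro summable_on_cmult_right mb)
    show "(\<lambda>n. (\<Phi> + Cd) / 2 * (\<bar>Mx n x\<bar> * mpow vd n)) summable_on UNIV"
      by (intro summable_on_cmult_right summable_Mx_vd)
    fix n
    define I where "I = infsum (\<lambda>y. \<bar>P y * \<phi> y * Mx n y\<bar>) UNIV"
    have I: "I \<ge> 0" unfolding I_def by (rule infsum_nonneg) simp
    have "infsum (\<lambda>y. \<bar>f n y\<bar>) UNIV = \<bar>\<rho> n\<bar> * \<bar>Mx n x\<bar> * (inverse (hinv n) * I)"
      unfolding eq infsum_cmult_right' I_def[symmetric] using hinv_pos[of n] by (simp add: abs_mult)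
    also have "\<dots> \<le> 1 * \<bar>Mx n x\<bar> * (inverse (hinv n) * I)"
      using assms(1)[of n] I hinv_pos[of n] by (intro mult_right_mono) auto
    also have "\<dots> \<le> 1 * \<bar>Mx n x\<bar> * ((\<Phi> + Cd) / 2 * mpow vd n)"
      unfolding I_def by (intro mult_left_mono mb) auto
    finally show "infsum (\<lambda>y. \<bar>f n y\<bar>) UNIV \<le> (\<Phi> + Cd) / 2 * (\<bar>Mx n x\<bar> * mpow vd n)"
      by (simp add: mult_ac)
  qed
qed (rule S)

text \<open>The Meixner polynomials are the eigenfunctions of the conditional expectation, with
  eigenvalues \<open>\<rho> m\<close>.\<close>

lemma kap_Mx_moment:
  assumes "\<And>n. \<bar>\<rho> n\<bar> \<le> 1"
  shows "((\<lambda>y. P y * Mx m y * kap \<rho> x y) has_sum \<rho> m * Mx m x) UNIV"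
proof (rule kap_moment[OF assms second_moment])
  show "((\<lambda>y. P y * Mx m y * Mx n y) has_sum (if n = m then hinv m else 0)) UNIV" for n
    by (rule orthogonality)
  show "((\<lambda>n. \<rho> n * inverse (hinv n) * Mx n x * (if n = m then hinv m else 0)) has_sum \<rho> m * Mx m x) UNIV"
    by (rule has_sum_finite_neutralI[of "{m}"]) (use hinv_pos[of m] in auto)
qed

lemma kap_marginal:
  assumes "\<And>n. \<bar>\<rho> n\<bar> \<le> 1" "\<rho> (\<lambda>_. 0) = 1"
  shows "((\<lambda>y. P y * kap \<rho> x y) has_sum 1) UNIV"
  using kap_Mx_moment[of \<rho> "\<lambda>_. 0" x] assms by (simp add: Mx_zero)

text \<open>Non-negative joint weights form a measure whose marginals are \<open>P\<close>, so the
  product of two polynomials is dominated by the sum of their squares. The double sum may then be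
  evaluated with \<open>y\<close> first, by \<open>kap_Mx_moment\<close>.\<close>

lemma correlations_of_nonneg:
  assumes r: "\<And>n. \<bar>\<rho> n\<bar> \<le> 1" and r0: "\<rho> (\<lambda>_. 0) = 1" and nn: "\<And>x y. kap \<rho> x y \<ge> 0"
  shows "lancaster_correlations \<theta> p u a z \<rho> \<alpha>"
proof -
  have L: "lancaster \<theta> p u a z \<rho> \<alpha> x y = P x * P y * kap \<rho> x y" for x y
    by (intro lancaster_eq_kap lancaster_term_summable r r0)
  define l where "l x y = P x * P y * kap \<rho> x y" for x y
  have l0: "l x y \<ge> 0" for x y using P_pos[of x] P_pos[of y] nn[of x y] by (simp add: l_def)
  have s1: "(\<lambda>(x, y). l x y * (Mx m x)\<^sup>2) summable_on UNIV \<times> UNIV" for m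
  proof (rule summable_on_pairs)
    have *: "((\<lambda>y. \<bar>l x y * (Mx m x)\<^sup>2\<bar>) has_sum P x * (Mx m x)\<^sup>2) UNIV" for x
      using has_sum_cmult_right[OF kap_marginal[where \<rho> = \<rho> and x = x, OF r r0], of "P x * (Mx m x)\<^sup>2"] l0
      by (simp add: abs_mult) (simp add: l_def mult_ac)
    show "(\<lambda>y. \<bar>l x y * (Mx m x)\<^sup>2\<bar>) summable_on UNIV"
      and "infsum (\<lambda>y. \<bar>l x y * (Mx m x)\<^sup>2\<bar>) UNIV \<le> P x * (Mx m x)\<^sup>2" for x
      using *[of x] by (auto simp: has_sum_iff)
    show "(\<lambda>x. P x * (Mx m x)\<^sup>2) summable_on UNIV"
      using second_moment by (rule has_sum_imp_summable)
  qed
  have s2: "(\<lambda>(x, y). l x y * (Mx n y)\<^sup>2) summable_on UNIV \<times> UNIV" for n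
    using s1[of n] by (subst summable_on_swap) (simp add: l_def kap_sym[of _ y x for x y] mult_ac case_prod_unfold)
  have "((\<lambda>(x, y). lancaster \<theta> p u a z \<rho> \<alpha> x y * (Mx m x * Mx n y))
        has_sum (if m = n then \<rho> n * inverse (meixner_h \<alpha> \<theta> a z n) else 0)) (UNIV \<times> UNIV)" for m n
  proof (rule has_sum_SigmaI)
    show "((\<lambda>y. case (x, y) of (x, y) \<Rightarrow> lancaster \<theta> p u a z \<rho> \<alpha> x y * (Mx m x * Mx n y)) has_sum
        \<rho> n * (P x * Mx n x * Mx m x)) UNIV" for x
      using has_sum_cmult_right[OF kap_Mx_moment[where \<rho> = \<rho> and x = x and m = n, OF r], of "P x * Mx m x"]
      by (simp add: L mult_ac)
    show "((\<lambda>x. \<rho> n * (P x * Mx n x * Mx m x)) has_sum (if m = n then \<rho> n * inverse (meixner_h \<alpha> \<theta> a z n) else 0)) UNIV"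
      using has_sum_cmult_right[OF orthogonality[of n m], of "\<rho> n"] by (auto simp: meixner_h_eq split: if_splits)
    show "(\<lambda>(x, y). lancaster \<theta> p u a z \<rho> \<alpha> x y * (Mx m x * Mx n y)) summable_on UNIV \<times> UNIV"
    proof (rule summable_on_real_comparison[OF summable_on_add[OF s1[of m] s2[of n]]], clarify)
      fix x y
      have "\<bar>l x y * (Mx m x * Mx n y)\<bar> = l x y * \<bar>Mx m x * Mx n y\<bar>"
        using l0[of x y] by (simp add: abs_mult)
      also have "\<bar>Mx m x * Mx n y\<bar> \<le> (Mx m x)\<^sup>2 + (Mx n y)\<^sup>2"
      proof -
        have "2 * (\<bar>Mx m x\<bar> * \<bar>Mx n y\<bar>) \<le> (Mx m x)\<^sup>2 + (Mx n y)\<^sup>2"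
          using sum_squares_bound[of "\<bar>Mx m x\<bar>" "\<bar>Mx n y\<bar>"] by (simp add: mult.assoc)
        moreover have "0 \<le> \<bar>Mx m x\<bar> * \<bar>Mx n y\<bar>" by simp
        ultimately show ?thesis unfolding abs_mult by linarith
      qed
      then have "l x y * \<bar>Mx m x * Mx n y\<bar> \<le> l x y * ((Mx m x)\<^sup>2 + (Mx n y)\<^sup>2)"
        using l0 by (rule mult_left_mono)
      finally show "\<bar>lancaster \<theta> p u a z \<rho> \<alpha> x y * (Mx m x * Mx n y)\<bar> \<le> l x y * (Mx m x)\<^sup>2 + l x y * (Mx n y)\<^sup>2"
        by (simp only: L l_def[symmetric] distrib_left)
    qed
  qed
  then show ?thesis unfolding lancaster_correlations_def by (simp add: UNIV_Times_UNIV)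
qed

end

section \<open>The kernel of a fixed point of the simplex\<close>

context meixner_basis
begin

definition mass :: "real^'d \<Rightarrow> real" where "mass \<xi> = (\<Sum>i\<in>UNIV. \<xi> $ i)"

text \<open>The sum in \<open>p_pair\<close> taken at \<open>\<xi>\<close> itself instead of
  \<open>\<xi>\<close> divided by its mass, so that it makes sense for mass 0.\<close>

definition hyp_avg :: "real^'d \<Rightarrow> 'd \<Rightarrow> 'd \<Rightarrow> real" where
  "hyp_avg \<xi> i k = (\<Sum>l\<in>UNIV. (\<xi> $ l) * hypergroup_s u a i k l)"

definition beta :: "real^'d \<Rightarrow> real" where
  "beta \<xi> = \<theta> * (1 - mass \<xi>) / (1 + \<theta> * (1 - mass \<xi>))"

lemma rho_lin_z: "rho_lin u z \<xi> = mass \<xi>"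
  by (simp add: rho_lin_def mass_def)

lemma mass_bounds: "\<xi> \<in> unit_simplex \<Longrightarrow> 0 \<le> mass \<xi>" "\<xi> \<in> unit_simplex \<Longrightarrow> mass \<xi> \<le> 1"
  by (auto simp: unit_simplex_def mass_def sum_nonneg)

lemma abs_rho_lin_le:
  assumes "\<xi> \<in> unit_simplex"
  shows "\<bar>rho_lin u j \<xi>\<bar> \<le> 1"
proof -
  have "\<bar>rho_lin u j \<xi>\<bar> \<le> (\<Sum>i\<in>UNIV. \<bar>(u j $ i) * (\<xi> $ i)\<bar>)"
    unfolding rho_lin_def by (rule sum_abs)
  also have "\<dots> \<le> (\<Sum>i\<in>UNIV. 1 * (\<xi> $ i))"
  proof (rule sum_mono)
    fix i
    have "\<xi> $ i \<ge> 0" using assms by (simp add: unit_simplex_def)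
    then show "\<bar>(u j $ i) * (\<xi> $ i)\<bar> \<le> 1 * (\<xi> $ i)"
      using mult_right_mono[OF abs_u_le_1[of j i]] by (simp add: abs_mult)
  qed
  also have "\<dots> \<le> 1" using assms by (simp add: unit_simplex_def)
  finally show ?thesis .
qed

lemma abs_mpow_rho_le:
  assumes "\<xi> \<in> unit_simplex"
  shows "\<bar>mpow (\<lambda>j. rho_lin u j \<xi>) n\<bar> \<le> 1"
  unfolding abs_mpow by (rule mpow_le_one) (auto intro: abs_rho_lin_le[OF assms])

lemma hyp_avg_eq: "hyp_avg \<xi> i k = (\<Sum>r\<in>UNIV. rho_lin u r \<xi> * inverse (a r) * (u r $ i) * (u r $ k))"
  unfolding hyp_avg_def hypergroup_s_def rho_lin_def sum_distrib_left sum_distrib_right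
  by (subst sum.swap) (simp add: mult_ac)

lemma a_z [simp]: "a z = 1"
  using u_orth[of z z] sum_p by simp

lemma one_plus_pos: "\<xi> \<in> unit_simplex \<Longrightarrow> 1 + \<theta> * (1 - mass \<xi>) > 0"
  using mass_bounds(2)[of \<xi>] theta_pos by (intro add_pos_nonneg mult_nonneg_nonneg) auto

lemma beta_bounds: "\<xi> \<in> unit_simplex \<Longrightarrow> 0 \<le> beta \<xi>" "\<xi> \<in> unit_simplex \<Longrightarrow> beta \<xi> < 1"
  using one_plus_pos[of \<xi>] mass_bounds(2)[of \<xi>] theta_pos by (auto simp: beta_def)

text \<open>The factor \<open>p $ i * p $ k\<close> is cancelled and the mass multiplied out. For
  mass 0 the left side is vacuous and the right side is non-negativity of \<open>hyp_avg\<close>, so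
  one inequality covers both cases.\<close>

lemma pair_condition_iff:
  assumes "\<xi> \<in> unit_simplex"
  shows "pair_condition \<theta> p u a \<xi> \<longleftrightarrow> (\<forall>i k. mass \<xi> * beta \<xi> \<le> hyp_avg \<xi> i k)"
proof (cases "mass \<xi> = 0")
  case True
  have "hyp_avg \<xi> i k \<ge> 0" for i k
    unfolding hyp_avg_def using assms hypergroup by (auto simp: unit_simplex_def intro!: sum_nonneg)
  then show ?thesis using True by (simp add: pair_condition_def mass_def[symmetric])
next
  case False
  then have s: "mass \<xi> > 0" using mass_bounds(1)[OF assms] by simp
  have pp: "p_pair p u a (\<xi> /\<^sub>R mass \<xi>) i k = p $ i * p $ k * (hyp_avg \<xi> i k / mass \<xi>)" for i k
    by (simp add: p_pair_def hyp_avg_def divide_inverse sum_distrib_left mult_ac)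
  have "p_pair p u a (\<xi> /\<^sub>R mass \<xi>) i k \<ge> beta \<xi> * (p $ i) * (p $ k) \<longleftrightarrow> mass \<xi> * beta \<xi> \<le> hyp_avg \<xi> i k" for i k
  proof -
    have "p $ i * p $ k > 0" using p_pos by simp
    then have "beta \<xi> * (p $ i) * (p $ k) \<le> p $ i * p $ k * (hyp_avg \<xi> i k / mass \<xi>) \<longleftrightarrow> beta \<xi> \<le> hyp_avg \<xi> i k / mass \<xi>"
      using mult_le_cancel_left_pos[of "p $ i * p $ k" "beta \<xi>" "hyp_avg \<xi> i k / mass \<xi>"] by (simp only: mult_ac)
    also have "\<dots> \<longleftrightarrow> mass \<xi> * beta \<xi> \<le> hyp_avg \<xi> i k"
      using s by (simp add: pos_le_divide_eq mult.commute)
    finally show ?thesis unfolding pp .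
  qed
  then show ?thesis
    using False unfolding pair_condition_def Let_def mass_def[symmetric] beta_def by simp
qed

end

context meixner_system
begin

text \<open>Given \<open>X = x\<close>, the vector \<open>Y\<close> is distributed as a negative binomial vector plus an independent
  vector with generating function \<open>branch \<xi> i\<close> for each of the \<open>x\<^sub>i\<close> individuals of type \<open>i\<close>.\<close>

definition branch :: "real^'a \<Rightarrow> 'a \<Rightarrow> ('a \<Rightarrow> real) \<Rightarrow> real" where
  "branch \<xi> i t = (1 - mass \<xi>) * (1 + \<theta>) / (1 + \<theta> * (1 - mass \<xi>)) +
     (\<Sum>k\<in>UNIV. p $ k * (hyp_avg \<xi> i k - mass \<xi> * beta \<xi>) * t k) * (1 - (\<Sum>k\<in>UNIV. beta \<xi> * p $ k * t k)) powr (-1)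
       / (1 + \<theta> * (1 - mass \<xi>))"

definition cond_pgf :: "real^'a \<Rightarrow> ('a \<Rightarrow> nat) \<Rightarrow> ('a \<Rightarrow> real) \<Rightarrow> real" where
  "cond_pgf \<xi> x t = (1 + \<theta> * (1 - mass \<xi>)) powr (-\<alpha>) * (1 - (\<Sum>k\<in>UNIV. beta \<xi> * p $ k * t k)) powr (-\<alpha>) * mpow (\<lambda>i. branch \<xi> i t) x"

lemma beta_series_pos:
  assumes "\<xi> \<in> unit_simplex" "\<And>i. \<bar>t i\<bar> < 1"
  shows "1 - (\<Sum>k\<in>UNIV. beta \<xi> * p $ k * t k) > 0" "\<bar>tr z t\<bar> < 1"
proof -
  have "\<bar>tr z t\<bar> \<le> (\<Sum>k\<in>UNIV. p $ k * \<bar>t k\<bar>)"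
    unfolding tr_z by (rule order_trans[OF sum_abs]) (use p_pos in \<open>simp add: abs_mult less_imp_le\<close>)
  also have "\<dots> < (\<Sum>k\<in>UNIV. p $ k * 1)"
    using assms(2) p_pos by (intro sum_strict_mono mult_strict_left_mono) auto
  finally show *: "\<bar>tr z t\<bar> < 1" by (simp add: sum_p)
  have "(\<Sum>k\<in>UNIV. beta \<xi> * p $ k * t k) = beta \<xi> * tr z t"
    by (simp add: tr_z sum_distrib_left mult_ac)
  also have "\<dots> \<le> beta \<xi> * \<bar>tr z t\<bar>"
    using beta_bounds[OF assms(1)] by (intro mult_left_mono) auto
  also have "\<dots> \<le> beta \<xi> * 1"
    using beta_bounds[OF assms(1)] * by (intro mult_left_mono) auto
  finally show "1 - (\<Sum>k\<in>UNIV. beta \<xi> * p $ k * t k) > 0"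
    using beta_bounds[OF assms(1)] by simp
qed

text \<open>Summing over the basis labels turns the products of \<open>rho_lin u j \<xi>\<close>,
  \<open>inverse (a j)\<close> and two basis values into \<open>hyp_avg\<close>, by
  \<open>hyp_avg_eq\<close>. This is how the hypergroup function enters the conditional law.\<close>

lemma A_lin_W:
  assumes A: "A_fn t \<noteq> 0"
  shows "A_fn t * lin (\<lambda>j. rho_lin u j \<xi> * W_fn t j) i =
    (1 - mass \<xi>) * (1 + \<theta>) + (\<Sum>k\<in>UNIV. p $ k * (hyp_avg \<xi> i k - \<theta> * (1 - mass \<xi>)) * t k)"
proof -
  have "A_fn t * lin (\<lambda>j. rho_lin u j \<xi> * W_fn t j) i =
     A_fn t + (\<Sum>j\<in>UNIV. lam i j * (rho_lin u j \<xi> * (A_fn t * W_fn t j)))"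
    by (simp add: lin_def distrib_left sum_distrib_left mult_ac)
  also have "(\<Sum>j\<in>UNIV. lam i j * (rho_lin u j \<xi> * (A_fn t * W_fn t j))) =
     - ((1 + \<theta>) * mass \<xi> * (1 - tr z t)) + (\<Sum>j\<in>UNIV - {z}. rho_lin u j \<xi> * inverse (a j) * (u j $ i) * tr j t)"
  proof -
    have "lam i z * (rho_lin u z \<xi> * (A_fn t * W_fn t z)) = - ((1 + \<theta>) * mass \<xi> * (1 - tr z t))"
      using A theta_pos by (simp add: lam_def W_fn_def rho_lin_z)
    moreover have "(\<Sum>j\<in>UNIV - {z}. lam i j * (rho_lin u j \<xi> * (A_fn t * W_fn t j))) =
        (\<Sum>j\<in>UNIV - {z}. rho_lin u j \<xi> * inverse (a j) * (u j $ i) * tr j t)"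
      by (rule sum.cong) (use A in \<open>auto simp: lam_def W_fn_def divide_inverse\<close>)
    ultimately show ?thesis by (simp add: sum.remove[of UNIV z])
  qed
  also have "(\<Sum>j\<in>UNIV - {z}. rho_lin u j \<xi> * inverse (a j) * (u j $ i) * tr j t) =
     (\<Sum>j\<in>UNIV. rho_lin u j \<xi> * inverse (a j) * (u j $ i) * tr j t) - mass \<xi> * tr z t"
    by (simp add: sum.remove[of UNIV z "\<lambda>j. rho_lin u j \<xi> * inverse (a j) * (u j $ i) * tr j t"] rho_lin_z)
  also have "(\<Sum>j\<in>UNIV. rho_lin u j \<xi> * inverse (a j) * (u j $ i) * tr j t) = (\<Sum>k\<in>UNIV. p $ k * hyp_avg \<xi> i k * t k)"
    unfolding tr_def hyp_avg_eq sum_distrib_left sum_distrib_right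
    by (subst sum.swap) (simp add: mult_ac)
  finally have "A_fn t * lin (\<lambda>j. rho_lin u j \<xi> * W_fn t j) i = A_fn t - (1 + \<theta>) * mass \<xi> * (1 - tr z t)
      + (\<Sum>k\<in>UNIV. p $ k * hyp_avg \<xi> i k * t k) - mass \<xi> * tr z t" by simp
  moreover have "(\<Sum>k\<in>UNIV. p $ k * (hyp_avg \<xi> i k - \<theta> * (1 - mass \<xi>)) * t k) =
      (\<Sum>k\<in>UNIV. p $ k * hyp_avg \<xi> i k * t k) - \<theta> * (1 - mass \<xi>) * tr z t"
    by (simp add: tr_z sum_distrib_left sum_subtractf[symmetric] algebra_simps)
  ultimately show ?thesis by (simp add: A_fn_def algebra_simps)
qed

lemma lin_W_quotient:
  assumes xi: "\<xi> \<in> unit_simplex" and t: "\<And>i. \<bar>t i\<bar> < 1"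
  shows "A_fn t > 0" and "rho_lin u z \<xi> * W_fn t z < 1" "\<bar>rho_lin u z \<xi> * W_fn t z\<bar> < 1"
    and "A_fn t * (1 - rho_lin u z \<xi> * W_fn t z) = (1 + \<theta> * (1 - mass \<xi>)) * (1 - (\<Sum>k\<in>UNIV. beta \<xi> * p $ k * t k))"
    and "lin (\<lambda>j. rho_lin u j \<xi> * W_fn t j) i / (1 - rho_lin u z \<xi> * W_fn t z) = branch \<xi> i t"
proof -
  define T where "T = tr z t"
  define s where "s = mass \<xi>"
  define b where "b = beta \<xi>"
  define r where "r = 1 + \<theta> * (1 - s)"
  have T: "\<bar>T\<bar> < 1" using beta_series_pos(2)[OF xi, of t] t by (simp add: T_def)
  have s: "0 \<le> s" "s \<le> 1" using mass_bounds[OF xi] by (auto simp: s_def)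
  have r: "r > 0" using one_plus_pos[OF xi] by (simp add: r_def s_def)
  have b: "r * b = \<theta> * (1 - s)" using r by (simp add: b_def beta_def r_def s_def)
  have bT: "(\<Sum>k\<in>UNIV. beta \<xi> * p $ k * t k) = b * T"
    by (simp add: T_def b_def tr_z sum_distrib_left mult_ac)
  have bT1: "1 - b * T > 0" using beta_series_pos(1)[OF xi, of t] t by (simp add: bT)
  have thT: "\<theta> * (1 - T) > 0" using theta_pos T by simp
  show A: "A_fn t > 0" using thT by (simp add: A_fn_def T_def)
  have AW: "A_fn t * W_fn t z = \<theta> * (1 - T)" using A by (simp add: W_fn_def T_def)
  have W: "0 \<le> W_fn t z" "W_fn t z < 1"
    using thT A by (auto simp: W_fn_def A_fn_def T_def)
  have sW: "s * W_fn t z \<le> W_fn t z"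
    using mult_right_mono[OF s(2) W(1)] by simp
  have sW0: "s * W_fn t z \<ge> 0" using s W by simp
  show w1: "rho_lin u z \<xi> * W_fn t z < 1" "\<bar>rho_lin u z \<xi> * W_fn t z\<bar> < 1"
    using sW sW0 W by (auto simp: rho_lin_z s_def)
  have "A_fn t * (1 - s * W_fn t z) = A_fn t - s * (A_fn t * W_fn t z)" by (simp add: algebra_simps)
  also have "\<dots> = 1 + \<theta> * (1 - s) * (1 - T)" unfolding AW by (simp add: A_fn_def T_def algebra_simps)
  also have "\<dots> = r - (r * b) * T" unfolding b by (simp add: r_def algebra_simps)
  finally have R: "A_fn t * (1 - s * W_fn t z) = r * (1 - b * T)" by (simp add: algebra_simps)
  then show "A_fn t * (1 - rho_lin u z \<xi> * W_fn t z) = (1 + \<theta> * (1 - mass \<xi>)) * (1 - (\<Sum>k\<in>UNIV. beta \<xi> * p $ k * t k))"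
    by (simp add: rho_lin_z s_def bT r_def)
  define H where "H = (\<Sum>k\<in>UNIV. p $ k * hyp_avg \<xi> i k * t k)"
  have sums: "(\<Sum>k\<in>UNIV. p $ k * (hyp_avg \<xi> i k - c) * t k) = H - c * T" for c
    by (simp add: H_def T_def tr_z sum_distrib_left sum_subtractf[symmetric] algebra_simps)
  have "lin (\<lambda>j. rho_lin u j \<xi> * W_fn t j) i / (1 - rho_lin u z \<xi> * W_fn t z) =
      (A_fn t * lin (\<lambda>j. rho_lin u j \<xi> * W_fn t j) i) / (A_fn t * (1 - s * W_fn t z))"
    using A by (simp add: rho_lin_z s_def)
  also have "\<dots> = ((1 - s) * (1 + \<theta>) + (H - \<theta> * (1 - s) * T)) / (r * (1 - b * T))"
    using A_lin_W[of t \<xi> i] A R by (simp add: sums s_def)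
  \<comment> \<open>A multiple of the denominator \<open>1 - b * T\<close> is split off; it becomes
    the constant term of \<open>branch\<close>, and what remains is the linear form with
    coefficients \<open>hyp_avg \<xi> i k - s * b\<close>.\<close>
  also have "(1 - s) * (1 + \<theta>) + (H - \<theta> * (1 - s) * T) = (1 - s) * (1 + \<theta>) * (1 - b * T) + (H - s * b * T)"
  proof -
    have "(1 - s) * (1 + \<theta>) * b + s * b = r * b" by (simp add: r_def algebra_simps)
    then have "((1 - s) * (1 + \<theta>) * b + s * b) * T = \<theta> * (1 - s) * T" using b by simp
    then show ?thesis by (simp add: algebra_simps)
  qed
  also have "\<dots> / (r * (1 - b * T)) = (1 - s) * (1 + \<theta>) / r + (H - s * b * T) * (1 - b * T) powr (-1) / r"
  proof -
    have "(x * X + y) / (r * X) = x / r + y * X powr (-1) / r" if "X > 0" for x y X :: real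
      using r that by (simp add: powr_minus field_simps)
    from this[OF bT1] show ?thesis by simp
  qed
  finally show "lin (\<lambda>j. rho_lin u j \<xi> * W_fn t j) i / (1 - rho_lin u z \<xi> * W_fn t z) = branch \<xi> i t"
    unfolding branch_def bT sums s_def[symmetric] r_def[symmetric] unfolding b_def[symmetric] .
qed

lemma kap_pgf:
  assumes xi: "\<xi> \<in> unit_simplex" and t: "\<And>i. \<bar>t i\<bar> < 1"
  shows "((\<lambda>y. P y * kap (mpow (\<lambda>j. rho_lin u j \<xi>)) x y * mpow t y) has_sum cond_pgf \<xi> x t) UNIV"
proof -
  define w where "w j = rho_lin u j \<xi> * W_fn t j" for j
  note q = lin_W_quotient[where t = t, OF xi t]
  have pt: "\<theta> * (\<Sum>i\<in>UNIV. p $ i * \<bar>t i\<bar>) < 1 + \<theta>"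
  proof -
    have "(\<Sum>i\<in>UNIV. p $ i * \<bar>t i\<bar>) \<le> (\<Sum>i\<in>UNIV. p $ i * 1)"
      using t p_pos by (intro sum_mono mult_left_mono) (auto simp: less_imp_le)
    then have "\<theta> * (\<Sum>i\<in>UNIV. p $ i * \<bar>t i\<bar>) \<le> \<theta> * 1"
      using theta_pos by (intro mult_left_mono) (auto simp: sum_p)
    then show ?thesis by simp
  qed
  have "(\<lambda>y. P y * (mpow t y)\<^sup>2) summable_on UNIV"
  proof (rule summable_on_real_comparison[OF has_sum_imp_summable[OF has_sum_P]])
    fix y
    have "\<bar>mpow t y\<bar> \<le> 1" unfolding abs_mpow by (rule mpow_le_one) (auto intro: less_imp_le t)
    then have "(mpow t y)\<^sup>2 \<le> 1" by (simp add: abs_square_le_1)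
    then show "\<bar>P y * (mpow t y)\<^sup>2\<bar> \<le> P y"
      using P_pos[of y] by (simp add: abs_mult mult_left_le)
  qed
  then obtain \<Phi> where phi: "((\<lambda>y. P y * (mpow t y)\<^sup>2) has_sum \<Phi>) UNIV"
    unfolding summable_on_def by blast
  have c: "((\<lambda>y. P y * mpow t y * Mx n y) has_sum hinv n * A_fn t powr (-\<alpha>) * mpow (W_fn t) n) UNIV" for n
    using moment_gf[OF pt, of n] by (simp add: mult_ac)
  have wz: "\<bar>w z\<bar> < 1" "w z < 1" using q(2,3) by (auto simp: w_def)
  have "((\<lambda>n. A_fn t powr (-\<alpha>) * (Mx n x * mpow w n)) has_sum A_fn t powr (-\<alpha>) * gf x w) UNIV"
    by (intro has_sum_cmult_right has_sum_gf wz)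
  moreover have "A_fn t powr (-\<alpha>) * (Mx n x * mpow w n) = mpow (\<lambda>j. rho_lin u j \<xi>) n * inverse (hinv n) * Mx n x *
      (hinv n * A_fn t powr (-\<alpha>) * mpow (W_fn t) n)" for n
    using hinv_pos[of n] unfolding w_def mpow_mult by simp
  ultimately have S: "((\<lambda>n. mpow (\<lambda>j. rho_lin u j \<xi>) n * inverse (hinv n) * Mx n x *
      (hinv n * A_fn t powr (-\<alpha>) * mpow (W_fn t) n)) has_sum A_fn t powr (-\<alpha>) * gf x w) UNIV" by simp
  have "((\<lambda>y. P y * mpow t y * kap (mpow (\<lambda>j. rho_lin u j \<xi>)) x y) has_sum A_fn t powr (-\<alpha>) * gf x w) UNIV"
    by (rule kap_moment[OF abs_mpow_rho_le[OF xi] phi c S])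
  moreover have "A_fn t powr (-\<alpha>) * gf x w = cond_pgf \<xi> x t"
  proof -
    have "A_fn t powr (-\<alpha>) * gf x w = (A_fn t * (1 - w z)) powr (-\<alpha>) * mpow (\<lambda>i. lin w i / (1 - w z)) x"
      using q(1) wz by (simp add: gf_alt(1)[of w, OF wz(2)] powr_mult)
    also have "A_fn t * (1 - w z) = (1 + \<theta> * (1 - mass \<xi>)) * (1 - (\<Sum>k\<in>UNIV. beta \<xi> * p $ k * t k))"
      using q(4) by (simp add: w_def)
    also have "\<dots> powr (-\<alpha>) = (1 + \<theta> * (1 - mass \<xi>)) powr (-\<alpha>) * (1 - (\<Sum>k\<in>UNIV. beta \<xi> * p $ k * t k)) powr (-\<alpha>)"
      using one_plus_pos[OF xi] beta_series_pos(1)[OF xi, of t] t by (simp add: powr_mult)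
    also have "(\<lambda>i. lin w i / (1 - w z)) = (\<lambda>i. branch \<xi> i t)"
      using q(5) unfolding w_def by blast
    finally show ?thesis by (simp add: cond_pgf_def)
  qed
  ultimately show ?thesis by (simp add: mult_ac)
qed

text \<open>\<open>cond_pgf\<close> is built from factors with non-negative coefficients. The pair
  condition is used for the linear form in \<open>branch\<close>; the power \<open>-1\<close> there
  is the negative binomial series with exponent 1.\<close>

lemma kap_nonneg_of_condition:
  assumes xi: "\<xi> \<in> unit_simplex" and pc: "pair_condition \<theta> p u a \<xi>"
  shows "kap (mpow (\<lambda>j. rho_lin u j \<xi>)) x y \<ge> 0"
proof -
  note b = beta_bounds[OF xi] and o = one_plus_pos[OF xi] and m = mass_bounds[OF xi]
  have q: "beta \<xi> * p $ k \<ge> 0" for k using b p_pos[of k] by simp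
  have q1: "(\<Sum>k\<in>UNIV. beta \<xi> * p $ k) < 1"
    using b by (simp add: sum_p flip: sum_distrib_left)
  have nb: "nn_series (\<lambda>t. (1 - (\<Sum>k\<in>UNIV. beta \<xi> * p $ k * t k)) powr (-\<gamma>))" if "\<gamma> > 0" for \<gamma>
    by (rule nn_series_negbin[OF q q1 that])
  have "nn_series (\<lambda>t. branch \<xi> i t)" for i
  proof -
    have d: "p $ k * (hyp_avg \<xi> i k - mass \<xi> * beta \<xi>) \<ge> 0" for k
      using pc pair_condition_iff[OF xi] p_pos[of k] by simp
    have "nn_series (\<lambda>t. (1 - mass \<xi>) * (1 + \<theta>) / (1 + \<theta> * (1 - mass \<xi>)) +
     (\<Sum>k\<in>UNIV. p $ k * (hyp_avg \<xi> i k - mass \<xi> * beta \<xi>) * t k) * (1 - (\<Sum>k\<in>UNIV. beta \<xi> * p $ k * t k)) powr (-1)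
       * inverse (1 + \<theta> * (1 - mass \<xi>)))"
      using o m theta_pos
      by (intro nn_series_add nn_series_mult nn_series_sum nn_series_const nn_series_var nb d) auto
    then show ?thesis by (simp add: branch_def[abs_def] divide_inverse)
  qed
  then have "nn_series (cond_pgf \<xi> x)"
    unfolding cond_pgf_def[abs_def] mpow_def
    by (intro nn_series_mult nn_series_prod nn_series_power nn_series_const nb alpha_pos) auto
  then obtain c where c0: "\<And>n. c n \<ge> 0"
    and c: "\<And>t. (\<forall>i. \<bar>t i\<bar> < 1) \<Longrightarrow> ((\<lambda>n. c n * mpow t n) has_sum cond_pgf \<xi> x t) UNIV"
    unfolding nn_series_def by blast
  have "P y * kap (mpow (\<lambda>j. rho_lin u j \<xi>)) x y = c y"
    by (rule mpowser_unique[of 1 _ "cond_pgf \<xi> x"]) (auto intro!: kap_pgf[OF xi] c)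
  then show ?thesis using c0[of y] P_pos[of y] by (metis zero_le_mult_iff not_le)
qed

text \<open>A series with non-negative coefficients increases in each variable. The necessity proof
  uses non-negativity of the kernel through this inequality alone.\<close>

lemma cond_pgf_mono_of_nonneg:
  assumes xi: "\<xi> \<in> unit_simplex" and nn: "\<And>y. kap (mpow (\<lambda>j. rho_lin u j \<xi>)) x y \<ge> 0"
    and t: "\<And>i. 0 \<le> t i" "\<And>i. t i < 1"
  shows "cond_pgf \<xi> x (\<lambda>_. 0) \<le> cond_pgf \<xi> x t"
proof (rule has_sum_mono[OF kap_pgf[OF xi] kap_pgf[OF xi]])
  fix y
  show "P y * kap (mpow (\<lambda>j. rho_lin u j \<xi>)) x y * mpow (\<lambda>_. 0) y \<le> P y * kap (mpow (\<lambda>j. rho_lin u j \<xi>)) x y * mpow t y"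
    using P_pos[of y] nn[of y] t by (intro mult_left_mono mpow_mono) auto
qed (use t in auto)

text \<open>All coefficient sequences bounded by 1 share the majorant
  \<open>\<bar>c n\<bar>\<close>, so one finite set \<open>F\<close> approximates the kernels of all
  realisations and of the mixture equally well. Only finite sums are integrated, and the kernel
  itself never is.\<close>

lemma kap_mixture_nonneg:
  assumes M: "prob_space M" and X: "X \<in> borel_measurable M" "\<And>\<omega>. \<omega> \<in> space M \<Longrightarrow> X \<omega> \<in> unit_simplex"
    and r: "\<And>n. \<rho> n = (\<integral>\<omega>. mpow (\<lambda>j. rho_lin u j (X \<omega>)) n \<partial>M)"
    and nn: "AE \<omega> in M. kap (mpow (\<lambda>j. rho_lin u j (X \<omega>))) x y \<ge> 0"
  shows "\<bar>\<rho> n\<bar> \<le> 1" and "kap \<rho> x y \<ge> 0"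
proof -
  interpret prob_space M by fact
  define g where "g n \<omega> = mpow (\<lambda>j. rho_lin u j (X \<omega>)) n" for n \<omega>
  have gm: "g n \<in> borel_measurable M" for n
  proof -
    have "(\<lambda>\<omega>. X \<omega> $ i) \<in> borel_measurable M" for i
      by (rule measurable_compose[OF X(1)]) (intro borel_measurable_continuous_onI continuous_intros)
    then show ?thesis
      unfolding g_def mpow_def rho_lin_def
      by (intro borel_measurable_prod borel_measurable_power borel_measurable_sum borel_measurable_times) auto
  qed
  have gb: "\<bar>g n \<omega>\<bar> \<le> 1" if "\<omega> \<in> space M" for n \<omega>
    unfolding g_def by (rule abs_mpow_rho_le[OF X(2)[OF that]])
  have gi: "integrable M (g n)" for n
    by (rule integrable_const_bound[of _ 1]) (auto intro!: gb gm)
  have r1: "\<bar>\<rho> n\<bar> \<le> 1" for n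
  proof -
    have "\<bar>\<rho> n\<bar> \<le> (\<integral>\<omega>. \<bar>g n \<omega>\<bar> \<partial>M)" unfolding r g_def[symmetric] by (rule integral_abs_bound)
    also have "\<dots> \<le> (\<integral>\<omega>. 1 \<partial>M)" by (rule integral_mono) (auto intro!: integrable_abs gi gb)
    finally show ?thesis by (simp add: prob_space)
  qed
  then show "\<bar>\<rho> n\<bar> \<le> 1" .
  define c where "c n = inverse (hinv n) * Mx n x * Mx n y" for n
  have cs: "(\<lambda>n. \<bar>c n\<bar>) summable_on UNIV" unfolding c_def by (rule summable_hMM)
  have kr: "((\<lambda>n. \<rho>' n * c n) has_sum kap \<rho>' x y) UNIV" if "\<And>n. \<bar>\<rho>' n\<bar> \<le> 1" for \<rho>'
    using has_sum_infsum[OF summable_kap[of \<rho>' x y, OF that]] by (simp add: kap_def c_def mult.assoc)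
  show "kap \<rho> x y \<ge> 0"
  proof (rule field_le_epsilon)
    fix \<epsilon> :: real assume eps: "\<epsilon> > 0"
    define S where "S = infsum (\<lambda>n. \<bar>c n\<bar>) UNIV"
    have hs: "((\<lambda>n. \<bar>c n\<bar>) has_sum S) UNIV" unfolding S_def by (rule has_sum_infsum[OF cs])
    obtain F where F: "finite F" "\<bar>(\<Sum>n\<in>F. \<bar>c n\<bar>) - S\<bar> \<le> \<epsilon> / 2"
      using has_sum_finite_approximation[OF hs, of "\<epsilon> / 2"] eps by (auto simp: dist_real_def)
    have near: "\<bar>kap \<rho>' x y - (\<Sum>n\<in>F. \<rho>' n * c n)\<bar> \<le> \<epsilon> / 2" if "\<And>n. \<bar>\<rho>' n\<bar> \<le> 1" for \<rho>'
    proof (rule order_trans)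
      have "((\<lambda>n. \<rho>' n * c n) has_sum kap \<rho>' x y - (\<Sum>n\<in>F. \<rho>' n * c n)) (UNIV - F)"
        by (rule has_sum_Diff[OF kr[OF that] has_sum_finite[OF F(1)]]) auto
      moreover have "((\<lambda>n. \<bar>c n\<bar>) has_sum S - (\<Sum>n\<in>F. \<bar>c n\<bar>)) (UNIV - F)"
        by (rule has_sum_Diff[OF hs has_sum_finite[OF F(1)]]) auto
      ultimately show "\<bar>kap \<rho>' x y - (\<Sum>n\<in>F. \<rho>' n * c n)\<bar> \<le> S - (\<Sum>n\<in>F. \<bar>c n\<bar>)"
        by (rule has_sum_abs_le) (use that in \<open>auto simp: abs_mult intro: mult_left_le_one_le\<close>)
      show "S - (\<Sum>n\<in>F. \<bar>c n\<bar>) \<le> \<epsilon> / 2" using F(2) by linarith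
    qed
    have "- (\<epsilon> / 2) = (\<integral>\<omega>. - (\<epsilon> / 2) \<partial>M)" by (simp add: prob_space)
    also have "\<dots> \<le> (\<integral>\<omega>. (\<Sum>n\<in>F. g n \<omega> * c n) \<partial>M)"
    proof (rule integral_mono_AE)
      show "AE \<omega> in M. - (\<epsilon> / 2) \<le> (\<Sum>n\<in>F. g n \<omega> * c n)"
        using nn AE_space
      proof eventually_elim
        case (elim \<omega>)
        have "\<bar>kap (mpow (\<lambda>j. rho_lin u j (X \<omega>))) x y - (\<Sum>n\<in>F. g n \<omega> * c n)\<bar> \<le> \<epsilon> / 2"
          unfolding g_def by (rule near, rule abs_mpow_rho_le[OF X(2)[OF elim(2)]])
        with elim(1) show ?case by linarith
      qed
    qed (auto intro!: Bochner_Integration.integrable_sum integrable_mult_left gi)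
    also have "\<dots> = (\<Sum>n\<in>F. \<rho> n * c n)"
      by (simp add: gi r g_def[symmetric])
    finally show "0 \<le> kap \<rho> x y + \<epsilon>"
      using near[of \<rho>, OF r1] eps by linarith
  qed
qed

end

section \<open>Necessity of the pair condition\<close>

context meixner_basis
begin

text \<open>The generating functions at 0 and at half a unit vector are compared for one individual
  of type \<open>i\<close>. As \<open>\<alpha>\<close> tends to 0 the common negative binomial
  factor tends to 1 and the constant \<open>B0\<close> cancels, which leaves the sign of the
  coefficient of \<open>t k\<close> in \<open>branch\<close>.\<close>

lemma condition_of_nonneg:
  assumes xi: "\<xi> \<in> unit_simplex"
    and nn: "\<And>\<alpha> x y. \<alpha> > 0 \<Longrightarrow> meixner_system.kap \<theta> u a z \<alpha> (mpow (\<lambda>j. rho_lin u j \<xi>)) x y \<ge> 0"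
  shows "pair_condition \<theta> p u a \<xi>"
  unfolding pair_condition_iff[OF xi]
proof (intro allI)
  fix i k
  define b where "b = beta \<xi> * p $ k / 2"
  define r where "r = 1 + \<theta> * (1 - mass \<xi>)"
  define B0 where "B0 = (1 - mass \<xi>) * (1 + \<theta>) / r"
  define D where "D = p $ k * (hyp_avg \<xi> i k - mass \<xi> * beta \<xi>) / 2"
  note bb = beta_bounds[OF xi]
  have r: "r > 0" using one_plus_pos[OF xi] by (simp add: r_def)
  have pk: "p $ k \<le> 1" using member_le_sum[of k UNIV "\<lambda>i. p $ i"] p_pos by (simp add: sum_p less_imp_le)
  have b: "0 \<le> b" "b < 1"
  proof -
    show "0 \<le> b" using bb p_pos[of k] by (simp add: b_def)
    have "beta \<xi> * p $ k \<le> 1 * 1" using bb pk p_pos[of k] by (intro mult_mono) auto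
    then show "b < 1" by (simp add: b_def)
  qed
  have ineq: "B0 \<le> (1 - b) powr (-\<alpha>) * (B0 + D * (1 - b) powr (-1) / r)" if "\<alpha> > 0" for \<alpha>
  proof -
    interpret ms: meixner_system \<theta> p u a z e \<alpha> by unfold_locales (rule that)
    \<comment> \<open>Any value strictly between 0 and 1 would do in place of 1/2.\<close>
    define t where "t = (\<lambda>j. if j = k then 1/2 else 0 :: real)"
    have "ms.cond_pgf \<xi> (e_vec i) (\<lambda>_. 0) \<le> ms.cond_pgf \<xi> (e_vec i) t"
      by (rule ms.cond_pgf_mono_of_nonneg[OF xi nn[OF that]]) (auto simp: t_def)
    moreover have sum_t: "(\<Sum>j\<in>UNIV. f j * t j) = f k / 2" for f :: "'d \<Rightarrow> real"
    proof -
      have "(\<Sum>j\<in>UNIV. f j * t j) = (\<Sum>j\<in>UNIV. if j = k then f k / 2 else 0)"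
        by (rule sum.cong) (auto simp: t_def)
      then show ?thesis by simp
    qed
    ultimately have "r powr (-\<alpha>) * B0 \<le> r powr (-\<alpha>) * ((1 - b) powr (-\<alpha>) * (B0 + D * (1 - b) powr (-1) / r))"
      using sum_t[of "\<lambda>j. beta \<xi> * p $ j"] sum_t[of "\<lambda>j. p $ j * (hyp_avg \<xi> i j - mass \<xi> * beta \<xi>)"]
      by (simp only: ms.cond_pgf_def ms.branch_def r_def[symmetric] B0_def b_def[symmetric] D_def[symmetric]
          mpow_e_vec mult_zero_right sum.neutral_const diff_zero powr_one_eq_one mult_zero_left mult_1_right
          mult_1_left div_0 add_0_right mult.assoc)
    then show ?thesis using r by simp
  qed
  have "((\<lambda>\<alpha>. (1 - b) powr (-\<alpha>) * (B0 + D * (1 - b) powr (-1) / r)) \<longlongrightarrow> (1 - b) powr (-0) * (B0 + D * (1 - b) powr (-1) / r)) (at_right 0)"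
    using b by (intro tendsto_intros) auto
  then have "B0 \<le> (1 - b) powr (-0) * (B0 + D * (1 - b) powr (-1) / r)"
  proof (rule tendsto_lowerbound)
    show "\<forall>\<^sub>F \<alpha> in at_right 0. B0 \<le> (1 - b) powr (-\<alpha>) * (B0 + D * (1 - b) powr (-1) / r)"
      by (rule eventually_at_rightI[of 0 1], rule ineq) auto
  qed simp
  then have "0 \<le> D * ((1 - b) powr (-1) / r)" using b by simp
  moreover have "(1 - b) powr (-1) / r > 0" using r b by simp
  ultimately have "D \<ge> 0" by (metis mult_neg_pos not_le)
  then show "mass \<xi> * beta \<xi> \<le> hyp_avg \<xi> i k"
    using p_pos[of k] by (simp add: D_def zero_le_mult_iff)
qed

end

section \<open>Difference calculus\<close>

definition Dif :: "'d \<Rightarrow> (('d \<Rightarrow> nat) \<Rightarrow> real) \<Rightarrow> ('d \<Rightarrow> nat) \<Rightarrow> real" where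
  "Dif i f x = f (\<lambda>j. x j + e_vec i j) - f x"

text \<open>Polynomial functions of degree less than \<open>k\<close>, characterised by the
  vanishing of all \<open>k\<close>-fold forward differences. No coefficients are involved, and
  leading forms can be compared by applying differences.\<close>

fun deg_lt :: "nat \<Rightarrow> (('d::finite \<Rightarrow> nat) \<Rightarrow> real) \<Rightarrow> bool" where
  "deg_lt 0 f \<longleftrightarrow> f = (\<lambda>_. 0)"
| "deg_lt (Suc k) f \<longleftrightarrow> (\<forall>i. deg_lt k (Dif i f))"

lemma Dif_zero [simp]: "Dif i (\<lambda>_. c) = (\<lambda>_. 0)"
  by (auto simp: Dif_def)

lemma Dif_add: "Dif i (\<lambda>x. f x + g x) = (\<lambda>x. Dif i f x + Dif i g x)"
  by (auto simp: Dif_def)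

lemma Dif_cmult: "Dif i (\<lambda>x. c * f x) = (\<lambda>x. c * Dif i f x)"
  by (auto simp: Dif_def algebra_simps)

lemma Dif_sum: "Dif i (\<lambda>x. \<Sum>s\<in>S. f s x) = (\<lambda>x. \<Sum>s\<in>S. Dif i (f s) x)"
  by (auto simp: Dif_def sum_subtractf)

lemma Dif_commute: "Dif i (Dif j f) = Dif j (Dif i f)"
  by (auto simp: Dif_def fun_eq_iff add_ac)

lemma deg_lt_zero [simp]: "deg_lt k (\<lambda>_. 0)"
  by (induction k) auto

lemma deg_lt_add: "deg_lt k f \<Longrightarrow> deg_lt k g \<Longrightarrow> deg_lt k (\<lambda>x. f x + g x)"
  by (induction k arbitrary: f g) (auto simp: Dif_add)

lemma deg_lt_cmult: "deg_lt k f \<Longrightarrow> deg_lt k (\<lambda>x. c * f x)"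
  by (induction k arbitrary: f) (auto simp: Dif_cmult)

lemma deg_lt_diff: "deg_lt k f \<Longrightarrow> deg_lt k g \<Longrightarrow> deg_lt k (\<lambda>x. f x - g x)"
  using deg_lt_add[of k f "\<lambda>x. -1 * g x"] deg_lt_cmult[of k g "-1"] by simp

lemma deg_lt_sum: "(\<And>s. s \<in> S \<Longrightarrow> deg_lt k (f s)) \<Longrightarrow> deg_lt k (\<lambda>x. \<Sum>s\<in>S. f s x)"
  by (induction S rule: infinite_finite_induct) (auto intro: deg_lt_add)

lemma deg_lt_Suc: "deg_lt k f \<Longrightarrow> deg_lt (Suc k) f"
  by (induction k arbitrary: f) auto

text \<open>One more than the sharp bound, which keeps the statement free of subtraction.\<close>

lemma deg_lt_mult:
  "deg_lt k f \<Longrightarrow> deg_lt l g \<Longrightarrow> deg_lt (k + l) (\<lambda>x. f x * g x)"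
proof (induction "k + l" arbitrary: k l f g)
  case (Suc m)
  show ?case
  proof (cases "k = 0 \<or> l = 0")
    case True
    then have "(\<lambda>x. f x * g x) = (\<lambda>_. 0)" using Suc.prems by (auto simp: fun_eq_iff)
    then show ?thesis by (simp only: deg_lt_zero)
  next
    case False
    then obtain k' l' where kl: "k = Suc k'" "l = Suc l'" by (meson not0_implies_Suc)
    have "deg_lt (k' + l) (\<lambda>x. Dif i f x * g x)" for i
      using Suc kl by (intro Suc.hyps(1)) auto
    moreover have "deg_lt (k + l') (\<lambda>x. f x * Dif i g x)" for i
      using Suc kl by (intro Suc.hyps(1)) auto
    moreover have "deg_lt (k' + l) (\<lambda>x. Dif i f x * Dif i g x)" for i
      using Suc kl by (intro Suc.hyps(1) deg_lt_Suc[of l', folded kl]) auto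
    moreover have "Dif i (\<lambda>x. f x * g x) = (\<lambda>x. Dif i f x * g x + f x * Dif i g x + Dif i f x * Dif i g x)" for i
      by (auto simp: Dif_def algebra_simps)
    moreover have "k + l' = k' + l" "k + l = Suc (k' + l)" using kl by auto
    ultimately show ?thesis by (auto intro!: deg_lt_add)
  qed
qed auto

lemma deg_lt_1_const:
  assumes "deg_lt (Suc 0) f"
  shows "f x = f (\<lambda>_. 0)"
proof (induction "total x" arbitrary: x)
  case 0
  then show ?case by (metis total_eq_0_iff)
next
  case (Suc m)
  then obtain i where "x i \<noteq> 0" by (metis total_eq_0_iff nat.distinct(1) ext)
  define y where "y = (\<lambda>j. x j - e_vec i j)"
  have x: "x = (\<lambda>j. y j + e_vec i j)" using \<open>x i \<noteq> 0\<close> by (auto simp: y_def e_vec_def)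
  then have "total x = total y + 1" by (simp only: total_add total_e_vec)
  then have "f y = f (\<lambda>_. 0)" using Suc.hyps by auto
  moreover have "Dif i f y = 0" using assms by (simp add: fun_eq_iff)
  ultimately show ?case by (simp add: Dif_def flip: x)
qed

text \<open>A lattice path of \<open>total x\<close> unit steps leads from 0 to \<open>x\<close>,
  and each step changes \<open>f\<close> by a difference of lower degree.\<close>

lemma deg_lt_growth:
  "deg_lt (Suc k) f \<Longrightarrow> \<exists>C\<ge>0. \<forall>x. \<bar>f x\<bar> \<le> C * (1 + real (total x)) ^ k"
proof (induction k arbitrary: f)
  case 0
  then show ?case
    using deg_lt_1_const[of f] by (intro exI[of _ "\<bar>f (\<lambda>_. 0)\<bar>"]) (metis abs_ge_zero mult_1_right power_0 order_refl)
next
  case (Suc k)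
  then have "\<forall>i. \<exists>C\<ge>0. \<forall>x. \<bar>Dif i f x\<bar> \<le> C * (1 + real (total x)) ^ k"
    by (metis deg_lt.simps(2))
  then obtain c where c: "\<And>i. c i \<ge> 0" "\<And>i x. \<bar>Dif i f x\<bar> \<le> c i * (1 + real (total x)) ^ k"
    by metis
  define C where "C = (\<Sum>i\<in>UNIV. c i)"
  have C: "C \<ge> 0" "\<bar>Dif i f x\<bar> \<le> C * (1 + real (total x)) ^ k" for i x
  proof -
    show "C \<ge> 0" unfolding C_def by (intro sum_nonneg c)
    have "c i \<le> C" unfolding C_def by (rule member_le_sum) (auto intro: c)
    then show "\<bar>Dif i f x\<bar> \<le> C * (1 + real (total x)) ^ k"
      by (intro order_trans[OF c(2)] mult_right_mono) auto
  qed
  have "\<bar>f x\<bar> \<le> \<bar>f (\<lambda>_. 0)\<bar> + real (total x) * (C * (1 + real (total x)) ^ k)" for x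
  proof (induction "total x" arbitrary: x)
    case 0
    then have "x = (\<lambda>_. 0)" by (metis total_eq_0_iff)
    then show ?case by simp
  next
    case (Suc m)
    then obtain i where "x i \<noteq> 0" by (metis total_eq_0_iff nat.distinct(1) ext)
    define y where "y = (\<lambda>j. x j - e_vec i j)"
    have x: "x = (\<lambda>j. y j + e_vec i j)" using \<open>x i \<noteq> 0\<close> by (auto simp: y_def e_vec_def)
    then have tx: "total x = total y + 1" by (simp only: total_add total_e_vec)
    then have IH: "\<bar>f y\<bar> \<le> \<bar>f (\<lambda>_. 0)\<bar> + real (total y) * (C * (1 + real (total y)) ^ k)"
      using Suc.hyps by auto
    have le: "C * (1 + real (total y)) ^ k \<le> C * (1 + real (total x)) ^ k"
      using C(1) tx by (intro mult_left_mono power_mono) auto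
    have "\<bar>f x\<bar> \<le> \<bar>f y\<bar> + \<bar>Dif i f y\<bar>"
      by (simp add: Dif_def flip: x)
    also have "\<dots> \<le> \<bar>f (\<lambda>_. 0)\<bar> + real (total y) * (C * (1 + real (total y)) ^ k) + C * (1 + real (total y)) ^ k"
      using IH C(2)[of i y] by linarith
    also have "\<dots> = \<bar>f (\<lambda>_. 0)\<bar> + real (total x) * (C * (1 + real (total y)) ^ k)"
      by (simp add: tx algebra_simps)
    also have "\<dots> \<le> \<bar>f (\<lambda>_. 0)\<bar> + real (total x) * (C * (1 + real (total x)) ^ k)"
      by (intro add_left_mono mult_left_mono[OF le]) auto
    finally show ?case .
  qed
  moreover have "\<bar>f (\<lambda>_. 0)\<bar> + real (total x) * (C * (1 + real (total x)) ^ k) \<le> (\<bar>f (\<lambda>_. 0)\<bar> + C) * (1 + real (total x)) ^ Suc k" for x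
  proof -
    have "\<bar>f (\<lambda>_. 0)\<bar> * 1 \<le> \<bar>f (\<lambda>_. 0)\<bar> * (1 + real (total x)) ^ Suc k"
      by (intro mult_left_mono one_le_power) auto
    moreover have "real (total x) * (C * (1 + real (total x)) ^ k) \<le> (1 + real (total x)) * (C * (1 + real (total x)) ^ k)"
      using C(1) by (intro mult_right_mono) auto
    ultimately show ?thesis by (simp add: algebra_simps)
  qed
  ultimately show ?case
    using C(1) by (intro exI[of _ "\<bar>f (\<lambda>_. 0)\<bar> + C"] conjI allI) (auto intro: order_trans simp del: power_Suc)
qed

lemma finite_total_less: "finite {m :: 'd::finite \<Rightarrow> nat. total m < k}"
proof (rule finite_subset)
  show "{m :: 'd \<Rightarrow> nat. total m < k} \<subseteq> {m. \<forall>i. m i \<le> (\<lambda>_. k) i}"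
    by (auto intro!: less_imp_le[OF le_less_trans[OF component_le_total]])
qed (rule finite_below[of "\<lambda>_. k"])

section \<open>Differences in the directions of the basis\<close>

context meixner_basis
begin

text \<open>Orthogonality over the points says that one square matrix is a left inverse of another.
  It is then a right inverse too, which is orthogonality over the labels.\<close>

lemma dual_orth: "(\<Sum>r\<in>UNIV. (u r $ i) * (u r $ k) * inverse (a r)) * p $ k = (if i = k then 1 else 0)"
proof -
  define A :: "real^'d^'d" where "A = (\<chi> j i. (u j $ i) * p $ i * inverse (a j))"
  define B :: "real^'d^'d" where "B = (\<chi> i k. u k $ i)"
  have "A ** B = mat 1"
  proof -
    have "(\<Sum>i\<in>UNIV. (u j $ i) * p $ i * inverse (a j) * (u k $ i)) = (if j = k then 1 else 0)" for j k
    proof -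
      have "(\<Sum>i\<in>UNIV. (u j $ i) * p $ i * inverse (a j) * (u k $ i)) = inverse (a j) * (\<Sum>i\<in>UNIV. (u j $ i) * (u k $ i) * p $ i)"
        by (simp add: sum_distrib_left mult_ac)
      then show ?thesis using less_imp_neq[OF a_pos, of j] by (auto simp: u_orth)
    qed
    then show ?thesis by (simp add: A_def B_def matrix_matrix_mult_def mat_def vec_eq_iff)
  qed
  then have "B ** A = mat 1" by (simp add: matrix_left_right_inverse)
  then have "(B ** A) $ i $ k = (if i = k then 1 else 0)" by (simp add: mat_def)
  then show ?thesis
    by (simp add: A_def B_def matrix_matrix_mult_def sum_distrib_right sum_distrib_left mult_ac)
qed

text \<open>The difference operators dual to the linear forms \<open>rl\<close>: by
  \<open>nab_rl_mult\<close>, \<open>nab i\<close> maps \<open>rl j\<close> to 1 if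
  \<open>i = j\<close> and to 0 otherwise.\<close>

definition nab :: "'d \<Rightarrow> (('d \<Rightarrow> nat) \<Rightarrow> real) \<Rightarrow> ('d \<Rightarrow> nat) \<Rightarrow> real" where
  "nab j f x = (\<Sum>i\<in>UNIV. p $ i * (u j $ i) * inverse (a j) * Dif i f x)"

lemma Dif_eq_nab: "Dif i f = (\<lambda>x. \<Sum>j\<in>UNIV. (u j $ i) * nab j f x)"
proof
  fix x
  have "(\<Sum>j\<in>UNIV. (u j $ i) * nab j f x) = (\<Sum>k\<in>UNIV. ((\<Sum>j\<in>UNIV. (u j $ i) * (u j $ k) * inverse (a j)) * p $ k) * Dif k f x)"
    unfolding nab_def sum_distrib_left sum_distrib_right by (subst sum.swap) (simp add: mult_ac)
  also have "\<dots> = (\<Sum>k\<in>UNIV. if i = k then Dif k f x else 0)"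
    by (rule sum.cong) (simp_all add: dual_orth)
  finally show "Dif i f x = (\<Sum>j\<in>UNIV. (u j $ i) * nab j f x)" by simp
qed

lemma nab_add: "nab j (\<lambda>x. f x + g x) = (\<lambda>x. nab j f x + nab j g x)"
  by (simp add: nab_def[abs_def] Dif_add distrib_left sum.distrib)

lemma nab_cmult: "nab j (\<lambda>x. c * f x) = (\<lambda>x. c * nab j f x)"
  by (simp add: nab_def[abs_def] Dif_cmult sum_distrib_left mult_ac)

lemma nab_const [simp]: "nab j (\<lambda>_. c) = (\<lambda>_. 0)"
  by (simp add: nab_def[abs_def])

lemma nab_commute: "nab j (nab k f) = nab k (nab j f)"
proof -
  have *: "nab j (nab k f) = (\<lambda>x. \<Sum>i\<in>UNIV. \<Sum>l\<in>UNIV. p $ i * (u j $ i) * inverse (a j) * (p $ l * (u k $ l) * inverse (a k) * Dif i (Dif l f) x))" for j k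
    unfolding nab_def[abs_def] Dif_sum Dif_cmult sum_distrib_left by simp
  show ?thesis
    unfolding *[of j k] *[of k j] by (subst sum.swap) (simp add: Dif_commute[of _ _ f] mult_ac)
qed

lemma deg_lt_nab: "deg_lt (Suc k) f \<Longrightarrow> deg_lt k (nab j f)"
  unfolding nab_def[abs_def] by (intro deg_lt_sum deg_lt_cmult) simp

lemma deg_lt_nabI: "(\<And>j. deg_lt k (nab j f)) \<Longrightarrow> deg_lt (Suc k) f"
  unfolding deg_lt.simps Dif_eq_nab by (intro allI deg_lt_sum deg_lt_cmult)

definition rl :: "'d \<Rightarrow> ('d \<Rightarrow> nat) \<Rightarrow> real" where
  "rl j x = (\<Sum>i\<in>UNIV. (u j $ i) * real (x i))"

definition rpow :: "('d \<Rightarrow> nat) \<Rightarrow> ('d \<Rightarrow> nat) \<Rightarrow> real" where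
  "rpow n x = mpow (\<lambda>j. rl j x) n"

lemma rl_add_e: "rl j (\<lambda>k. x k + e_vec i k) = rl j x + u j $ i"
proof -
  have "(\<Sum>k\<in>UNIV. (u j $ k) * real (e_vec i k)) = (\<Sum>k\<in>UNIV. if k = i then u j $ i else 0)"
    by (rule sum.cong) (auto simp: e_vec_def)
  then show ?thesis by (simp add: rl_def distrib_left sum.distrib)
qed

lemma rl_z: "rl z x = real (total x)"
  by (simp add: rl_def total_def)

lemma Dif_rl_mult: "Dif i (\<lambda>x. rl j x * f x) = (\<lambda>x. rl j x * Dif i f x + (u j $ i) * Dif i f x + (u j $ i) * f x)"
  by (auto simp: Dif_def rl_add_e algebra_simps)

lemma deg_lt_rl_mult: "deg_lt k f \<Longrightarrow> deg_lt (Suc k) (\<lambda>x. rl j x * f x)"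
proof (induction k arbitrary: f)
  case (Suc k)
  then have "deg_lt k (Dif i f)" for i by simp
  then have "deg_lt (Suc k) (\<lambda>x. rl j x * Dif i f x + (u j $ i) * Dif i f x + (u j $ i) * f x)" for i
    using Suc.IH[of "Dif i f"] deg_lt_Suc[of k "Dif i f"] Suc.prems
    by (intro deg_lt_add deg_lt_cmult) blast+
  then show ?case unfolding deg_lt.simps(2)[of "Suc k"] Dif_rl_mult by blast
qed auto

text \<open>A Leibniz rule. The last sum is the correction to the rule for derivatives; it contains
  only first differences of \<open>f\<close>, so it lies one degree below \<open>f\<close>.\<close>

lemma nab_rl_mult:
  "nab i (\<lambda>x. rl j x * f x) = (\<lambda>x. rl j x * nab i f x + (if i = j then f x else 0)
     + (\<Sum>k\<in>UNIV. p $ k * (u i $ k) * inverse (a i) * (u j $ k) * Dif k f x))"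
proof
  fix x
  have "(\<Sum>k\<in>UNIV. p $ k * (u i $ k) * inverse (a i) * ((u j $ k) * f x)) = inverse (a i) * (\<Sum>k\<in>UNIV. (u i $ k) * (u j $ k) * p $ k) * f x"
    by (simp add: sum_distrib_left sum_distrib_right mult_ac)
  also have "\<dots> = (if i = j then f x else 0)" using less_imp_neq[OF a_pos, of i] by (auto simp: u_orth)
  finally have *: "(\<Sum>k\<in>UNIV. p $ k * (u i $ k) * inverse (a i) * ((u j $ k) * f x)) = (if i = j then f x else 0)" .
  show "nab i (\<lambda>x. rl j x * f x) x = rl j x * nab i f x + (if i = j then f x else 0)
     + (\<Sum>k\<in>UNIV. p $ k * (u i $ k) * inverse (a i) * (u j $ k) * Dif k f x)"
    unfolding nab_def Dif_rl_mult *[symmetric] sum_distrib_left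
    by (simp add: sum.distrib[symmetric] algebra_simps)
qed

definition dn :: "'d \<Rightarrow> ('d \<Rightarrow> nat) \<Rightarrow> 'd \<Rightarrow> nat" where
  "dn j n = n(j := n j - 1)"

lemma dn_add_e: "n j \<noteq> 0 \<Longrightarrow> n = (\<lambda>k. dn j n k + e_vec j k)"
  by (auto simp: dn_def e_vec_def)

lemma dn_of_add: "dn j (\<lambda>k. m k + e_vec j k) = m"
  by (auto simp: dn_def e_vec_def)

lemma total_dn: "n j \<noteq> 0 \<Longrightarrow> total n = Suc (total (dn j n))"
proof -
  assume "n j \<noteq> 0"
  then have "total n = total (\<lambda>k. dn j n k + e_vec j k)" by (simp flip: dn_add_e)
  then show ?thesis by (simp only: total_add total_e_vec Suc_eq_plus1)
qed

lemma mfact_add_e: "mfact (\<lambda>k. m k + e_vec j k) = real (Suc (m j)) * mfact m"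
  unfolding mfact_def
  by (subst (1 2) prod.remove[of UNIV j]) (auto simp: e_vec_def intro!: prod.cong)

lemma mfact_dn: "n j \<noteq> 0 \<Longrightarrow> mfact n = real (n j) * mfact (dn j n)"
proof -
  assume n: "n j \<noteq> 0"
  then have "mfact n = mfact (\<lambda>k. dn j n k + e_vec j k)" by (simp flip: dn_add_e)
  also have "\<dots> = real (n j) * mfact (dn j n)"
  proof -
    have "Suc (dn j n j) = n j" using n by (simp add: dn_def)
    then show ?thesis by (simp only: mfact_add_e)
  qed
  finally show ?thesis .
qed

lemma rpow_add_e: "rpow (\<lambda>k. m k + e_vec j k) = (\<lambda>x. rl j x * rpow m x)"
  by (auto simp: rpow_def mpow_add)

lemma multiindex_induct [case_names zero add]:
  assumes "Q (\<lambda>_. 0)" "\<And>m j. Q m \<Longrightarrow> Q (\<lambda>k. m k + e_vec j k)"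
  shows "Q (n :: 'd \<Rightarrow> nat)"
proof (induction "total n" arbitrary: n)
  case 0
  then have "n = (\<lambda>_. 0)" by (metis total_eq_0_iff)
  then show ?case using assms(1) by simp
next
  case (Suc k)
  then obtain j where j: "n j \<noteq> 0" by (metis total_eq_0_iff nat.distinct(1) ext)
  have "total (dn j n) = k" using Suc.hyps(2) total_dn[of n j, OF j] by simp
  then have "Q (\<lambda>k. dn j n k + e_vec j k)" using Suc.hyps(1) assms(2) by blast
  then show ?case using dn_add_e[of n j, OF j] by simp
qed

lemma deg_lt_rpow: "deg_lt (Suc (total n)) (rpow n)"
proof (induction n rule: multiindex_induct)
  case zero
  then show ?case by (simp add: rpow_def)
next
  case (add m j)
  have "total (\<lambda>k. m k + e_vec j k) = Suc (total m)" by (simp only: total_add total_e_vec Suc_eq_plus1)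
  then show ?case unfolding rpow_add_e using deg_lt_rl_mult[OF add] by (simp del: deg_lt.simps)
qed

text \<open>To leading order \<open>nab i\<close> acts on polynomials in the linear forms \<open>rl j\<close> as the partial
  derivative in the direction \<open>rl i\<close>.\<close>

lemma nab_rpow: "deg_lt (total n - 1) (\<lambda>x. nab i (rpow n) x - real (n i) * rpow (dn i n) x)"
proof (induction n rule: multiindex_induct)
  case zero
  then show ?case by (simp add: rpow_def[abs_def])
next
  case (add m j)
  define n where "n = (\<lambda>k. m k + e_vec j k)"
  define r where "r = (\<lambda>x. nab i (rpow m) x - real (m i) * rpow (dn i m) x)"
  have t: "total n - 1 = total m" unfolding n_def by (simp only: total_add total_e_vec diff_add_inverse2)
  have "deg_lt (total m) (\<lambda>x. rl j x * r x)"
  proof (cases "total m = 0")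
    case True
    then have "r = (\<lambda>_. 0)" using add by (simp add: r_def)
    then show ?thesis by (simp only: mult_zero_right deg_lt_zero)
  next
    case False
    then show ?thesis using deg_lt_rl_mult[OF add, of j] by (simp add: r_def del: deg_lt.simps)
  qed
  moreover have "deg_lt (total m) (\<lambda>x. \<Sum>k\<in>UNIV. p $ k * (u i $ k) * inverse (a i) * (u j $ k) * Dif k (rpow m) x)"
    using deg_lt_rpow[of m] by (intro deg_lt_sum deg_lt_cmult) auto
  ultimately have d: "deg_lt (total m) (\<lambda>x. rl j x * r x + (\<Sum>k\<in>UNIV. p $ k * (u i $ k) * inverse (a i) * (u j $ k) * Dif k (rpow m) x))"
    by (rule deg_lt_add)
  have "real (n i) * rpow (dn i n) x = rl j x * (real (m i) * rpow (dn i m) x) + (if i = j then rpow m x else 0)" for x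
  proof (cases "i = j")
    case True
    have 1: "dn i n = m" using True by (simp add: n_def dn_of_add)
    have 2: "n i = Suc (m i)" using True by (simp add: n_def e_vec_def)
    have 3: "real (m i) * rpow m x = real (m i) * (rl j x * rpow (dn i m) x)"
    proof (cases "m i = 0")
      case False
      then have "rpow m = rpow (\<lambda>k. dn i m k + e_vec i k)" by (simp flip: dn_add_e)
      then show ?thesis using True by (simp add: rpow_add_e)
    qed simp
    show ?thesis unfolding 1 2 using 3 True by (simp add: algebra_simps)
  next
    case False
    have "n i = m i" using False by (simp add: n_def e_vec_def)
    moreover have "dn i n = (\<lambda>k. dn i m k + e_vec j k)" using False by (auto simp: n_def dn_def e_vec_def)
    ultimately show ?thesis using False by (simp add: rpow_add_e)
  qed
  then have "nab i (rpow n) x - real (n i) * rpow (dn i n) x =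
      rl j x * r x + (\<Sum>k\<in>UNIV. p $ k * (u i $ k) * inverse (a i) * (u j $ k) * Dif k (rpow m) x)" for x
    unfolding n_def[symmetric] rpow_add_e[of m j, folded n_def] nab_rl_mult r_def by (simp add: algebra_simps)
  then have "deg_lt (total n - 1) (\<lambda>x. nab i (rpow n) x - real (n i) * rpow (dn i n) x)"
    using d by (simp only: t)
  then show ?case by (simp only: n_def)
qed

text \<open>The scaling between \<open>Mx n\<close> and its leading form. The exceptional value at
  \<open>z\<close> comes from \<open>1 + lam i z = - inverse \<theta>\<close>, where the coefficient
  of \<open>w z\<close> departs from the basis value 1.\<close>

definition sg :: "'d \<Rightarrow> real" where "sg j = (if j = z then - \<theta> else 1)"

lemma sg_nz: "sg j \<noteq> 0" using theta_pos by (simp add: sg_def)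

lemma fold_nab_deg: "deg_lt (length js + k) f \<Longrightarrow> deg_lt k (fold nab js f)"
  by (induction js arbitrary: f) (auto dest: deg_lt_nab simp del: deg_lt.simps)

lemma deg_lt_fold_nabI: "(\<And>js. length js = k \<Longrightarrow> fold nab js f = (\<lambda>_. 0)) \<Longrightarrow> deg_lt k f"
proof (induction k arbitrary: f)
  case 0
  from 0[of "[]"] show ?case by simp
next
  case (Suc k)
  show ?case
  proof (rule deg_lt_nabI, rule Suc.IH)
    fix j and js :: "'d list" assume "length js = k"
    then show "fold nab js (nab j f) = (\<lambda>_. 0)" using Suc.prems[of "j # js"] by simp
  qed
qed

lemma fold_nab_add: "fold nab js (\<lambda>x. f x + g x) = (\<lambda>x. fold nab js f x + fold nab js g x)"
  by (induction js arbitrary: f g) (auto simp: nab_add)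

lemma fold_nab_cmult: "fold nab js (\<lambda>x. c * f x) = (\<lambda>x. c * fold nab js f x)"
  by (induction js arbitrary: f) (auto simp: nab_cmult)

lemma fold_nab_zero: "fold nab js (\<lambda>_. 0) = (\<lambda>_. 0)"
  by (induction js) auto

lemma fold_nab_sum: "fold nab js (\<lambda>x. \<Sum>s\<in>S. f s x) = (\<lambda>x. \<Sum>s\<in>S. fold nab js (f s) x)"
  by (induction S rule: infinite_finite_induct) (auto simp: fold_nab_add fold_nab_zero)

text \<open>The operators \<open>nab\<close> commute, so an iterated difference depends only on the
  multi-index of multiplicities.\<close>

lemma fold_nab_count:
  assumes "\<And>j. count_list js j = count_list js' j"
  shows "fold nab js f = fold nab js' f"
proof -
  have "mset js = mset js'" by (rule multiset_eqI) (simp add: assms count_mset)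
  then have "fold nab js = fold nab js'"
    by (intro fold_multiset_equiv) (auto simp: fun_eq_iff nab_commute)
  then show ?thesis by simp
qed

end

section \<open>Expansion of polynomials into Meixner polynomials\<close>

lemma has_sum_finite_sum:
  fixes f :: "'b \<Rightarrow> 'c \<Rightarrow> real"
  shows "(\<And>s. s \<in> S \<Longrightarrow> (f s has_sum F s) A) \<Longrightarrow> ((\<lambda>x. \<Sum>s\<in>S. f s x) has_sum (\<Sum>s\<in>S. F s)) A"
  by (induction S rule: infinite_finite_induct) (auto intro: has_sum_add)

lemma nn_integral_count_space_has_sum:
  fixes f :: "'b \<Rightarrow> real"
  assumes "(f has_sum S) A" "\<And>q. q \<in> A \<Longrightarrow> f q \<ge> 0"
  shows "(\<integral>\<^sup>+q. ennreal (f q) \<partial>count_space A) = ennreal S"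
proof -
  have "integrable (count_space A) f"
    using assms(1) abs_summable_equivalent[of f A] by (simp add: abs_summable_on_def has_sum_imp_summable summable_on_abs_real)
  then have "(\<integral>\<^sup>+q. ennreal (f q) \<partial>count_space A) = ennreal (\<integral>q. f q \<partial>count_space A)"
    by (rule nn_integral_eq_integral) (use assms(2) in \<open>auto simp: AE_count_space\<close>)
  then show ?thesis
    using assms(1) infsetsum_infsum[of f A] by (simp add: infsetsum_def has_sum_iff abs_summable_equivalent[symmetric] summable_on_abs_real)
qed

lemma has_sum_shift:
  fixes f :: "('d::finite \<Rightarrow> nat) \<Rightarrow> real"
  assumes "((\<lambda>n. f n * mpow w n) has_sum F) UNIV"
  shows "((\<lambda>n. (if n j = 0 then 0 else f (n(j := n j - 1))) * mpow w n) has_sum w j * F) UNIV"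
proof -
  define g where "g n = (if n j = 0 then 0 else f (n(j := n j - 1))) * mpow w n" for n
  have "((\<lambda>m. g (\<lambda>k. m k + e_vec j k)) has_sum w j * F) UNIV"
  proof -
    have "(\<lambda>k. m k + e_vec j k)(j := m j) = m" for m by (auto simp: e_vec_def)
    then have "g (\<lambda>k. m k + e_vec j k) = w j * (f m * mpow w m)" for m
      by (simp add: g_def mpow_add) (simp add: e_vec_def)
    then show ?thesis using has_sum_cmult_right[OF assms, of "w j"] by simp
  qed
  moreover have "bij_betw (\<lambda>m k. m k + e_vec j k) UNIV {n. n j \<noteq> 0}"
    by (rule bij_betwI[where g = "\<lambda>n. n(j := n j - 1)"]) (auto simp: e_vec_def fun_eq_iff)
  ultimately have "(g has_sum w j * F) {n. n j \<noteq> 0}"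
    by (simp only: has_sum_reindex_bij_betw[where f = g])
  then have "(g has_sum w j * F) UNIV"
    by (rule has_sum_cong_neutral[THEN iffD1, rotated -1]) (auto simp: g_def)
  then show ?thesis by (simp add: g_def[abs_def])
qed

context meixner_system
begin

text \<open>The coefficients of \<open>w j * gf x w\<close>.\<close>

definition Md :: "'a \<Rightarrow> ('a \<Rightarrow> nat) \<Rightarrow> ('a \<Rightarrow> nat) \<Rightarrow> real" where
  "Md j n x = (if n j = 0 then 0 else Mx (dn j n) x)"

text \<open>Comparing coefficients in \<open>(1 - w\<^sub>z) G(x + e\<^sub>i, w) = L\<^sub>i(w) G(x, w)\<close>.\<close>

lemma meixner_recursion:
  "Mx n (\<lambda>k. x k + e_vec i k) - Md z n (\<lambda>k. x k + e_vec i k) = Mx n x + (\<Sum>j\<in>UNIV. lam i j * Md j n x)"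
proof (rule mpowser_unique[of 1 "\<lambda>n. Mx n (\<lambda>k. x k + e_vec i k) - Md z n (\<lambda>k. x k + e_vec i k)" "\<lambda>w. lin w i * gf x w"])
  fix w :: "'a \<Rightarrow> real"
  assume w: "\<And>j. \<bar>w j\<bar> < 1"
  define y where "y = (\<lambda>k. x k + e_vec i k)"
  have wz: "w z < 1" using w[of z] by linarith
  have sh: "((\<lambda>n. Md j n y * mpow w n) has_sum w j * gf y w) UNIV" for j y
    unfolding Md_def dn_def by (rule has_sum_shift[OF has_sum_gf[of w y, OF w]])
  have "gf y w * (1 - w z) = lin w i * gf x w"
  proof -
    have "mpow (lin w) y = lin w i * mpow (lin w) x" by (simp add: y_def mpow_add)
    moreover have "total y = total x + 1" unfolding y_def by (simp only: total_add total_e_vec)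
    moreover have "(1 - w z) powr (-(real (total x + 1) + \<alpha>)) * (1 - w z) = (1 - w z) powr (-(real (total x) + \<alpha>))"
    proof -
      have "(1 - w z) powr (-(real (total x) + \<alpha>)) = (1 - w z) powr (-(real (total x + 1) + \<alpha>) + 1)" by simp
      then show ?thesis using wz by (simp only: powr_add powr_one)
    qed
    ultimately show ?thesis by (simp add: gf_def mult_ac)
  qed
  then have eq: "gf y w - w z * gf y w = lin w i * gf x w" by (simp add: algebra_simps)
  have "((\<lambda>n. (Mx n y - Md z n y) * mpow w n) has_sum gf y w - w z * gf y w) UNIV"
    using has_sum_add[OF has_sum_gf[of w y, OF w] has_sum_uminusI[OF sh[of z y]]] by (simp add: left_diff_distrib)
  then show "((\<lambda>n. (Mx n (\<lambda>k. x k + e_vec i k) - Md z n (\<lambda>k. x k + e_vec i k)) * mpow w n) has_sum lin w i * gf x w) UNIV"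
    unfolding eq unfolding y_def .
  have "((\<lambda>n. Mx n x * mpow w n + (\<Sum>j\<in>UNIV. lam i j * (Md j n x * mpow w n))) has_sum gf x w + (\<Sum>j\<in>UNIV. lam i j * (w j * gf x w))) UNIV"
    by (intro has_sum_add has_sum_finite_sum has_sum_cmult_right has_sum_gf sh w)
  then show "((\<lambda>n. (Mx n x + (\<Sum>j\<in>UNIV. lam i j * Md j n x)) * mpow w n) has_sum lin w i * gf x w) UNIV"
    by (simp add: lin_def distrib_right distrib_left sum_distrib_right sum_distrib_left mult_ac)
qed simp

lemma Dif_Mx: "Dif i (Mx n) = (\<lambda>x. Dif i (Md z n) x + (Md z n x + (\<Sum>j\<in>UNIV. lam i j * Md j n x)))"
  using meixner_recursion[of n _ i] by (auto simp: Dif_def algebra_simps)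

lemma deg_lt_Md_of_Mx:
  assumes "n j \<noteq> 0 \<Longrightarrow> deg_lt (Suc (total (dn j n))) (Mx (dn j n))"
  shows "deg_lt (total n) (Md j n)"
proof (cases "n j = 0")
  case True
  then have "Md j n = (\<lambda>_. 0)" by (auto simp: Md_def)
  then show ?thesis by simp
next
  case False
  then have "Md j n = Mx (dn j n)" by (auto simp: Md_def)
  then show ?thesis using assms[OF False] total_dn[of n j, OF False] by (simp del: deg_lt.simps)
qed

lemma deg_lt_Mx: "deg_lt (Suc (total n)) (Mx n)"
proof (induction "total n" arbitrary: n rule: less_induct)
  case less
  have Md: "deg_lt (total n) (Md j n)" for j
    by (rule deg_lt_Md_of_Mx, rule less) (simp add: total_dn)
  have "deg_lt (total n) (Dif i (Md z n))" for i
    using deg_lt_Suc[OF Md[of z]] by simp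
  then show ?case
    unfolding deg_lt.simps Dif_Mx by (intro allI deg_lt_add deg_lt_sum deg_lt_cmult Md)
qed

lemma deg_lt_Md: "deg_lt (total n) (Md j n)"
  by (rule deg_lt_Md_of_Mx[OF deg_lt_Mx])

text \<open>After the factor \<open>sg\<close> has absorbed the exceptional label \<open>z\<close>,
  the coefficients in \<open>meixner_recursion\<close> are basis values, and orthogonality keeps the
  label \<open>j\<close> alone.\<close>

lemma nab_Mx: "nab j (Mx n) = (\<lambda>x. nab j (Md z n) x + inverse (sg j) * Md j n x)"
proof
  fix x
  have lz: "1 + lam i z = - inverse \<theta>" for i using theta_pos by (simp add: lam_def field_simps)
  have "(\<Sum>i\<in>UNIV. p $ i * (u j $ i) * inverse (a j) * (Md z n x + (\<Sum>k\<in>UNIV. lam i k * Md k n x)))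
      = (\<Sum>i\<in>UNIV. p $ i * (u j $ i) * inverse (a j) * (\<Sum>k\<in>UNIV. (u k $ i) * (inverse (sg k) * Md k n x)))"
  proof (rule sum.cong)
    fix i
    have "Md z n x + (\<Sum>k\<in>UNIV. lam i k * Md k n x) = (1 + lam i z) * Md z n x + (\<Sum>k\<in>UNIV - {z}. lam i k * Md k n x)"
      by (simp add: sum.remove[of UNIV z] algebra_simps)
    also have "(\<Sum>k\<in>UNIV - {z}. lam i k * Md k n x) = (\<Sum>k\<in>UNIV - {z}. (u k $ i) * (inverse (sg k) * Md k n x))"
      by (rule sum.cong) (auto simp: lam_def sg_def)
    also have "(1 + lam i z) * Md z n x + \<dots> = (\<Sum>k\<in>UNIV. (u k $ i) * (inverse (sg k) * Md k n x))"
    proof -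
      have "sg z = - \<theta>" by (simp add: sg_def)
      then show ?thesis
        using sum.remove[of UNIV z "\<lambda>k. (u k $ i) * (inverse (sg k) * Md k n x)"] by (simp add: lz)
    qed
    finally show "p $ i * (u j $ i) * inverse (a j) * (Md z n x + (\<Sum>k\<in>UNIV. lam i k * Md k n x)) =
      p $ i * (u j $ i) * inverse (a j) * (\<Sum>k\<in>UNIV. (u k $ i) * (inverse (sg k) * Md k n x))" by simp
  qed auto
  also have "\<dots> = (\<Sum>k\<in>UNIV. inverse (a j) * (\<Sum>i\<in>UNIV. (u j $ i) * (u k $ i) * p $ i) * (inverse (sg k) * Md k n x))"
    unfolding sum_distrib_left sum_distrib_right by (subst sum.swap) (simp add: mult_ac)
  also have "\<dots> = (\<Sum>k\<in>UNIV. if j = k then inverse (sg k) * Md k n x else 0)"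
    by (rule sum.cong) (use less_imp_neq[OF a_pos] in \<open>auto simp: u_orth\<close>)
  finally have *: "(\<Sum>i\<in>UNIV. p $ i * (u j $ i) * inverse (a j) * (Md z n x + (\<Sum>k\<in>UNIV. lam i k * Md k n x))) = inverse (sg j) * Md j n x"
    by simp
  show "nab j (Mx n) x = nab j (Md z n) x + inverse (sg j) * Md j n x"
    unfolding nab_def Dif_Mx *[symmetric] by (simp add: distrib_left sum.distrib)
qed

text \<open>\<open>Nx n\<close> is the Meixner polynomial scaled to have the leading form \<open>rpow n\<close>.\<close>

definition Nx :: "('a \<Rightarrow> nat) \<Rightarrow> ('a \<Rightarrow> nat) \<Rightarrow> real" where
  "Nx n x = mpow sg n * mfact n * Mx n x"

lemma nab_Nx: "deg_lt (total n - 1) (\<lambda>x. nab i (Nx n) x - real (n i) * Nx (dn i n) x)"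
proof -
  have "nab i (Nx n) x - real (n i) * Nx (dn i n) x = mpow sg n * mfact n * nab i (Md z n) x" for x
  proof -
    have "nab i (Nx n) x = mpow sg n * mfact n * nab i (Md z n) x + mpow sg n * mfact n * inverse (sg i) * Md i n x"
      unfolding Nx_def[abs_def] nab_cmult nab_Mx by (simp add: algebra_simps)
    moreover have "mpow sg n * mfact n * inverse (sg i) * Md i n x = real (n i) * Nx (dn i n) x"
    proof (cases "n i = 0")
      case False
      then have "mpow sg n = mpow sg (\<lambda>k. dn i n k + e_vec i k)" by (simp flip: dn_add_e)
      then have "mpow sg n = mpow sg (dn i n) * sg i" by (simp add: mpow_add)
      then show ?thesis using False sg_nz[of i] by (simp add: Nx_def Md_def mfact_dn)
    qed (simp add: Md_def)
    ultimately show ?thesis by simp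
  qed
  moreover have "deg_lt (total n - 1) (nab i (Md z n))"
  proof (cases "total n")
    case 0
    then have "Md z n = (\<lambda>_. 0)" by (auto simp: Md_def total_eq_0_iff)
    then show ?thesis by simp
  next
    case (Suc k)
    then show ?thesis using deg_lt_nab[of k "Md z n" i] deg_lt_Md[of n z] by (simp del: deg_lt.simps)
  qed
  ultimately show ?thesis by (simp add: deg_lt_cmult)
qed

text \<open>Both families obey the same rule for \<open>nab\<close> up to lower degree, so every
  \<open>nab i\<close> of the difference has small degree by induction.\<close>

lemma rpow_minus_Nx: "deg_lt (total n) (\<lambda>x. rpow n x - Nx n x)"
proof (induction "total n" arbitrary: n)
  case 0
  then have "n = (\<lambda>_. 0)" by (metis total_eq_0_iff)
  then have "rpow n x = Nx n x" for x by (simp add: rpow_def Nx_def Mx_zero)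
  then show ?case by simp
next
  case (Suc k)
  have "deg_lt k (nab i (\<lambda>x. rpow n x - Nx n x))" for i
  proof -
    have k: "total n - 1 = k" using Suc.hyps(2) by simp
    define r where "r x = nab i (rpow n) x - real (n i) * rpow (dn i n) x" for x
    define r' where "r' x = nab i (Nx n) x - real (n i) * Nx (dn i n) x" for x
    have "nab i (\<lambda>x. rpow n x - Nx n x) = (\<lambda>x. nab i (rpow n) x - nab i (Nx n) x)"
      using nab_add[of i "rpow n" "\<lambda>x. -1 * Nx n x"] nab_cmult[of i "-1" "Nx n"] by simp
    also have "\<dots> = (\<lambda>x. (r x - r' x) + real (n i) * (rpow (dn i n) x - Nx (dn i n) x))"
      by (auto simp: r_def r'_def algebra_simps)
    finally have eq: "nab i (\<lambda>x. rpow n x - Nx n x) = (\<lambda>x. (r x - r' x) + real (n i) * (rpow (dn i n) x - Nx (dn i n) x))" .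
    have "deg_lt k (\<lambda>x. real (n i) * (rpow (dn i n) x - Nx (dn i n) x))"
    proof (cases "n i = 0")
      case False
      then have "total (dn i n) = k" using total_dn[of n i] Suc.hyps(2) by simp
      then show ?thesis using Suc.hyps(1)[of "dn i n"] by (intro deg_lt_cmult) simp
    qed simp
    moreover have "deg_lt k r" "deg_lt k r'"
      using nab_rpow[of n i] nab_Nx[of n i] unfolding k r_def[abs_def] r'_def[abs_def] by blast+
    ultimately show ?thesis unfolding eq by (intro deg_lt_add deg_lt_diff)
  qed
  then show ?case unfolding Suc.hyps(2)[symmetric] by (rule deg_lt_nabI)
qed

text \<open>As for monomials, a derivative of order \<open>total n\<close> annihilates the leading
  form unless the multiplicities match, and then it yields the factorial of the multi-index.\<close>

lemma fold_nab_Nx: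
  "length js = total n \<Longrightarrow> fold nab js (Nx n) = (\<lambda>_. if (\<forall>j. count_list js j = n j) then mfact n else 0)"
proof (induction js arbitrary: n)
  case Nil
  then have "n = (\<lambda>_. 0)" by (metis total_eq_0_iff list.size(3))
  then show ?case by (auto simp: Nx_def Mx_zero)
next
  case (Cons j js)
  define r where "r x = nab j (Nx n) x - real (n j) * Nx (dn j n) x" for x
  have "deg_lt (length js + 0) r"
  proof -
    have "total n - 1 = length js + 0" using Cons.prems by simp
    then show ?thesis using nab_Nx[of n j] unfolding r_def[abs_def] by (simp only:)
  qed
  then have r: "fold nab js r = (\<lambda>_. 0)" using fold_nab_deg[of js 0 r] by simp
  have "nab j (Nx n) = (\<lambda>x. r x + real (n j) * Nx (dn j n) x)" by (auto simp: r_def)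
  then have eq: "fold nab (j # js) (Nx n) = (\<lambda>x. real (n j) * fold nab js (Nx (dn j n)) x)"
    by (simp add: fold_nab_add fold_nab_cmult r)
  show ?case
  proof (cases "n j = 0")
    case True
    then have "\<not> (\<forall>i. count_list (j # js) i = n i)" by (auto intro!: exI[of _ j])
    then show ?thesis unfolding eq using True by (simp only: if_False) simp
  next
    case False
    have "length js = total (dn j n)" using Cons.prems total_dn[of n j, OF False] by simp
    then have IH: "fold nab js (Nx (dn j n)) = (\<lambda>_. if (\<forall>i. count_list js i = dn j n i) then mfact (dn j n) else 0)"
      by (rule Cons.IH)
    have "(\<forall>i. count_list js i = dn j n i) \<longleftrightarrow> (\<forall>i. count_list (j # js) i = n i)"
      using False by (intro iff_allI) (auto simp: dn_def)
    then show ?thesis unfolding eq IH mfact_dn[of n j, OF False] by auto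
  qed
qed

lemma total_count_list: "total (count_list js) = length (js :: 'a list)"
proof (induction js)
  case (Cons j js)
  have "count_list (j # js) = (\<lambda>k. count_list js k + e_vec j k)" by (auto simp: e_vec_def)
  then have "total (count_list (j # js)) = total (\<lambda>k. count_list js k + e_vec j k)" by (simp only:)
  also have "\<dots> = total (count_list js) + 1" by (simp only: total_add total_e_vec)
  also have "\<dots> = length (j # js)" using Cons by simp
  finally show ?case .
qed (simp add: total_def)

text \<open>The top-degree part is removed by Taylor's formula: the coefficient of
  \<open>Nx n\<close> is the \<open>k\<close>-fold difference of \<open>f\<close> in the directions
  \<open>n\<close>, which is constant, divided by the factorial of \<open>n\<close>.\<close>

lemma deg_lt_span:
  "deg_lt k f \<Longrightarrow> \<exists>c. f = (\<lambda>x. \<Sum>m | total m < k. c m * Mx m x)"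
proof (induction k arbitrary: f)
  case 0
  then show ?case by auto
next
  case (Suc k)
  \<comment> \<open>A list of directions in which \<open>j\<close> occurs \<open>n j\<close> times;
    by \<open>fold_nab_count\<close> the choice does not affect the iterated difference.\<close>
  define js where "js n = (SOME js :: 'a list. \<forall>j. count_list js j = n j)" for n
  define b where "b n = fold nab (js n) f (\<lambda>_. 0) / mfact n" for n
  define g where "g x = f x - (\<Sum>n | total n = k. b n * Nx n x)" for x
  have fin: "finite {n :: 'a \<Rightarrow> nat. total n = k}"
    by (rule finite_subset[OF _ finite_total_less[of "Suc k"]]) auto
  have "fold nab ls g = (\<lambda>_. 0)" if len: "length ls = k" for ls
  proof -
    define n where "n = count_list ls"
    have n: "total n = k" using len by (simp add: n_def total_count_list)
    have "\<forall>j. count_list (js n) j = n j"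
      unfolding js_def by (rule someI[of _ ls]) (simp add: n_def)
    then have same: "fold nab (js n) f = fold nab ls f" by (intro fold_nab_count) (simp add: n_def)
    have const: "fold nab ls f x = fold nab ls f (\<lambda>_. 0)" for x
      using fold_nab_deg[of ls "Suc 0" f] Suc.prems len by (intro deg_lt_1_const) simp
    have "fold nab ls (\<lambda>x. \<Sum>n | total n = k. b n * Nx n x) x = (\<Sum>n' | total n' = k. if n' = n then b n * mfact n else 0)" for x
      unfolding fold_nab_sum fold_nab_cmult
    proof (rule sum.cong)
      fix n' assume "n' \<in> {n :: 'a \<Rightarrow> nat. total n = k}"
      then have "fold nab ls (Nx n') x = (if n' = n then mfact n else 0)"
      proof -
        have "(\<forall>j. count_list ls j = n' j) \<longleftrightarrow> n' = n" by (auto simp: n_def fun_eq_iff)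
        then show ?thesis using fold_nab_Nx[of ls n'] len \<open>n' \<in> _\<close> by simp
      qed
      then show "b n' * fold nab ls (Nx n') x = (if n' = n then b n * mfact n else 0)" by simp
    qed simp
    moreover have "(\<Sum>n' | total n' = k. if n' = n then b n * mfact n else 0) = b n * mfact n" using fin n by simp
    ultimately have "fold nab ls (\<lambda>x. \<Sum>n | total n = k. b n * Nx n x) x = fold nab ls f x" for x
      using mfact_pos[of n] const[of x] by (simp add: b_def same)
    moreover have "fold nab ls g x = fold nab ls f x + (-1) * fold nab ls (\<lambda>x. \<Sum>n | total n = k. b n * Nx n x) x" for x
    proof -
      have "g = (\<lambda>x. f x + (-1) * (\<Sum>n | total n = k. b n * Nx n x))" by (auto simp: g_def)
      then show ?thesis by (simp only: fold_nab_add fold_nab_cmult)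
    qed
    ultimately show ?thesis by auto
  qed
  then have "deg_lt k g" by (rule deg_lt_fold_nabI)
  then obtain c where c: "g = (\<lambda>x. \<Sum>m | total m < k. c m * Mx m x)" using Suc.IH by blast
  define c' where "c' m = (if total m = k then b m * (mpow sg m * mfact m) else c m)" for m
  have "f x = (\<Sum>m | total m < Suc k. c' m * Mx m x)" for x
  proof -
    have "{m :: 'a \<Rightarrow> nat. total m < Suc k} = {m. total m < k} \<union> {m. total m = k}" by auto
    then have "(\<Sum>m | total m < Suc k. c' m * Mx m x) = (\<Sum>m | total m < k. c' m * Mx m x) + (\<Sum>m | total m = k. c' m * Mx m x)"
      by (simp only:) (rule sum.union_disjoint, auto simp: fin finite_total_less)
    also have "(\<Sum>m | total m < k. c' m * Mx m x) = g x" unfolding c by (rule sum.cong) (auto simp: c'_def)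
    also have "(\<Sum>m | total m = k. c' m * Mx m x) = (\<Sum>n | total n = k. b n * Nx n x)"
      by (rule sum.cong) (auto simp: c'_def Nx_def mult_ac)
    finally show ?thesis by (simp add: g_def)
  qed
  then show ?case by blast
qed

section \<open>Polynomial moments of the joint weights\<close>

lemma expectation_of_span:
  assumes f: "f = (\<lambda>x. \<Sum>m | total m < k. c m * Mx m x)"
  shows "((\<lambda>x. P x * f x) has_sum (\<Sum>m | total m < k. c m * (if m = (\<lambda>_. 0) then 1 else 0))) UNIV"
proof -
  have "((\<lambda>x. \<Sum>m | total m < k. c m * (P x * Mx m x * Mx (\<lambda>_. 0) x)) has_sum
      (\<Sum>m | total m < k. c m * (if (\<lambda>_. 0) = m then hinv m else 0))) UNIV"
    by (intro has_sum_finite_sum has_sum_cmult_right orthogonality)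
  moreover have "(\<Sum>m | total m < k. c m * (if (\<lambda>_. 0) = m then hinv m else 0)) = (\<Sum>m | total m < k. c m * (if m = (\<lambda>_. 0) then 1 else 0))"
    by (rule sum.cong) auto
  ultimately show ?thesis
    unfolding f by (simp add: Mx_zero sum_distrib_left mult_ac)
qed

text \<open>Correlations with one index 0 are moments of a marginal, and \<open>deg_lt_span\<close>
  extends them from Meixner polynomials to all polynomials. The argument works with the joint
  weights directly, because absolute convergence of the kernel series rests on the bound for
  \<open>\<rho>\<close> that is derived from it.\<close>

lemma correlations_marginal:
  assumes corr: "lancaster_correlations \<theta> p u a z \<rho> \<alpha>" and r0: "\<rho> (\<lambda>_. 0) = 1"
    and f: "deg_lt k f" and E: "((\<lambda>x. P x * f x) has_sum E) UNIV"
  shows "((\<lambda>(x, y). lancaster \<theta> p u a z \<rho> \<alpha> x y * f x) has_sum E) UNIV"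
    and "((\<lambda>(x, y). lancaster \<theta> p u a z \<rho> \<alpha> x y * f y) has_sum E) UNIV"
proof -
  define l where "l q = (case q of (x, y) \<Rightarrow> lancaster \<theta> p u a z \<rho> \<alpha> x y)" for q
  obtain c where c: "f = (\<lambda>x. \<Sum>m | total m < k. c m * Mx m x)" using deg_lt_span[OF f] by blast
  have E': "(\<Sum>m | total m < k. c m * (if m = (\<lambda>_. 0) then 1 else 0)) = E"
    using has_sum_unique[OF expectation_of_span[OF c] E] .
  have h0: "meixner_h \<alpha> \<theta> a z (\<lambda>_. 0) = 1" by (simp add: meixner_h_eq)
  have co: "((\<lambda>q. l q * (Mx m (fst q) * Mx n (snd q))) has_sum (if m = n then \<rho> n * inverse (meixner_h \<alpha> \<theta> a z n) else 0)) UNIV" for m n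
    using corr unfolding lancaster_correlations_def l_def by (simp add: case_prod_unfold)
  have m1: "((\<lambda>q. l q * Mx m (fst q)) has_sum (if m = (\<lambda>_. 0) then 1 else 0)) UNIV" for m
    using co[of m "\<lambda>_. 0"] by (cases "m = (\<lambda>_. 0)") (simp_all add: Mx_zero r0 h0)
  have m2: "((\<lambda>q. l q * Mx m (snd q)) has_sum (if m = (\<lambda>_. 0) then 1 else 0)) UNIV" for m
    using co[of "\<lambda>_. 0" m] by (cases "m = (\<lambda>_. 0)") (simp_all add: Mx_zero r0 h0)
  have "((\<lambda>q. \<Sum>m | total m < k. c m * (l q * Mx m (fst q))) has_sum E) UNIV"
    unfolding E'[symmetric] by (intro has_sum_finite_sum has_sum_cmult_right m1)
  then show "((\<lambda>(x, y). lancaster \<theta> p u a z \<rho> \<alpha> x y * f x) has_sum E) UNIV"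
    unfolding c l_def by (simp add: case_prod_unfold sum_distrib_left mult_ac)
  have "((\<lambda>q. \<Sum>m | total m < k. c m * (l q * Mx m (snd q))) has_sum E) UNIV"
    unfolding E'[symmetric] by (intro has_sum_finite_sum has_sum_cmult_right m2)
  then show "((\<lambda>(x, y). lancaster \<theta> p u a z \<rho> \<alpha> x y * f y) has_sum E) UNIV"
    unfolding c l_def by (simp add: case_prod_unfold sum_distrib_left mult_ac)
qed

text \<open>The mixed moment \<open>\<rho> n * hinv n\<close> is bounded by the mean of the two
  marginal second moments of \<open>Mx n\<close>, both equal to \<open>hinv n\<close>. Non-negative
  weights make the pointwise inequality summable.\<close>

lemma abs_rho_le_1:
  assumes nn: "lancaster_nonneg \<theta> p u a z \<rho> \<alpha>" and corr: "lancaster_correlations \<theta> p u a z \<rho> \<alpha>"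
    and r0: "\<rho> (\<lambda>_. 0) = 1"
  shows "\<bar>\<rho> n\<bar> \<le> 1"
proof -
  define l where "l = lancaster \<theta> p u a z \<rho> \<alpha>"
  have l0: "l x y \<ge> 0" for x y using nn by (simp add: lancaster_nonneg_def l_def)
  have d: "deg_lt (Suc (total n) + Suc (total n)) (\<lambda>x. Mx n x * Mx n x)"
    by (intro deg_lt_mult deg_lt_Mx)
  have E: "((\<lambda>x. P x * (Mx n x * Mx n x)) has_sum hinv n) UNIV"
    using second_moment[of n] by (simp add: power2_eq_square)
  note mm = correlations_marginal[OF corr r0 d E, folded l_def]
  have "((\<lambda>q. (case q of (x, y) \<Rightarrow> l x y * (Mx n x * Mx n x)) + (case q of (x, y) \<Rightarrow> l x y * (Mx n y * Mx n y))) has_sum hinv n + hinv n) UNIV"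
    by (intro has_sum_add mm)
  from has_sum_cmult_right[OF this, of "1/2"]
  have hs: "((\<lambda>(x, y). 1/2 * (l x y * (Mx n x * Mx n x) + l x y * (Mx n y * Mx n y))) has_sum hinv n) UNIV"
    by (simp add: case_prod_unfold)
  have c: "((\<lambda>(x, y). l x y * (Mx n x * Mx n y)) has_sum \<rho> n * hinv n) UNIV"
    using corr unfolding lancaster_correlations_def l_def by (auto simp: meixner_h_eq dest!: spec[of _ n])
  have "\<bar>\<rho> n * hinv n\<bar> \<le> hinv n"
  proof (rule has_sum_abs_le[OF c hs], clarify)
    fix x y
    have "2 * (\<bar>Mx n x\<bar> * \<bar>Mx n y\<bar>) \<le> (Mx n x)\<^sup>2 + (Mx n y)\<^sup>2"
      using sum_squares_bound[of "\<bar>Mx n x\<bar>" "\<bar>Mx n y\<bar>"] by (simp add: mult.assoc)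
    then have "l x y * (\<bar>Mx n x\<bar> * \<bar>Mx n y\<bar>) \<le> l x y * (1/2 * ((Mx n x)\<^sup>2 + (Mx n y)\<^sup>2))"
      by (intro mult_left_mono l0) simp
    then show "\<bar>l x y * (Mx n x * Mx n y)\<bar> \<le> 1/2 * (l x y * (Mx n x * Mx n x) + l x y * (Mx n y * Mx n y))"
      using l0[of x y] by (simp add: abs_mult power2_eq_square algebra_simps)
  qed
  then show ?thesis using hinv_pos[of n] by (simp add: abs_mult)
qed

lemma lancaster_pmf:
  assumes nn: "lancaster_nonneg \<theta> p u a z \<rho> \<alpha>" and corr: "lancaster_correlations \<theta> p u a z \<rho> \<alpha>"
    and r0: "\<rho> (\<lambda>_. 0) = 1"
  shows "\<exists>J. bivariate_nb \<alpha> \<theta> p J \<and> (\<forall>x y. pmf J (x, y) = lancaster \<theta> p u a z \<rho> \<alpha> x y)"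
proof -
  define l where "l q = (case q of (x, y) \<Rightarrow> lancaster \<theta> p u a z \<rho> \<alpha> x y)" for q
  have r: "\<bar>\<rho> n\<bar> \<le> 1" for n by (rule abs_rho_le_1[OF nn corr r0])
  have l0: "l q \<ge> 0" for q using nn by (auto simp: lancaster_nonneg_def l_def split: prod.split)
  have L: "l (x, y) = P x * P y * kap \<rho> x y" for x y
    using lancaster_eq_kap[of \<rho> x y, OF lancaster_term_summable r0] r by (simp add: l_def)
  have "((\<lambda>(x, y). lancaster \<theta> p u a z \<rho> \<alpha> x y * 1) has_sum 1) UNIV"
    by (rule correlations_marginal(1)[OF corr r0, of "Suc 0" "\<lambda>_. 1"]) (use has_sum_P in auto)
  then have l1: "(l has_sum 1) UNIV" by (simp add: l_def[abs_def])
  define J where "J = embed_pmf l"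
  have J: "pmf J q = l q" for q
    unfolding J_def by (rule pmf_embed_pmf) (use l0 nn_integral_count_space_has_sum[OF l1] in auto)
  have mar: "pmf (map_pmf f J) x = S" if "(l has_sum S) (f -` {x})" for f :: "_ \<Rightarrow> 'a \<Rightarrow> nat" and x S
  proof -
    have "ennreal (pmf (map_pmf f J) x) = emeasure (measure_pmf J) (f -` {x})" by (simp add: ennreal_pmf_map)
    also have "\<dots> = (\<integral>\<^sup>+q. ennreal (l q) \<partial>count_space (f -` {x}))"
      by (simp add: nn_integral_pmf[symmetric] J)
    also have "\<dots> = ennreal S" by (rule nn_integral_count_space_has_sum[OF that]) (rule l0)
    finally show ?thesis
      using has_sum_nonneg[OF that] l0 by (simp add: pmf_nonneg)
  qed
  have m1: "(l has_sum P x) (fst -` {x})" for x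
  proof -
    have "((\<lambda>y. l (x, y)) has_sum P x) UNIV"
      using has_sum_cmult_right[OF kap_marginal[of \<rho> x, OF r r0], of "P x"] by (simp add: L mult_ac)
    moreover have "bij_betw (\<lambda>y. (x, y)) UNIV (fst -` {x})"
      by (rule bij_betwI[where g = snd]) auto
    ultimately show ?thesis by (subst has_sum_reindex_bij_betw[symmetric]) auto
  qed
  have m2: "(l has_sum P y) (snd -` {y})" for y
  proof -
    have "((\<lambda>x. l (x, y)) has_sum P y) UNIV"
      using has_sum_cmult_right[OF kap_marginal[of \<rho> y, OF r r0], of "P y"] by (simp add: L kap_sym[of \<rho> _ y] mult_ac)
    moreover have "bij_betw (\<lambda>x. (x, y)) UNIV (snd -` {y})"
      by (rule bij_betwI[where g = fst]) auto
    ultimately show ?thesis by (subst has_sum_reindex_bij_betw[symmetric]) auto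
  qed
  have "bivariate_nb \<alpha> \<theta> p J"
    unfolding bivariate_nb_def using mar[OF m1] mar[OF m2] by blast
  then show ?thesis using J by (intro exI[of _ J]) (auto simp: l_def)
qed

end

section \<open>A compactness theorem for measures on a cube\<close>

definition binary_digit :: "real \<Rightarrow> nat \<Rightarrow> int" where
  "binary_digit y k = \<lfloor>2 ^ Suc k * y\<rfloor> - 2 * \<lfloor>2 ^ k * y\<rfloor>"

lemma binary_digit_cases: "binary_digit y k = 0 \<or> binary_digit y k = 1"
proof -
  have "2 * \<lfloor>2 ^ k * y\<rfloor> \<le> \<lfloor>2 ^ Suc k * y\<rfloor>" by (simp add: le_floor_iff)
  moreover have "\<lfloor>2 ^ Suc k * y\<rfloor> < 2 * \<lfloor>2 ^ k * y\<rfloor> + 2"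
  proof -
    have "2 ^ k * y < real_of_int \<lfloor>2 ^ k * y\<rfloor> + 1" by linarith
    then have "2 ^ Suc k * y < 2 * real_of_int \<lfloor>2 ^ k * y\<rfloor> + 2" by (simp only: power_Suc mult.assoc)
    then show ?thesis by (simp add: floor_less_iff)
  qed
  ultimately show ?thesis unfolding binary_digit_def by linarith
qed

lemma binary_expansion:
  assumes "0 \<le> y" "y < 1"
  shows "(\<lambda>k. real_of_int (binary_digit y k) / 2 ^ Suc k) sums y"
proof -
  have partial: "(\<Sum>k<n. real_of_int (binary_digit y k) / 2 ^ Suc k) = real_of_int \<lfloor>2 ^ n * y\<rfloor> / 2 ^ n" for n
  proof (induction n)
    case 0
    have "\<lfloor>y\<rfloor> = 0" using assms by (simp add: floor_eq_iff)
    then show ?case by simp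
  next
    case (Suc n)
    then show ?case by (simp add: binary_digit_def field_simps)
  qed
  have "(\<lambda>n. real_of_int \<lfloor>2 ^ n * y\<rfloor> / 2 ^ n) \<longlonglongrightarrow> y"
  proof (rule tendsto_sandwich[where f = "\<lambda>n. y - (1/2) ^ n" and h = "\<lambda>_. y"])
    have "y - (1/2) ^ n \<le> real_of_int \<lfloor>2 ^ n * y\<rfloor> / 2 ^ n" for n
    proof -
      have "2 ^ n * y - 1 \<le> real_of_int \<lfloor>2 ^ n * y\<rfloor>" by linarith
      then have "(2 ^ n * y - 1) / 2 ^ n \<le> real_of_int \<lfloor>2 ^ n * y\<rfloor> / 2 ^ n" by (rule divide_right_mono) simp
      then show ?thesis by (simp add: diff_divide_distrib power_one_over)
    qed
    then show "\<forall>\<^sub>F n in sequentially. y - (1/2) ^ n \<le> real_of_int \<lfloor>2 ^ n * y\<rfloor> / 2 ^ n" by simp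
    have "real_of_int \<lfloor>2 ^ n * y\<rfloor> / 2 ^ n \<le> (2 ^ n * y) / 2 ^ n" for n
      by (intro divide_right_mono) auto
    then show "\<forall>\<^sub>F n in sequentially. real_of_int \<lfloor>2 ^ n * y\<rfloor> / 2 ^ n \<le> y" by simp
    have "(\<lambda>n. y - (1/2) ^ n) \<longlonglongrightarrow> y - 0" by (intro tendsto_intros LIMSEQ_power_zero) simp
    then show "(\<lambda>n. y - (1/2) ^ n) \<longlonglongrightarrow> y" by simp
  qed simp
  then show ?thesis unfolding sums_def partial .
qed

text \<open>Schoenberg's function: it reads off the leading ternary digit of a number all of whose
  ternary digits are \<open>0\<close> or \<open>2\<close>, and \<open>3\<^sup>m\<close> shifts the digits.\<close>

definition schoenberg :: "real \<Rightarrow> real" where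
  "schoenberg t = max 0 (min 1 (1/2 - cos (pi * t)))"

lemma schoenberg_bounds: "0 \<le> schoenberg t" "schoenberg t \<le> 1"
  by (auto simp: schoenberg_def)

lemma continuous_schoenberg: "continuous_on UNIV schoenberg"
  unfolding schoenberg_def by (intro continuous_intros)

lemma schoenberg_periodic: "schoenberg (2 * of_int k + t) = schoenberg t"
proof -
  have "cos (pi * (2 * of_int k + t)) = cos (pi * t + 2 * pi * of_int k)" by (simp add: algebra_simps)
  also have "\<dots> = cos (pi * t)" by (simp add: cos_add sin_integer_2pi cos_integer_2pi)
  finally show ?thesis by (simp add: schoenberg_def)
qed

lemma schoenberg_low: "0 \<le> t \<Longrightarrow> t \<le> 1/3 \<Longrightarrow> schoenberg t = 0"
proof -
  assume t: "0 \<le> t" "t \<le> 1/3"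
  have "cos (pi / 3) \<le> cos (pi * t)"
    using t pi_gt_zero by (intro cos_monotone_0_pi_le) (auto simp: field_simps)
  then show ?thesis by (simp add: schoenberg_def cos_60)
qed

lemma schoenberg_high: "2/3 \<le> t \<Longrightarrow> t \<le> 1 \<Longrightarrow> schoenberg t = 1"
proof -
  assume t: "2/3 \<le> t" "t \<le> 1"
  have "cos (pi * t) \<le> cos (pi * (2/3))"
    using t pi_gt_zero by (intro cos_monotone_0_pi_le) (auto simp: field_simps)
  moreover have "cos (pi * (2/3)) = - (1/2)" using cos_120 by (simp add: mult.commute)
  ultimately show ?thesis by (simp add: schoenberg_def)
qed

text \<open>The number in [0, 1] with ternary digits \<open>2 * b m\<close>,
  \<open>2 * b (m + 1)\<close> and so on, a point of the Cantor set for binary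
  \<open>b\<close>.\<close>

definition ternary :: "(nat \<Rightarrow> real) \<Rightarrow> nat \<Rightarrow> real" where
  "ternary b m = suminf (\<lambda>j. 2 * b (m + j) / 3 ^ Suc j)"

lemma ternary_props:
  assumes b: "\<And>m. b m = 0 \<or> b m = 1"
  shows "0 \<le> ternary b m" "ternary b m \<le> 1" "ternary b m = 2 * b m / 3 + ternary b (Suc m) / 3"
proof -
  have geo: "(\<lambda>j. 2 / 3 ^ Suc j :: real) sums 1"
    using sums_mult[OF geometric_sums[of "1/3 :: real"], of "2/3"] by (simp add: power_one_over divide_simps)
  have nn: "0 \<le> 2 * b (m + j) / 3 ^ Suc j" for m j using b[of "m + j"] by auto
  have le: "2 * b (m + j) / 3 ^ Suc j \<le> 2 / 3 ^ Suc j" for m j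
    using b[of "m + j"] by (intro divide_right_mono) auto
  have sm: "summable (\<lambda>j. 2 * b (m + j) / 3 ^ Suc j)" for m
  proof (rule summable_comparison_test'[OF sums_summable[OF geo], of 0])
    show "norm (2 * b (m + j) / 3 ^ Suc j) \<le> 2 / 3 ^ Suc j" for j
      unfolding real_norm_def abs_of_nonneg[OF nn] by (rule le)
  qed
  show "0 \<le> ternary b m" unfolding ternary_def by (rule suminf_nonneg[OF sm nn])
  show "ternary b m \<le> 1"
    unfolding ternary_def sums_unique[OF geo] by (rule suminf_le[OF le sm sums_summable[OF geo]])
  have "ternary b m = 2 * b (m + 0) / 3 ^ Suc 0 + suminf (\<lambda>j. 2 * b (m + Suc j) / 3 ^ Suc (Suc j))"
    unfolding ternary_def using suminf_split_head[OF sm[of m]] by simp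
  also have "suminf (\<lambda>j. 2 * b (m + Suc j) / 3 ^ Suc (Suc j)) = suminf (\<lambda>j. 2 * b (Suc m + j) / 3 ^ Suc j / 3)"
    by (simp add: mult.commute)
  also have "\<dots> = ternary b (Suc m) / 3" unfolding ternary_def by (rule suminf_divide[OF sm])
  finally show "ternary b m = 2 * b m / 3 + ternary b (Suc m) / 3" by simp
qed

text \<open>Multiplication by 3 moves a digit 0 or 2 in front of the point, so the integral part
  stays even and disappears by periodicity. What is left is decided by the leading digit.\<close>

lemma schoenberg_ternary:
  assumes b: "\<And>m. b m = 0 \<or> b m = 1"
  shows "schoenberg (3 ^ m * ternary b 0) = b m"
proof -
  have "\<exists>K. 3 ^ m * ternary b 0 = 2 * of_int K + ternary b m"
  proof (induction m)
    case 0
    then show ?case by (intro exI[of _ 0]) simp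
  next
    case (Suc m)
    then obtain K where K: "3 ^ m * ternary b 0 = 2 * of_int K + ternary b m" by blast
    have "3 ^ Suc m * ternary b 0 = 3 * (2 * of_int K + ternary b m)" using K by simp
    also have "\<dots> = 2 * (3 * of_int K + b m) + ternary b (Suc m)"
      using ternary_props(3)[of b m, OF b] by simp
    also have "3 * of_int K + b m = of_int (3 * K + (if b m = 0 then 0 else 1))" using b[of m] by auto
    finally show ?case by blast
  qed
  then obtain K where K: "3 ^ m * ternary b 0 = 2 * of_int K + ternary b m" by blast
  have "schoenberg (ternary b m) = b m"
    using b[of m]
  proof
    assume "b m = 0"
    then show ?thesis using ternary_props[of b m, OF b] ternary_props(1,2)[of b "Suc m", OF b] by (simp add: schoenberg_low)
  next
    assume "b m = 1"
    then show ?thesis using ternary_props[of b m, OF b] ternary_props(1,2)[of b "Suc m", OF b] by (simp add: schoenberg_high)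
  qed
  then show ?thesis unfolding K schoenberg_periodic .
qed

text \<open>A space-filling curve: the injection \<open>to_nat\<close> assigns to every coordinate its own ternary digits.\<close>

definition curve :: "real \<Rightarrow> real^'d::finite" where
  "curve t = (\<chi> i. 2 * suminf (\<lambda>k. schoenberg (3 ^ to_nat (i, k) * t) / 2 ^ Suc k))"

lemma geometric_half: "(\<lambda>k. 1 / 2 ^ Suc k :: real) sums 1"
  using power_half_series by (simp add: power_one_over)

lemma curve_bounds: "0 \<le> curve t $ i" "curve t $ i \<le> 2"
proof -
  define f where "f k = schoenberg (3 ^ to_nat (i, k) * t) / 2 ^ Suc k" for k
  have f: "0 \<le> f k" "f k \<le> 1 / 2 ^ Suc k" for k
    using schoenberg_bounds by (auto simp: f_def divide_right_mono simp del: power_Suc)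
  have sm: "summable f"
    by (rule summable_comparison_test'[OF sums_summable[OF geometric_half], of 0]) (use f in auto)
  have "0 \<le> suminf f" by (rule suminf_nonneg[OF sm f(1)])
  moreover have "suminf f \<le> 1"
    using suminf_le[OF f(2) sm sums_summable[OF geometric_half]] sums_unique[OF geometric_half] by simp
  moreover have "curve t $ i = 2 * suminf f" by (simp add: curve_def f_def[abs_def])
  ultimately show "0 \<le> curve t $ i" "curve t $ i \<le> 2" by auto
qed

lemma continuous_curve: "continuous_on UNIV (curve :: real \<Rightarrow> real^'d::finite)"
proof -
  have "continuous_on UNIV (\<lambda>t. suminf (\<lambda>k. schoenberg (3 ^ to_nat (i, k) * t) / 2 ^ Suc k))" for i :: 'd
  proof (rule uniform_limit_theorem)
    show "uniform_limit UNIV (\<lambda>n t. \<Sum>k<n. schoenberg (3 ^ to_nat (i, k) * t) / 2 ^ Suc k)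
        (\<lambda>t. suminf (\<lambda>k. schoenberg (3 ^ to_nat (i, k) * t) / 2 ^ Suc k)) sequentially"
      by (rule Weierstrass_m_test[OF _ sums_summable[OF geometric_half]])
         (use schoenberg_bounds in \<open>auto simp: divide_right_mono simp del: power_Suc\<close>)
    have "continuous_on UNIV (\<lambda>t. schoenberg (c * t))" for c
      by (rule continuous_on_compose2[OF continuous_schoenberg]) (auto intro!: continuous_intros)
    then show "\<forall>\<^sub>F n in sequentially. continuous_on UNIV (\<lambda>t. \<Sum>k<n. schoenberg (3 ^ to_nat (i, k) * t) / 2 ^ Suc k)"
      by (intro always_eventually allI continuous_on_sum continuous_on_divide continuous_on_const) auto
  qed simp
  then show ?thesis
    unfolding curve_def by (intro continuous_on_vec_lambda continuous_on_mult continuous_on_const)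
qed

lemma curve_surj:
  fixes v :: "real^'d::finite"
  assumes "\<And>i. 0 \<le> v $ i" "\<And>i. v $ i < 2"
  obtains t where "0 \<le> t" "t \<le> 1" "curve t = v"
proof -
  \<comment> \<open>Position \<open>to_nat (i, k)\<close> of the ternary number carries the binary
    digit \<open>k\<close> of coordinate \<open>i\<close>; the coordinates are halved because binary
    expansions are taken in [0, 1).\<close>
  define b where "b m = (case from_nat m of (i :: 'd, k) \<Rightarrow> real_of_int (binary_digit (v $ i / 2) k))" for m
  have b: "b m = 0 \<or> b m = 1" for m
    using binary_digit_cases by (auto simp: b_def split: prod.split)
  have "curve (ternary b 0) $ i = v $ i" for i
  proof -
    have "schoenberg (3 ^ to_nat (i, k) * ternary b 0) = real_of_int (binary_digit (v $ i / 2) k)" for k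
      by (simp add: schoenberg_ternary[of b, OF b] b_def)
    moreover have "suminf (\<lambda>k. real_of_int (binary_digit (v $ i / 2) k) / 2 ^ Suc k) = v $ i / 2"
      using assms[of i] by (intro sums_unique[symmetric] binary_expansion) auto
    ultimately show ?thesis by (simp add: curve_def)
  qed
  then have "curve (ternary b 0) = v" by (simp add: vec_eq_iff)
  then show ?thesis using that ternary_props(1,2)[of b 0, OF b] by blast
qed

text \<open>The points are lifted along the curve to parameters in [0, 1], a weak limit is extracted
  on the line, and it is pushed forward by the curve. Continuity of the curve turns continuous test
  functions on the cube into continuous ones on the line.\<close>

lemma cube_compactness:
  fixes \<mu> :: "nat \<Rightarrow> 'b pmf" and v :: "nat \<Rightarrow> 'b \<Rightarrow> real^'d::finite"
  assumes v: "\<And>N x i. 0 \<le> v N x $ i" "\<And>N x i. v N x $ i < 2"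
  obtains \<nu> :: "(real^'d) measure" and r :: "nat \<Rightarrow> nat" where
    "prob_space \<nu>" "sets \<nu> = sets borel" "strict_mono r"
    "AE x in \<nu>. \<forall>i. 0 \<le> x $ i \<and> x $ i \<le> 2"
    "\<forall>f :: real^'d \<Rightarrow> real. continuous_on UNIV f \<longrightarrow>
      (\<lambda>k. measure_pmf.expectation (\<mu> (r k)) (\<lambda>x. f (v (r k) x))) \<longlonglongrightarrow> (\<integral>x. f x \<partial>\<nu>)"
proof -
  have "\<exists>t. 0 \<le> t \<and> t \<le> 1 \<and> curve t = v N x" for N x
    using curve_surj[of "v N x"] v by metis
  then obtain t where t: "\<And>N x. 0 \<le> t N x" "\<And>N x. t N x \<le> 1" "\<And>N x. curve (t N x) = v N x" by metis
  define D where "D N = distr (measure_pmf (\<mu> N)) borel (t N)" for N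
  have tm: "t N \<in> measurable (measure_pmf (\<mu> N)) borel" for N by simp
  have rd: "real_distribution (D N)" for N
    unfolding D_def real_distribution_def real_distribution_axioms_def
    by (auto intro: prob_space.prob_space_distr measure_pmf.prob_space_axioms)
  \<comment> \<open>Tightness is expressed with half-open intervals; the left end -1 makes room for
    the parameter 0.\<close>
  have m1: "measure (D N) {-1<..1} = 1" for N
  proof -
    have "measure (D N) {-1<..1} = measure (measure_pmf (\<mu> N)) (t N -` {-1<..1} \<inter> space (measure_pmf (\<mu> N)))"
      unfolding D_def by (rule measure_distr) auto
    also have "t N -` {-1<..1} \<inter> space (measure_pmf (\<mu> N)) = UNIV"
    proof -
      have "-1 < t N x" for x using t(1)[of N x] by linarith
      then show ?thesis using t(2) by auto
    qed
    finally show ?thesis by simp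
  qed
  have "tight D"
    unfolding tight_def
  proof (intro conjI allI impI rd)
    fix \<epsilon> :: real assume "\<epsilon> > 0"
    then have "-1 < (1 :: real) \<and> (\<forall>N. 1 - \<epsilon> < measure (D N) {-1<..1})" by (simp add: m1)
    then show "\<exists>a b. a < b \<and> (\<forall>n. 1 - \<epsilon> < measure (D n) {a<..b})" by blast
  qed
  then obtain r M where r: "strict_mono (r :: nat \<Rightarrow> nat)" and M: "real_distribution M" and w: "weak_conv_m (D \<circ> id \<circ> r) M"
    using tight_imp_convergent_subsubsequence[of D id] by (auto simp: strict_mono_def)
  interpret M: real_distribution M by fact
  define \<nu> where "\<nu> = distr M borel (curve :: real \<Rightarrow> real^'d)"
  have cm: "(curve :: real \<Rightarrow> real^'d) \<in> borel_measurable borel"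
    by (rule borel_measurable_continuous_onI[OF continuous_curve])
  have cmM: "(curve :: real \<Rightarrow> real^'d) \<in> borel_measurable M" using cm by simp
  show ?thesis
  proof (rule that[of \<nu> r])
    show "prob_space \<nu>" unfolding \<nu>_def by (rule M.prob_space_distr[OF cmM])
    show "sets \<nu> = sets borel" by (simp add: \<nu>_def)
    show "strict_mono r" by fact
    have "AE s in M. \<forall>i. 0 \<le> (curve s :: real^'d) $ i \<and> (curve s :: real^'d) $ i \<le> 2"
      by (intro AE_I2 allI conjI curve_bounds)
    then show "AE x in \<nu>. \<forall>i. 0 \<le> x $ i \<and> x $ i \<le> 2"
      unfolding \<nu>_def
    proof (subst AE_distr_iff[OF cmM])
      have "closed {x :: real^'d. \<forall>i. 0 \<le> x $ i \<and> x $ i \<le> 2}"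
        by (intro closed_Collect_all closed_Collect_conj closed_Collect_le continuous_intros)
      then show "{x \<in> space borel. \<forall>i. 0 \<le> (x :: real^'d) $ i \<and> x $ i \<le> 2} \<in> sets borel" by simp
    qed
    show "\<forall>f :: real^'d \<Rightarrow> real. continuous_on UNIV f \<longrightarrow>
      (\<lambda>k. measure_pmf.expectation (\<mu> (r k)) (\<lambda>x. f (v (r k) x))) \<longlonglongrightarrow> (\<integral>x. f x \<partial>\<nu>)"
    proof (intro allI impI)
      fix f :: "real^'d \<Rightarrow> real" assume f: "continuous_on UNIV f"
      have fm: "f \<in> borel_measurable borel" by (rule borel_measurable_continuous_onI[OF f])
      have fc: "continuous_on UNIV (\<lambda>s. f (curve s))"
        by (rule continuous_on_compose2[OF f continuous_curve]) auto
      \<comment> \<open>The test function \<open>f\<close> may be unbounded, but weak convergence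
        asks for boundedness only of its composition with the curve, which stays in the
        cube.\<close>
      have "compact (cbox 0 (\<chi> i. 2) :: (real^'d) set)" by (rule compact_cbox)
      then have "bounded (f ` cbox 0 (\<chi> i. 2))"
        by (intro compact_imp_bounded compact_continuous_image continuous_on_subset[OF f]) auto
      then obtain B where B: "\<And>x. x \<in> cbox 0 (\<chi> i. 2) \<Longrightarrow> norm (f x) \<le> B"
        unfolding bounded_iff by auto
      have fb: "norm (f (curve s)) \<le> B" for s
        by (rule B) (auto simp: mem_box_cart curve_bounds)
      have "(\<lambda>n. integral\<^sup>L ((D \<circ> id \<circ> r) n) (\<lambda>s. f (curve s))) \<longlonglongrightarrow> integral\<^sup>L M (\<lambda>s. f (curve s))"
      proof (rule weak_conv_imp_integral_bdd_continuous_conv[OF _ M w])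
        show "real_distribution ((D \<circ> id \<circ> r) n)" for n by (simp add: rd)
        show "isCont (\<lambda>s. f (curve s)) s" for s
          using fc by (simp add: continuous_on_eq_continuous_at)
      qed (rule fb)
      moreover have "integral\<^sup>L (D N) (\<lambda>s. f (curve s)) = measure_pmf.expectation (\<mu> N) (\<lambda>x. f (v N x))" for N
        unfolding D_def by (subst integral_distr) (auto simp: t intro!: measurable_compose[OF cm fm])
      moreover have "integral\<^sup>L M (\<lambda>s. f (curve s)) = (\<integral>x. f x \<partial>\<nu>)"
        unfolding \<nu>_def by (rule integral_distr[symmetric, OF cmM fm])
      ultimately show "(\<lambda>k. measure_pmf.expectation (\<mu> (r k)) (\<lambda>x. f (v (r k) x))) \<longlonglongrightarrow> (\<integral>x. f x \<partial>\<nu>)"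
        by simp
    qed
  qed
qed

section \<open>The representing measure\<close>

lemma power_ratio_tendsto_0:
  assumes "m < n"
  shows "(\<lambda>N. (1 + real (Suc N)) ^ m / real (Suc N) ^ n) \<longlonglongrightarrow> 0"
proof -
  have "(\<lambda>N. (1 + 1 / real (Suc N)) ^ m * (1 / real (Suc N)) ^ (n - m)) \<longlonglongrightarrow> (1 + 0) ^ m * 0 ^ (n - m)"
    using LIMSEQ_Suc[OF lim_1_over_n[where 'a = real]] by (intro tendsto_intros) auto
  moreover have "(1 + 1 / real (Suc N)) ^ m * (1 / real (Suc N)) ^ (n - m) = (1 + real (Suc N)) ^ m / real (Suc N) ^ n" for N
  proof -
    have "real (Suc N) ^ n = real (Suc N) ^ m * real (Suc N) ^ (n - m)"
      using assms by (simp flip: power_add)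
    moreover have "1 + 1 / real (Suc N) = (1 + real (Suc N)) / real (Suc N)" by (simp add: field_simps)
    ultimately show ?thesis by (simp add: power_divide del: of_nat_Suc)
  qed
  moreover have "(0 :: real) ^ (n - m) = 0" using assms by simp
  ultimately show ?thesis by (simp del: of_nat_Suc)
qed

lemma continuous_on_mpow_rho: "continuous_on UNIV (\<lambda>x :: real^'d::finite. mpow (\<lambda>j. rho_lin u j x) n)"
  unfolding mpow_def rho_lin_def by (intro continuous_intros)

lemma expectation_has_sum:
  assumes "\<And>x. pmf \<mu> x = q x" "((\<lambda>x. q x * f x) has_sum S) UNIV"
  shows "measure_pmf.expectation \<mu> f = (S :: real)"
proof -
  have s: "(\<lambda>x. q x * f x) summable_on UNIV" using assms(2) by (rule has_sum_imp_summable)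
  have "measure_pmf.expectation \<mu> f = infsetsum (\<lambda>x. q x * f x) UNIV"
    by (simp add: pmf_expectation_eq_infsetsum assms(1))
  also have "\<dots> = infsum (\<lambda>x. q x * f x) UNIV"
    by (rule infsetsum_infsum) (use s in \<open>simp add: abs_summable_equivalent[symmetric] summable_on_abs_real\<close>)
  finally show ?thesis using assms(2) by (simp add: infsumI)
qed

definition axis_index :: "'d \<Rightarrow> nat \<Rightarrow> 'd \<Rightarrow> nat" where
  "axis_index j k = (\<lambda>i. if i = j then k else 0)"

lemma mpow_axis_index: "mpow w (axis_index j k) = w j ^ k"
proof -
  have "mpow w (axis_index j k) = (\<Prod>i\<in>UNIV. if i = j then w j ^ k else 1)"
    unfolding mpow_def axis_index_def by (rule prod.cong) auto
  then show ?thesis by simp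
qed

lemma total_axis_index: "total (axis_index j k :: 'd::finite \<Rightarrow> nat) = k"
  by (simp add: total_def axis_index_def)

section \<open>Moments of the conditional laws and of their truncations\<close>

context meixner_system
begin

lemma rl_axis_index: "rl j (axis_index e N) = real N"
proof -
  have "rl j (axis_index e N) = (\<Sum>i\<in>UNIV. if i = e then real N else 0)"
    unfolding rl_def axis_index_def by (rule sum.cong) auto
  then show ?thesis by simp
qed

lemma rpow_axis_index: "rpow n (axis_index e N) = real N ^ total n"
  by (simp add: rpow_def rl_axis_index mpow_const)

lemma abs_rl_le: "\<bar>rl j x\<bar> \<le> real (total x)"
proof -
  have "\<bar>rl j x\<bar> \<le> (\<Sum>i\<in>UNIV. \<bar>(u j $ i) * real (x i)\<bar>)" unfolding rl_def by (rule sum_abs)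
  also have "\<dots> \<le> (\<Sum>i\<in>UNIV. 1 * real (x i))"
    by (rule sum_mono) (simp add: abs_mult mult_left_le_one_le abs_u_le_1)
  finally show ?thesis by (simp add: total_def)
qed

lemma abs_rpow_le: "\<bar>rpow n x\<bar> \<le> real (total x) ^ total n"
  unfolding rpow_def abs_mpow mpow_const[symmetric] by (intro mpow_mono abs_rl_le) auto

text \<open>The conditional law of \<open>X\<close> when \<open>Y\<close> puts \<open>Suc N\<close>
  individuals at the normalisation point; \<open>Suc\<close> keeps the later divisor
  positive.\<close>

definition cq :: "(('a \<Rightarrow> nat) \<Rightarrow> real) \<Rightarrow> nat \<Rightarrow> ('a \<Rightarrow> nat) \<Rightarrow> real" where
  "cq \<rho> N x = P x * kap \<rho> x (axis_index e (Suc N))"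

text \<open>In the expansion of \<open>rpow n\<close> into Meixner polynomials only the leading term, which conditioning
  multiplies by \<open>\<rho> n\<close>, survives the division by \<open>N ^ total n\<close>.\<close>

lemma conditional_moments:
  assumes r: "\<And>n. \<bar>\<rho> n\<bar> \<le> 1"
  obtains E where "\<And>N. ((\<lambda>x. cq \<rho> N x * rpow n x) has_sum E N) UNIV"
    "(\<lambda>N. E N / real (Suc N) ^ total n) \<longlonglongrightarrow> \<rho> n"
proof -
  define y where "y N = axis_index e (Suc N)" for N
  define s where "s = mpow sg n * mfact n"
  define S where "S = {m :: 'a \<Rightarrow> nat. total m < total n}"
  obtain c where c: "(\<lambda>x. rpow n x - Nx n x) = (\<lambda>x. \<Sum>m\<in>S. c m * Mx m x)"
    using deg_lt_span[OF rpow_minus_Nx[of n]] unfolding S_def by blast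
  have exp: "rpow n x = s * Mx n x + (\<Sum>m\<in>S. c m * Mx m x)" for x
    using fun_cong[OF c, of x] by (simp add: Nx_def s_def)
  have M: "((\<lambda>x. cq \<rho> N x * Mx m x) has_sum \<rho> m * Mx m (y N)) UNIV" for m N
    using kap_Mx_moment[of \<rho> m "y N", OF r] by (simp add: cq_def y_def kap_sym[of \<rho> "axis_index e (Suc N)"] mult_ac)
  define E where "E N = s * (\<rho> n * Mx n (y N)) + (\<Sum>m\<in>S. c m * (\<rho> m * Mx m (y N)))" for N
  have "((\<lambda>x. s * (cq \<rho> N x * Mx n x) + (\<Sum>m\<in>S. c m * (cq \<rho> N x * Mx m x))) has_sum E N) UNIV" for N
    unfolding E_def by (intro has_sum_add has_sum_finite_sum has_sum_cmult_right M)
  then have 1: "((\<lambda>x. cq \<rho> N x * rpow n x) has_sum E N) UNIV" for N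
    by (simp add: exp distrib_left sum_distrib_left mult_ac)
  have diff: "E N / real (Suc N) ^ total n = \<rho> n + (\<Sum>m\<in>S. c m * (\<rho> m - \<rho> n) * (Mx m (y N) / real (Suc N) ^ total n))" for N
  proof -
    \<comment> \<open>The same expansion evaluated at the conditioning state has the left-hand side
      \<open>real (Suc N) ^ total n\<close>; subtracting \<open>\<rho> n\<close> times it from
      \<open>E N\<close> eliminates the leading term.\<close>
    have y: "real (Suc N) ^ total n = s * Mx n (y N) + (\<Sum>m\<in>S. c m * Mx m (y N))"
      using exp[of "y N"] by (simp only: y_def rpow_axis_index)
    have "E N = \<rho> n * real (Suc N) ^ total n + (\<Sum>m\<in>S. c m * (\<rho> m - \<rho> n) * Mx m (y N))"
      unfolding y E_def by (simp add: algebra_simps sum_subtractf sum_distrib_left)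
    then have "E N / real (Suc N) ^ total n = (\<rho> n * real (Suc N) ^ total n) / real (Suc N) ^ total n
        + (\<Sum>m\<in>S. c m * (\<rho> m - \<rho> n) * Mx m (y N)) / real (Suc N) ^ total n"
      by (simp only: add_divide_distrib)
    then show ?thesis by (simp add: sum_divide_distrib)
  qed
  have "(\<lambda>N. \<rho> n + (\<Sum>m\<in>S. c m * (\<rho> m - \<rho> n) * (Mx m (y N) / real (Suc N) ^ total n))) \<longlonglongrightarrow>
      \<rho> n + (\<Sum>m\<in>S. c m * (\<rho> m - \<rho> n) * 0)"
  proof (intro tendsto_intros)
    fix m assume "m \<in> S"
    then have m: "total m < total n" by (simp add: S_def)
    obtain C where C: "C \<ge> 0" "\<And>x. \<bar>Mx m x\<bar> \<le> C * (1 + real (total x)) ^ total m"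
      using deg_lt_growth[OF deg_lt_Mx[of m]] by blast
    show "(\<lambda>N. Mx m (y N) / real (Suc N) ^ total n) \<longlonglongrightarrow> 0"
    proof (rule Lim_null_comparison)
      have "norm (Mx m (y N) / real (Suc N) ^ total n) \<le> C * ((1 + real (Suc N)) ^ total m / real (Suc N) ^ total n)" for N
        using C(2)[of "y N"] by (simp add: y_def total_axis_index divide_right_mono abs_divide del: of_nat_Suc)
      then show "\<forall>\<^sub>F N in sequentially. norm (Mx m (y N) / real (Suc N) ^ total n) \<le> C * ((1 + real (Suc N)) ^ total m / real (Suc N) ^ total n)"
        by simp
      show "(\<lambda>N. C * ((1 + real (Suc N)) ^ total m / real (Suc N) ^ total n)) \<longlonglongrightarrow> 0"
        using tendsto_mult_left[OF power_ratio_tendsto_0[OF m], of C] by simp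
    qed
  qed
  then have 2: "(\<lambda>N. E N / real (Suc N) ^ total n) \<longlonglongrightarrow> \<rho> n" unfolding diff by simp
  show ?thesis by (rule that[OF 1 2])
qed

text \<open>The cut at total mass 2 keeps the coordinates inside the cube of
  \<open>cube_compactness\<close>. Any threshold above 1 makes the discarded moments geometrically
  small.\<close>

definition trunc :: "nat \<Rightarrow> ('a \<Rightarrow> nat) \<Rightarrow> real^'a" where
  "trunc N x = (\<chi> i. if total x < 2 * Suc N then real (x i) / real (Suc N) else 0)"

lemma trunc_bounds: "0 \<le> trunc N x $ i" "trunc N x $ i < 2"
proof -
  show "0 \<le> trunc N x $ i" by (simp add: trunc_def)
  show "trunc N x $ i < 2"
  proof (cases "total x < 2 * Suc N")
    case True
    then have "x i < 2 * Suc N" using component_le_total[of x i] by linarith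
    then have "real (x i) < 2 * real (Suc N)" by linarith
    then show ?thesis using True by (simp add: trunc_def pos_divide_less_eq del: of_nat_Suc)
  qed (simp add: trunc_def)
qed

text \<open>Where the cut applies, the scaled mass \<open>R\<close> is at least 2, so a power of
  order \<open>total n\<close> is at most 2^(-k) times the one of order \<open>total n + k\<close>.
  The right-hand side is a moment again, since \<open>rl z\<close> is the total.\<close>

lemma trunc_error:
  "\<bar>mpow (\<lambda>j. rho_lin u j (trunc N x)) n - rpow n x / real (Suc N) ^ total n\<bar>
    \<le> (1/2) ^ k * (rpow (axis_index z (total n + k)) x / real (Suc N) ^ (total n + k))"
proof -
  define R where "R = real (total x) / real (Suc N)"
  have R: "rpow (axis_index z K) x / real (Suc N) ^ K = R ^ K" for K
    by (simp add: rpow_def mpow_axis_index rl_z R_def power_divide)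
  have R0: "R \<ge> 0" by (simp add: R_def)
  show ?thesis
  proof (cases "total x < 2 * Suc N")
    case True
    have "rho_lin u j (trunc N x) = rl j x * inverse (real (Suc N))" for j
      using True by (simp add: rho_lin_def trunc_def rl_def sum_distrib_left divide_inverse mult_ac)
    then have "mpow (\<lambda>j. rho_lin u j (trunc N x)) n = rpow n x / real (Suc N) ^ total n"
      by (simp add: mpow_mult mpow_const rpow_def power_inverse divide_inverse del: of_nat_Suc)
    then show ?thesis unfolding R using R0 by simp
  next
    case False
    then have "real (2 * Suc N) \<le> real (total x)" by (simp only: of_nat_le_iff not_less)
    then have "2 * real (Suc N) \<le> real (total x)" by (simp only: of_nat_mult of_nat_numeral)
    then have R2: "R \<ge> 2" unfolding R_def by (subst pos_le_divide_eq) auto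
    have rho0: "rho_lin u j (trunc N x) = 0" for j
      using False by (simp add: rho_lin_def trunc_def)
    have "\<bar>mpow (\<lambda>j. rho_lin u j (trunc N x)) n - rpow n x / real (Suc N) ^ total n\<bar> \<le> R ^ total n"
    proof (cases "total n = 0")
      case True
      then have "n = (\<lambda>_. 0)" by (simp add: total_eq_0_iff)
      then show ?thesis by (simp add: rpow_def)
    next
      case False
      then have "mpow (\<lambda>j. rho_lin u j (trunc N x)) n = 0" by (simp add: rho0 mpow_const)
      moreover have "\<bar>rpow n x\<bar> / real (Suc N) ^ total n \<le> real (total x) ^ total n / real (Suc N) ^ total n"
        by (intro divide_right_mono abs_rpow_le) simp
      ultimately show ?thesis by (simp add: R_def power_divide)
    qed
    also have "\<dots> = (1/2) ^ k * (R ^ total n * 2 ^ k)" by (simp add: power_one_over)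
    also have "\<dots> \<le> (1/2) ^ k * (R ^ total n * R ^ k)"
      using R2 R0 by (intro mult_left_mono power_mono) auto
    finally show ?thesis unfolding R by (simp add: power_add)
  qed
qed

text \<open>The truncation error is at most 2^(-k) times a moment of order
  \<open>total n + k\<close>, whose limit is at most 1 in modulus. Choosing \<open>k\<close> first
  and then \<open>N\<close> makes the error vanish.\<close>

lemma trunc_moments:
  assumes r: "\<And>n. \<bar>\<rho> n\<bar> \<le> 1" and r0: "\<rho> (\<lambda>_. 0) = 1" and nn: "\<And>x y. kap \<rho> x y \<ge> 0"
  obtains E where "\<And>N. ((\<lambda>x. cq \<rho> N x * mpow (\<lambda>j. rho_lin u j (trunc N x)) n) has_sum E N) UNIV"
    "E \<longlonglongrightarrow> \<rho> n"
proof -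
  have q0: "cq \<rho> N x \<ge> 0" for N x using nn P_pos[of x] by (simp add: cq_def)
  define f where "f N x = mpow (\<lambda>j. rho_lin u j (trunc N x)) n" for N x
  obtain E0 where E0: "\<And>N. ((\<lambda>x. cq \<rho> N x * rpow n x) has_sum E0 N) UNIV"
    and E0_lim: "(\<lambda>N. E0 N / real (Suc N) ^ total n) \<longlonglongrightarrow> \<rho> n"
    using conditional_moments[of \<rho> n, OF r] by blast
  have "\<forall>k. \<exists>E1. (\<forall>N. ((\<lambda>x. cq \<rho> N x * rpow (axis_index z (total n + k)) x) has_sum E1 N) UNIV) \<and>
      (\<lambda>N. E1 N / real (Suc N) ^ (total n + k)) \<longlonglongrightarrow> \<rho> (axis_index z (total n + k))"
  proof
    fix k
    obtain E1 where "\<And>N. ((\<lambda>x. cq \<rho> N x * rpow (axis_index z (total n + k)) x) has_sum E1 N) UNIV"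
      "(\<lambda>N. E1 N / real (Suc N) ^ total (axis_index z (total n + k))) \<longlonglongrightarrow> \<rho> (axis_index z (total n + k))"
      using conditional_moments[of \<rho> "axis_index z (total n + k)", OF r] by blast
    then show "\<exists>E1. (\<forall>N. ((\<lambda>x. cq \<rho> N x * rpow (axis_index z (total n + k)) x) has_sum E1 N) UNIV) \<and>
      (\<lambda>N. E1 N / real (Suc N) ^ (total n + k)) \<longlonglongrightarrow> \<rho> (axis_index z (total n + k))"
      unfolding total_axis_index by blast
  qed
  then have "\<exists>E1. \<forall>k. (\<forall>N. ((\<lambda>x. cq \<rho> N x * rpow (axis_index z (total n + k)) x) has_sum E1 k N) UNIV) \<and>
      (\<lambda>N. E1 k N / real (Suc N) ^ (total n + k)) \<longlonglongrightarrow> \<rho> (axis_index z (total n + k))"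
    by (rule choice)
  then obtain E1 where *: "\<forall>k. (\<forall>N. ((\<lambda>x. cq \<rho> N x * rpow (axis_index z (total n + k)) x) has_sum E1 k N) UNIV) \<and>
      (\<lambda>N. E1 k N / real (Suc N) ^ (total n + k)) \<longlonglongrightarrow> \<rho> (axis_index z (total n + k))" ..
  have E1: "((\<lambda>x. cq \<rho> N x * rpow (axis_index z (total n + k)) x) has_sum E1 k N) UNIV" for k N
    using * by blast
  have E1_lim: "(\<lambda>N. E1 k N / real (Suc N) ^ (total n + k)) \<longlonglongrightarrow> \<rho> (axis_index z (total n + k))" for k
    using * by blast
  define d where "d N x = f N x - rpow n x / real (Suc N) ^ total n" for N x
  have bd: "((\<lambda>x. (1/2) ^ k * (cq \<rho> N x * rpow (axis_index z (total n + k)) x) / real (Suc N) ^ (total n + k))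
      has_sum (1/2) ^ k * E1 k N / real (Suc N) ^ (total n + k)) UNIV" for k N
    by (intro has_sum_divide_const has_sum_cmult_right E1)
  have le: "\<bar>cq \<rho> N x * d N x\<bar> \<le> (1/2) ^ k * (cq \<rho> N x * rpow (axis_index z (total n + k)) x) / real (Suc N) ^ (total n + k)" for k N x
    using mult_left_mono[OF trunc_error[of N x n k] q0[of N x]] q0[of N x]
    by (simp add: d_def f_def abs_mult mult_ac del: of_nat_Suc)
  have ds: "(\<lambda>x. cq \<rho> N x * d N x) summable_on UNIV" for N
    by (rule summable_on_real_comparison[OF has_sum_imp_summable[OF bd[of 0 N]] le])
  define D where "D N = infsum (\<lambda>x. cq \<rho> N x * d N x) UNIV" for N
  have D: "((\<lambda>x. cq \<rho> N x * d N x) has_sum D N) UNIV" for N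
    unfolding D_def by (rule has_sum_infsum[OF ds])
  have Dle: "\<bar>D N\<bar> \<le> (1/2) ^ k * (E1 k N / real (Suc N) ^ (total n + k))" for k N
    using has_sum_abs_le[OF D bd le] by simp
  have "D \<longlonglongrightarrow> 0"
  proof (rule LIMSEQ_I)
    fix \<epsilon> :: real assume "\<epsilon> > 0"
    then obtain k where k: "(1/2 :: real) ^ k < \<epsilon> / 2"
      using real_arch_pow_inv[of "\<epsilon> / 2" "1/2"] by auto
    \<comment> \<open>The limit is at most 1, so 2 bounds the moments from some \<open>N\<close> on;
      the tolerance for \<open>(1/2) ^ k\<close> was halved to match.\<close>
    have "\<rho> (axis_index z (total n + k)) < 2" using r[of "axis_index z (total n + k)"] by linarith
    then have "\<forall>\<^sub>F N in sequentially. E1 k N / real (Suc N) ^ (total n + k) < 2"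
      by (rule order_tendstoD(2)[OF E1_lim])
    then obtain N0 where N0: "\<And>N. N \<ge> N0 \<Longrightarrow> E1 k N / real (Suc N) ^ (total n + k) < 2"
      by (auto simp: eventually_sequentially)
    have "norm (D N - 0) < \<epsilon>" if "N \<ge> N0" for N
    proof -
      have "\<bar>D N\<bar> \<le> (1/2) ^ k * 2"
        using Dle[of N k] N0[OF that] by (meson less_imp_le mult_left_mono order_trans zero_le_power zero_le_divide_1_iff zero_le_numeral)
      then show ?thesis using k by simp
    qed
    then show "\<exists>N0. \<forall>N\<ge>N0. norm (D N - 0) < \<epsilon>" by blast
  qed
  then have "(\<lambda>N. D N + E0 N / real (Suc N) ^ total n) \<longlonglongrightarrow> 0 + \<rho> n"
    by (intro tendsto_add E0_lim)
  moreover have "((\<lambda>x. cq \<rho> N x * f N x) has_sum D N + E0 N / real (Suc N) ^ total n) UNIV" for N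
    using has_sum_add[OF D[of N] has_sum_divide_const[OF E0[of N], of "real (Suc N) ^ total n"]]
    by (simp add: d_def right_diff_distrib del: of_nat_Suc)
  ultimately show ?thesis
    using that[of "\<lambda>N. D N + E0 N / real (Suc N) ^ total n"] by (simp add: f_def)
qed

text \<open>The weak limit is a priori a measure on the cube only. All its moments of the mass are
  at most 1, since they equal \<open>\<rho>\<close> at multiples of the label \<open>z\<close>, and
  this forces the mass to be at most 1 almost surely.\<close>

lemma representing_measure:
  assumes r: "\<And>n. \<bar>\<rho> n\<bar> \<le> 1" and r0: "\<rho> (\<lambda>_. 0) = 1" and nn: "\<And>x y. kap \<rho> x y \<ge> 0"
  shows "\<exists>(M :: (real^'a) measure) (\<xi> :: real^'a \<Rightarrow> real^'a). simplex_random_vector M \<xi> \<and>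
           (\<forall>n. \<rho> n = (\<integral>\<omega>. (\<Prod>j\<in>UNIV. rho_lin u j (\<xi> \<omega>) ^ n j) \<partial>M))"
proof -
  have q0: "cq \<rho> N x \<ge> 0" for N x using nn P_pos[of x] by (simp add: cq_def)
  have q1: "(cq \<rho> N has_sum 1) UNIV" for N
    using kap_marginal[of \<rho> "axis_index e (Suc N)", OF r r0]
    by (simp add: cq_def[abs_def] kap_sym[of \<rho> "axis_index e (Suc N)"])
  define \<mu> where "\<mu> N = embed_pmf (cq \<rho> N)" for N
  have mu: "pmf (\<mu> N) x = cq \<rho> N x" for N x
    unfolding \<mu>_def by (rule pmf_embed_pmf) (use q0 nn_integral_count_space_has_sum[OF q1] in auto)
  obtain \<nu> :: "(real^'a) measure" and s where nu: "prob_space \<nu>" "sets \<nu> = sets borel" "strict_mono s"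
    and cube: "AE x in \<nu>. \<forall>i. 0 \<le> x $ i \<and> x $ i \<le> 2"
    and lim: "\<forall>f :: real^'a \<Rightarrow> real. continuous_on UNIV f \<longrightarrow>
      (\<lambda>k. measure_pmf.expectation (\<mu> (s k)) (\<lambda>x. f (trunc (s k) x))) \<longlonglongrightarrow> (\<integral>x. f x \<partial>\<nu>)"
    by (rule cube_compactness[of trunc \<mu>, OF trunc_bounds]) (rule that, assumption+)
  interpret \<nu>: prob_space \<nu> by fact
  have moment: "(\<integral>x. mpow (\<lambda>j. rho_lin u j x) n \<partial>\<nu>) = \<rho> n" for n
  proof -
    obtain E where E: "\<And>N. ((\<lambda>x. cq \<rho> N x * mpow (\<lambda>j. rho_lin u j (trunc N x)) n) has_sum E N) UNIV" "E \<longlonglongrightarrow> \<rho> n"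
      using trunc_moments[of \<rho> n, OF r r0 nn] by blast
    have "measure_pmf.expectation (\<mu> N) (\<lambda>x. mpow (\<lambda>j. rho_lin u j (trunc N x)) n) = E N" for N
      by (rule expectation_has_sum[OF mu E(1)])
    then have "(\<lambda>k. E (s k)) \<longlonglongrightarrow> (\<integral>x. mpow (\<lambda>j. rho_lin u j x) n \<partial>\<nu>)"
      using lim[rule_format, OF continuous_on_mpow_rho[of u n]] by simp
    moreover have "(\<lambda>k. E (s k)) \<longlonglongrightarrow> \<rho> n"
      using LIMSEQ_subseq_LIMSEQ[OF E(2) nu(3)] by (simp add: o_def)
    ultimately show ?thesis by (rule LIMSEQ_unique)
  qed
  have meas: "f \<in> borel_measurable \<nu>" if "continuous_on UNIV f" for f :: "real^'a \<Rightarrow> real"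
    using borel_measurable_continuous_onI[OF that] nu(2) by (simp cong: measurable_cong_sets)
  have mass_cont: "continuous_on UNIV (mass :: real^'a \<Rightarrow> real)"
    unfolding mass_def by (intro continuous_intros)
  have mass_pow: "(\<integral>x. mass x ^ k \<partial>\<nu>) \<le> 1" for k
    using moment[of "axis_index z k"] r[of "axis_index z k"] by (simp add: mpow_axis_index rho_lin_z)
  have mass_AE: "AE x in \<nu>. 0 \<le> mass x \<and> mass x \<le> 2 * real CARD('a)"
    using cube
  proof eventually_elim
    case (elim x)
    have "mass x \<le> (\<Sum>i\<in>(UNIV :: 'a set). 2)" unfolding mass_def by (rule sum_mono) (use elim in auto)
    then show ?case using elim by (auto simp: mass_def sum_nonneg)
  qed
  have int: "integrable \<nu> (\<lambda>x. mass x ^ k)" for k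
  proof (rule \<nu>.integrable_const_bound[of _ "(2 * real CARD('a)) ^ k"])
    show "AE x in \<nu>. norm (mass x ^ k) \<le> (2 * real CARD('a)) ^ k"
      using mass_AE
    proof eventually_elim
      case (elim x)
      then have "\<bar>mass x\<bar> ^ k \<le> (2 * real CARD('a)) ^ k" by (intro power_mono) auto
      then show ?case by (simp only: real_norm_def power_abs)
    qed
  qed (intro meas continuous_intros mass_cont)
  have "AE x in \<nu>. mass x < c" if c: "c > 1" for c
  proof -
    have S: "{x \<in> space \<nu>. c \<le> mass x} \<in> sets \<nu>"
      using meas[OF mass_cont] by measurable
    \<comment> \<open>Markov's inequality for the \<open>k\<close>-th power of the mass; letting
      \<open>k\<close> grow gives measure 0 for every \<open>c > 1\<close>.\<close>
    have "measure \<nu> {x \<in> space \<nu>. c \<le> mass x} \<le> (1/c) ^ k" for k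
    proof -
      have "c ^ k * measure \<nu> {x \<in> space \<nu>. c \<le> mass x} = (\<integral>x. c ^ k * indicator {x \<in> space \<nu>. c \<le> mass x} x \<partial>\<nu>)"
        using S by simp
      also have "\<dots> \<le> (\<integral>x. mass x ^ k \<partial>\<nu>)"
      proof (rule integral_mono_AE[OF _ int])
        show "integrable \<nu> (\<lambda>x. c ^ k * indicator {x \<in> space \<nu>. c \<le> mass x} x :: real)"
          using S by (intro integrable_mult_right integrable_real_indicator) (auto simp: \<nu>.emeasure_finite less_top[symmetric])
        show "AE x in \<nu>. c ^ k * indicator {x \<in> space \<nu>. c \<le> mass x} x \<le> mass x ^ k"
          using mass_AE by eventually_elim (use c in \<open>auto simp: indicator_def intro!: power_mono\<close>)
      qed
      also have "\<dots> \<le> 1" by (rule mass_pow)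
      finally show ?thesis using c by (simp add: power_one_over field_simps)
    qed
    moreover have "(\<lambda>k. (1/c) ^ k) \<longlonglongrightarrow> 0" using c by (intro LIMSEQ_power_zero) simp
    ultimately have "measure \<nu> {x \<in> space \<nu>. c \<le> mass x} \<le> 0"
      by (intro LIMSEQ_le_const) auto
    then have "measure \<nu> {x \<in> space \<nu>. c \<le> mass x} = 0" by (simp add: measure_le_0_iff)
    then have "{x \<in> space \<nu>. c \<le> mass x} \<in> null_sets \<nu>"
      using S by (simp add: null_sets_def \<nu>.emeasure_eq_measure)
    then show ?thesis by (rule AE_I') auto
  qed
  then have "AE x in \<nu>. \<forall>k. mass x < 1 + 1 / real (Suc k)"
    by (subst AE_all_countable) auto
  then have simplex: "AE x in \<nu>. x \<in> unit_simplex"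
    using cube
  proof eventually_elim
    case (elim x)
    have "mass x \<le> 1 + \<epsilon>" if "\<epsilon> > 0" for \<epsilon>
    proof -
      obtain k where k: "1 / real (Suc k) < \<epsilon>" by (rule nat_approx_posE[where 'a = real, OF \<open>\<epsilon> > 0\<close>])
      have "mass x < 1 + 1 / real (Suc k)" using elim(1) by blast
      with k show ?thesis by linarith
    qed
    then have "mass x \<le> 1" by (rule field_le_epsilon)
    then show ?case using elim(2) by (simp add: unit_simplex_def mass_def)
  qed
  \<comment> \<open>The identity, altered on a null set, because membership in the simplex is
    demanded at every point.\<close>
  define \<xi> :: "real^'a \<Rightarrow> real^'a" where "\<xi> x = (if x \<in> unit_simplex then x else 0)" for x
  have cl: "closed (unit_simplex :: (real^'a) set)"
    unfolding unit_simplex_def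
    by (intro closed_Collect_all closed_Collect_conj closed_Collect_le continuous_intros)
  have "\<xi> \<in> borel_measurable borel"
    unfolding \<xi>_def using cl by (intro measurable_If_set) auto
  then have xm: "\<xi> \<in> borel_measurable \<nu>" using nu(2) by (simp cong: measurable_cong_sets)
  have xs: "\<xi> x \<in> unit_simplex" for x by (auto simp: \<xi>_def unit_simplex_def)
  have "\<rho> n = (\<integral>x. (\<Prod>j\<in>UNIV. rho_lin u j (\<xi> x) ^ n j) \<partial>\<nu>)" for n
  proof -
    have "(\<integral>x. mpow (\<lambda>j. rho_lin u j (\<xi> x)) n \<partial>\<nu>) = (\<integral>x. mpow (\<lambda>j. rho_lin u j x) n \<partial>\<nu>)"
    proof (rule integral_cong_AE)
      show "(\<lambda>x. mpow (\<lambda>j. rho_lin u j (\<xi> x)) n) \<in> borel_measurable \<nu>"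
        by (rule measurable_compose[OF xm borel_measurable_continuous_onI[OF continuous_on_mpow_rho]])
      show "(\<lambda>x. mpow (\<lambda>j. rho_lin u j x) n) \<in> borel_measurable \<nu>"
        by (rule meas[OF continuous_on_mpow_rho])
      show "AE x in \<nu>. mpow (\<lambda>j. rho_lin u j (\<xi> x)) n = mpow (\<lambda>j. rho_lin u j x) n"
        using simplex by eventually_elim (simp add: \<xi>_def)
    qed
    then show ?thesis using moment[of n] by (simp add: mpow_def)
  qed
  then show ?thesis
    using nu(1) xm xs by (intro exI[of _ \<nu>] exI[of _ \<xi>]) (simp add: simplex_random_vector_def)
qed

end

text \<open>The correlation property is a premise of the first two claims, as part of the notion of
  a Lancaster expansion, and a consequence of the pair condition in the last two.\<close>

theorem theorem5:
  fixes \<theta> :: real and p :: "real^'d::finite" and u :: "'d \<Rightarrow> real^'d" and a :: "'d \<Rightarrow> real"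
    and z e :: 'd and \<rho> :: "('d \<Rightarrow> nat) \<Rightarrow> real"
  assumes "CARD('d) \<ge> 2"
    and "\<theta> > 0"
    and "\<forall>i. p $ i > 0" and "(\<Sum>i\<in>UNIV. p $ i) = 1"
    and "orthogonal_basis p u a z e"
    and "\<forall>j k l. hypergroup_s u a j k l \<ge> 0"
    and "\<rho> (\<lambda>_. 0) = 1"
  shows
    "(\<forall>\<alpha>>0. lancaster_nonneg \<theta> p u a z \<rho> \<alpha> \<and> lancaster_correlations \<theta> p u a z \<rho> \<alpha> \<longrightarrow>
        (\<exists>J. bivariate_nb \<alpha> \<theta> p J \<and> (\<forall>x y. pmf J (x, y) = lancaster \<theta> p u a z \<rho> \<alpha> x y)))
     \<and>
     ((\<forall>\<alpha>>0. lancaster_nonneg \<theta> p u a z \<rho> \<alpha> \<and> lancaster_correlations \<theta> p u a z \<rho> \<alpha>) \<longrightarrow>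
        (\<exists>(M :: (real^'d) measure) (\<xi> :: real^'d \<Rightarrow> real^'d). simplex_random_vector M \<xi> \<and>
           (\<forall>n. \<rho> n = (\<integral>\<omega>. (\<Prod>j\<in>UNIV. rho_lin u j (\<xi> \<omega>) ^ n j) \<partial>M))))
     \<and>
     (\<forall>\<xi>\<in>unit_simplex. (\<forall>n. \<rho> n = (\<Prod>j\<in>UNIV. rho_lin u j \<xi> ^ n j)) \<longrightarrow>
        ((\<forall>\<alpha>>0. lancaster_nonneg \<theta> p u a z \<rho> \<alpha>) \<longleftrightarrow> pair_condition \<theta> p u a \<xi>) \<and>
        (pair_condition \<theta> p u a \<xi> \<longrightarrow> (\<forall>\<alpha>>0. lancaster_correlations \<theta> p u a z \<rho> \<alpha>)))
     \<and>
     (\<forall>(M :: 'w measure) (\<xi> :: 'w \<Rightarrow> real^'d).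
        simplex_random_vector M \<xi> \<and>
        (\<forall>n. \<rho> n = (\<integral>\<omega>. (\<Prod>j\<in>UNIV. rho_lin u j (\<xi> \<omega>) ^ n j) \<partial>M)) \<and>
        (AE \<omega> in M. pair_condition \<theta> p u a (\<xi> \<omega>)) \<longrightarrow>
        (\<forall>\<alpha>>0. lancaster_nonneg \<theta> p u a z \<rho> \<alpha> \<and> lancaster_correlations \<theta> p u a z \<rho> \<alpha>))"
proof -
  interpret meixner_basis \<theta> p u a z e
    by unfold_locales (use assms in auto)
  have sys: "meixner_system \<theta> p u a z e \<alpha>" if "\<alpha> > 0" for \<alpha>
    by unfold_locales (rule that)
  note r0 = assms(7)
  show ?thesis
  proof (intro conjI, goal_cases)
    case 1
    show ?case
    proof (intro allI impI, elim conjE)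
      fix \<alpha> :: real
      assume "\<alpha> > 0" "lancaster_nonneg \<theta> p u a z \<rho> \<alpha>" "lancaster_correlations \<theta> p u a z \<rho> \<alpha>"
      then show "\<exists>J. bivariate_nb \<alpha> \<theta> p J \<and> (\<forall>x y. pmf J (x, y) = lancaster \<theta> p u a z \<rho> \<alpha> x y)"
        by (intro meixner_system.lancaster_pmf[OF sys] r0)
    qed
  next
    case 2
    show ?case
    proof
      assume H: "\<forall>\<alpha>>0. lancaster_nonneg \<theta> p u a z \<rho> \<alpha> \<and> lancaster_correlations \<theta> p u a z \<rho> \<alpha>"
      \<comment> \<open>The representing measure is constructed inside one system; 1 is an arbitrary
        choice of \<open>\<alpha>\<close>.\<close>
      interpret ms: meixner_system \<theta> p u a z e 1 by (rule sys) simp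
      have H1: "lancaster_nonneg \<theta> p u a z \<rho> 1" "lancaster_correlations \<theta> p u a z \<rho> 1"
        using H by auto
      have r: "\<bar>\<rho> n\<bar> \<le> 1" for n by (rule ms.abs_rho_le_1[OF H1 r0])
      have "ms.kap \<rho> x y \<ge> 0" for x y
        using ms.lancaster_nonneg_iff[of \<rho>, OF r r0] H1(1) by blast
      then show "\<exists>(M :: (real^'d) measure) (\<xi> :: real^'d \<Rightarrow> real^'d). simplex_random_vector M \<xi> \<and>
           (\<forall>n. \<rho> n = (\<integral>\<omega>. (\<Prod>j\<in>UNIV. rho_lin u j (\<xi> \<omega>) ^ n j) \<partial>M))"
        by (intro ms.representing_measure r r0)
    qed
  next
    case 3
    show ?case
    proof (intro ballI impI)
      fix \<xi> :: "real^'d"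
      assume xi: "\<xi> \<in> unit_simplex" and "\<forall>n. \<rho> n = (\<Prod>j\<in>UNIV. rho_lin u j \<xi> ^ n j)"
      then have rho: "\<rho> = mpow (\<lambda>j. rho_lin u j \<xi>)" by (auto simp: mpow_def)
      have r: "\<bar>\<rho> n\<bar> \<le> 1" for n unfolding rho by (rule abs_mpow_rho_le[OF xi])
      have iff: "lancaster_nonneg \<theta> p u a z \<rho> \<alpha> \<longleftrightarrow> (\<forall>x y. meixner_system.kap \<theta> u a z \<alpha> \<rho> x y \<ge> 0)" if "\<alpha> > 0" for \<alpha>
        by (rule meixner_system.lancaster_nonneg_iff[where \<rho> = \<rho>, OF sys[OF that] r r0])
      have pos: "meixner_system.kap \<theta> u a z \<alpha> \<rho> x y \<ge> 0" if "pair_condition \<theta> p u a \<xi>" "\<alpha> > 0" for \<alpha> x y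
        unfolding rho by (rule meixner_system.kap_nonneg_of_condition[OF sys[OF that(2)] xi that(1)])
      have "pair_condition \<theta> p u a \<xi>" if "\<forall>\<alpha>>0. lancaster_nonneg \<theta> p u a z \<rho> \<alpha>"
        by (rule condition_of_nonneg[OF xi]) (use that iff in \<open>auto simp: rho\<close>)
      moreover have "lancaster_nonneg \<theta> p u a z \<rho> \<alpha>" "lancaster_correlations \<theta> p u a z \<rho> \<alpha>"
        if "pair_condition \<theta> p u a \<xi>" "\<alpha> > 0" for \<alpha>
      proof -
        show "lancaster_nonneg \<theta> p u a z \<rho> \<alpha>" using pos[OF that] iff[OF that(2)] by blast
        show "lancaster_correlations \<theta> p u a z \<rho> \<alpha>"
          by (rule meixner_system.correlations_of_nonneg[where \<rho> = \<rho>, OF sys[OF that(2)] r r0 pos[OF that]])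
      qed
      ultimately show "((\<forall>\<alpha>>0. lancaster_nonneg \<theta> p u a z \<rho> \<alpha>) \<longleftrightarrow> pair_condition \<theta> p u a \<xi>) \<and>
        (pair_condition \<theta> p u a \<xi> \<longrightarrow> (\<forall>\<alpha>>0. lancaster_correlations \<theta> p u a z \<rho> \<alpha>))"
        by blast
    qed
  next
    case 4
    show ?case
    proof (intro allI impI, elim conjE)
      fix M :: "'w measure" and \<xi> :: "'w \<Rightarrow> real^'d" and \<alpha> :: real
      assume "simplex_random_vector M \<xi>" and pc: "AE \<omega> in M. pair_condition \<theta> p u a (\<xi> \<omega>)" and al: "\<alpha> > 0"
        and rho: "\<forall>n. \<rho> n = (\<integral>\<omega>. (\<Prod>j\<in>UNIV. rho_lin u j (\<xi> \<omega>) ^ n j) \<partial>M)"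
      then have M: "prob_space M" "\<xi> \<in> borel_measurable M" "\<And>\<omega>. \<omega> \<in> space M \<Longrightarrow> \<xi> \<omega> \<in> unit_simplex"
        by (auto simp: simplex_random_vector_def)
      interpret ms: meixner_system \<theta> p u a z e \<alpha> by (rule sys[OF al])
      have rho': "\<rho> n = (\<integral>\<omega>. mpow (\<lambda>j. rho_lin u j (\<xi> \<omega>)) n \<partial>M)" for n
        using rho by (simp add: mpow_def)
      have ae: "AE \<omega> in M. ms.kap (mpow (\<lambda>j. rho_lin u j (\<xi> \<omega>))) x y \<ge> 0" for x y
        using pc AE_space by eventually_elim (rule ms.kap_nonneg_of_condition[OF M(3)])
      have r: "\<bar>\<rho> n\<bar> \<le> 1" for n by (rule ms.kap_mixture_nonneg(1)[OF M rho' ae])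
      have k: "ms.kap \<rho> x y \<ge> 0" for x y by (rule ms.kap_mixture_nonneg(2)[OF M rho' ae])
      show "lancaster_nonneg \<theta> p u a z \<rho> \<alpha> \<and> lancaster_correlations \<theta> p u a z \<rho> \<alpha>"
        using ms.lancaster_nonneg_iff[of \<rho>, OF r r0] k ms.correlations_of_nonneg[of \<rho>, OF r r0 k] by blast
    qed
  qed
qed

end
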